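(* Let $d\ge1$, $p\in(1,2)$ and $s=d(2/p-1)$. Then the Fourier transform $\mathcal{F}\colon\dot W^p_s(\mathbb{R}^d)\to L^p(\mathbb{R}^d)$ is bounded, i.e. there is a constant $C>0$ such that for every $[f]\in\dot W^p_s(\mathbb{R}^d)$ there is a (necessarily unique) $g\in L^p(\mathbb{R}^d)$ such that $\hat f-g$ is supported in $\{0\}$, and $\|g\|_{L^p}\le C\|f\|_{\dot W^p_s}$.
   Context: $\mathcal{S}$ is the Schwartz space on $\mathbb{R}^d$, $\mathcal{S}'$ the tempered distributions, $\mathcal{P}$ the space of polynomials; $[f]$ denotes the class of $f\in\mathcal{S}'$ in $\mathcal{S}'/\mathcal{P}$. The Fourier transform is $\hat f(\xi)=\mathcal{F}f(\xi)=\int_{\mathbb{R}^d}f(x)e^{-2\pi i x\cdot\xi}\,dx$ on $\mathcal{S}$, extended to $\mathcal{S}'$ by $\langle\hat f,g\rangle=\langle f,\hat g\rangle$. Since $\mathcal{F}$ maps $\mathcal{P}$ onto the distributions supported in $\{0\}$, the Fourier transform of a class in $\mathcal{S}'/\mathcal{P}$ is determined modulo distributions supported in $\{0\}$. Fix $\varphi\in\mathcal{S}$ with $\hat\varphi$ radially decreasing, $\hat\varphi(\xi)=1$ for $|\xi|\le1$, $\hat\varphi(\xi)=0$ for $|\xi|\ge2$. Define $\varphi_k$, $k\in\mathbb{Z}$, by $\hat\varphi_0(\xi)=\hat\varphi(\xi/2)-\hat\varphi(\xi)$ and $\hat\varphi_k(\xi)=\hat\varphi_0(2^{-k}\xi)$.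 For $1<p<\infty$ and $s\in\mathbb{R}$, the homogeneous Sobolev space is $\dot W^p_s=\{[f]\in\mathcal{S}'/\mathcal{P}:\|f\|_{\dot W^p_s}<\infty\}$ with norm $\|f\|_{\dot W^p_s}=\left\|\left(\sum_{k\in\mathbb{Z}}|2^{ks}(\varphi_k*f)|^2\right)^{1/2}\right\|_{L^p}$ (different choices of $\varphi$ give equivalent norms). *)

theory Defs
  imports "HOL-Analysis.Analysis"
begin

text \<open>\<open>iter_partial [b\<^sub>1, \<dots>, b\<^sub>m] f\<close> is \<open>\<partial>\<^bsub>b\<^sub>1\<^esub> \<cdots> \<partial>\<^bsub>b\<^sub>m\<^esub> f\<close>.\<close>

primrec iter_partial :: "'a::euclidean_space list \<Rightarrow> ('a \<Rightarrow> complex) \<Rightarrow> 'a \<Rightarrow> complex" where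
  "iter_partial [] f = f"
| "iter_partial (b # bs) f = (\<lambda>x. frechet_derivative (iter_partial bs f) (at x) b)"

definition schwartz :: "('a::euclidean_space \<Rightarrow> complex) set" where
  "schwartz = {f. \<forall>bs. set bs \<subseteq> Basis \<longrightarrow>
     iter_partial bs f differentiable_on UNIV \<and>
     (\<forall>m::nat. bounded (range (\<lambda>x. norm x ^ m *\<^sub>R iter_partial bs f x)))}"

definition schwartz_seminorm ::
    "nat \<Rightarrow> 'a::euclidean_space list \<Rightarrow> ('a \<Rightarrow> complex) \<Rightarrow> real" where
  "schwartz_seminorm m bs f = (SUP x. norm x ^ m * norm (iter_partial bs f x))"

text \<open>
  A tempered distribution is a linear functional on the Schwartz space that is continuous for the
  topology given by the seminorms above, that is, bounded by a finite sum of them. Functionals are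
  total functions here; their values outside \<^const>\<open>schwartz\<close> are arbitrary and never used.
\<close>

definition tempered :: "(('a::euclidean_space \<Rightarrow> complex) \<Rightarrow> complex) set" where
  "tempered = {u.
     (\<forall>f\<in>schwartz. \<forall>g\<in>schwartz. u (\<lambda>x. f x + g x) = u f + u g) \<and>
     (\<forall>f\<in>schwartz. \<forall>c. u (\<lambda>x. c * f x) = c * u f) \<and>
     (\<exists>C N. \<forall>f\<in>schwartz. norm (u f) \<le>
        C * (\<Sum>m\<le>N. \<Sum>bs | set bs \<subseteq> Basis \<and> length bs \<le> N. schwartz_seminorm m bs f))}"

definition fun_distr :: "('a::euclidean_space \<Rightarrow> complex) \<Rightarrow> ('a \<Rightarrow> complex) \<Rightarrow> complex" where
  "fun_distr g = (\<lambda>f. \<integral>x. g x * f x \<partial>lborel)"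

definition distr_support ::
    "(('a::euclidean_space \<Rightarrow> complex) \<Rightarrow> complex) \<Rightarrow> 'a set" where
  "distr_support u = - \<Union>{U. open U \<and>
     (\<forall>f\<in>schwartz. compact (closure {x. f x \<noteq> 0}) \<and> closure {x. f x \<noteq> 0} \<subseteq> U \<longrightarrow> u f = 0)}"

text \<open>
  The relation \<open>u - v \<in> \<P>\<close> on tempered distributions; the quotient \<open>\<S>'/\<P>\<close> is
  \<open>tempered // mod_poly\<close>, and the class \<open>[f]\<close> is \<open>mod_poly `` {f}\<close>.
\<close>

definition mod_poly :: "(('a::euclidean_space \<Rightarrow> complex) \<Rightarrow> complex) rel" where
  "mod_poly = {(u, v). u \<in> tempered \<and> v \<in> tempered \<and>
     (\<exists>P. polynomial_function P \<and> (\<forall>f\<in>schwartz. u f - v f = fun_distr P f))}"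

definition fourier :: "('a::euclidean_space \<Rightarrow> complex) \<Rightarrow> 'a \<Rightarrow> complex" where
  "fourier f \<xi> = (\<integral>x. f x * cis (- 2 * pi * (x \<bullet> \<xi>)) \<partial>lborel)"

definition fourier_distr ::
    "(('a::euclidean_space \<Rightarrow> complex) \<Rightarrow> complex) \<Rightarrow> ('a \<Rightarrow> complex) \<Rightarrow> complex" where
  "fourier_distr u = (\<lambda>f. u (fourier f))"

definition conv_distr ::
    "('a::euclidean_space \<Rightarrow> complex) \<Rightarrow> (('a \<Rightarrow> complex) \<Rightarrow> complex) \<Rightarrow> 'a \<Rightarrow> complex" where
  "conv_distr \<psi> u x = u (\<lambda>y. \<psi> (x - y))"

text \<open>Extended power, intended for exponents \<open>a > 0\<close> only.\<close>

definition epowr :: "ennreal \<Rightarrow> real \<Rightarrow> ennreal" where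
  "epowr x a = (if x = \<infinity> then \<infinity> else ennreal (enn2real x powr a))"

definition eLp_norm :: "real \<Rightarrow> ('a::euclidean_space \<Rightarrow> ennreal) \<Rightarrow> ennreal" where
  "eLp_norm p h = epowr (\<integral>\<^sup>+x. epowr (h x) p \<partial>lborel) (1 / p)"

definition Lp_norm :: "real \<Rightarrow> ('a::euclidean_space \<Rightarrow> complex) \<Rightarrow> ennreal" where
  "Lp_norm p g = eLp_norm p (\<lambda>x. ennreal (norm (g x)))"

definition Lp :: "real \<Rightarrow> ('a::euclidean_space \<Rightarrow> complex) set" where
  "Lp p = {g \<in> borel_measurable lborel. Lp_norm p g < \<infinity>}"

definition lp_generator :: "('a::euclidean_space \<Rightarrow> complex) \<Rightarrow> bool" where
  "lp_generator \<phi> \<longleftrightarrow> \<phi> \<in> schwartz \<and>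
     (\<exists>h::real \<Rightarrow> real. antimono_on {0..} h \<and> (\<forall>\<xi>. fourier \<phi> \<xi> = of_real (h (norm \<xi>)))) \<and>
     (\<forall>\<xi>. norm \<xi> \<le> 1 \<longrightarrow> fourier \<phi> \<xi> = 1) \<and>
     (\<forall>\<xi>. norm \<xi> \<ge> 2 \<longrightarrow> fourier \<phi> \<xi> = 0)"

definition lp_symbol :: "('a::euclidean_space \<Rightarrow> complex) \<Rightarrow> 'a \<Rightarrow> complex" where
  "lp_symbol \<phi> \<xi> = fourier \<phi> (\<xi> /\<^sub>R 2) - fourier \<phi> \<xi>"

text \<open>
  The Littlewood--Paley piece \<open>\<phi>\<^sub>k\<close> is specified by its Fourier transform, which determines a
  Schwartz function uniquely. It exists: it is \<open>2\<^sup>k\<^sup>d \<phi>\<^sub>0(2\<^sup>k x)\<close> with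
  \<open>\<phi>\<^sub>0(x) = 2\<^sup>d \<phi>(2x) - \<phi>(x)\<close>.
\<close>

definition lp_piece :: "('a::euclidean_space \<Rightarrow> complex) \<Rightarrow> int \<Rightarrow> 'a \<Rightarrow> complex" where
  "lp_piece \<phi> k = (THE \<psi>. \<psi> \<in> schwartz \<and>
     (\<forall>\<xi>. fourier \<psi> \<xi> = lp_symbol \<phi> ((2 powi (- k)) *\<^sub>R \<xi>)))"

definition sobolev_norm ::
    "('a::euclidean_space \<Rightarrow> complex) \<Rightarrow> real \<Rightarrow> real \<Rightarrow> (('a \<Rightarrow> complex) \<Rightarrow> complex) \<Rightarrow> ennreal" where
  "sobolev_norm \<phi> p s f = eLp_norm p (\<lambda>x. epowr
     (\<Sum>\<^sub>\<infinity>k::int. ennreal ((norm (of_real (2 powr (of_int k * s)) * conv_distr (lp_piece \<phi> k) f x))\<^sup>2))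
     (1 / 2))"

definition homog_sobolev ::
    "('a::euclidean_space \<Rightarrow> complex) \<Rightarrow> real \<Rightarrow> real \<Rightarrow> (('a \<Rightarrow> complex) \<Rightarrow> complex) set set" where
  "homog_sobolev \<phi> p s = {mod_poly `` {f} | f. f \<in> tempered \<and> sobolev_norm \<phi> p s f < \<infinity>}"

end

theory Submission
  imports Defs
begin

text \<open>
  No Calderon--Zygmund theory is needed. Write \<open>G\<^sub>k = 2\<^sup>k\<^sup>s (\<phi>\<^sub>k * f)\<close> and \<open>M = sup\<^sub>k |G\<^sub>k|\<close>, which is dominated
  by the square function. By Hoelder's inequality on an annulus and Plancherel's theorem the \<open>L\<^sup>p\<close> norm
  of the transform of \<open>f\<close> is controlled by \<open>\<Sum>\<^sub>k 2\<^bsup>-kd(1-p/2)\<^esup> \<parallel>G\<^sub>k\<parallel>\<^sub>2\<^sup>p\<close>, and it remains to bound this by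
  \<open>\<parallel>M\<parallel>\<^sub>p\<^sup>p\<close> (a Franke--Jawerth embedding). Since \<open>G\<^sub>k\<close> is reproduced by convolution with an \<open>L\<^sup>1\<close>-normalized
  dilate of \<open>\<phi>\<close> of height \<open>\<sim> 2\<^sup>k\<^sup>d\<close>, one has \<open>\<parallel>G\<^sub>k\<parallel>\<^sub>\<infinity> \<lesssim> \<lambda>\<close> as soon as the set where \<open>M > \<lambda>\<close> has measure at
  most \<open>c 2\<^sup>-\<^sup>k\<^sup>d\<close>. Summing over dyadic heights \<open>\<lambda>\<close> then gives two geometric series.

  Fourier inversion is used only up to a positive constant. For Schwartz \<open>f\<close> and \<open>\<eta>\<close>, dilating \<open>\<eta>\<close> in the
  multiplication formula gives \<open>\<eta>(0) \<integral> F f = f(0) \<integral> F \<eta>\<close>, so that no Gaussian is required.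
\<close>

subsection \<open>Schwartz functions by finite orders of differentiability\<close>

text \<open>The value of \<open>s\<close> balances the powers of \<open>2^k\<close>. Hoelder on an
  annulus of measure about \<open>2^(kd)\<close> costs \<open>2^(kd(1-p/2))\<close> in the p-th
  power, and removing the weight \<open>2^(ks)\<close> costs
  \<open>2^(-ksp) = 2^(-2kd(1-p/2))\<close>, because \<open>sp = 2d(1-p/2)\<close>; the product is
  the weight of the overview. The range \<open>p < 2\<close> acts twice: \<open>1 - p/2 > 0\<close>
  makes the sum over frequencies at a fixed height geometric, and \<open>p/2 < 1\<close> makes
  \<open>t^(p/2)\<close> subadditive, so that heights can be estimated one at a time. The analytic
  obstacle is that a tempered distribution is only a functional bounded by finitely many seminorms.
  Both the reproducing formula for its pieces and the identification of its transform on an annulus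
  rest on exchanging it with an integral of translates (\<open>tempered_integral\<close>). Since a
  class is taken modulo polynomials, nothing controls the transform at the origin: the function is
  glued on the complement of 0, and the representatives of a class are compared there.\<close>

definition rapid :: "('a::real_normed_vector \<Rightarrow> 'b::real_normed_vector) \<Rightarrow> bool" where
  "rapid f \<longleftrightarrow> (\<forall>m::nat. \<exists>C. \<forall>x. norm x ^ m * norm (f x) \<le> C)"

definition pd :: "'a::euclidean_space \<Rightarrow> ('a \<Rightarrow> complex) \<Rightarrow> 'a \<Rightarrow> complex" where
  "pd b f = (\<lambda>x. frechet_derivative f (at x) b)"

text \<open>\<open>iter_partial\<close> adds derivatives on the outside, whereas this recursion
  removes the innermost one. A closure property thereby becomes an induction on the order with the
  function generalised: a partial derivative of the compound is built from compounds of the same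
  shape at one order less.\<close>

primrec schwartz_upto :: "nat \<Rightarrow> ('a::euclidean_space \<Rightarrow> complex) \<Rightarrow> bool" where
  "schwartz_upto 0 f \<longleftrightarrow> f differentiable_on UNIV \<and> rapid f"
| "schwartz_upto (Suc n) f \<longleftrightarrow>
     f differentiable_on UNIV \<and> rapid f \<and> (\<forall>b\<in>Basis. schwartz_upto n (pd b f))"

lemma iter_partial_snoc: "iter_partial (bs @ [b]) f = iter_partial bs (pd b f)"
  by (induction bs) (auto simp: pd_def)

lemma bounded_range_rapid:
  "(\<forall>m::nat. bounded (range (\<lambda>x. norm x ^ m *\<^sub>R f x))) \<longleftrightarrow> rapid f"
  by (auto simp: rapid_def bounded_iff)

lemma schwartz_upto_iff:
  "schwartz_upto n f \<longleftrightarrow> (\<forall>bs. set bs \<subseteq> Basis \<and> length bs \<le> n \<longrightarrow>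
     iter_partial bs f differentiable_on UNIV \<and> rapid (iter_partial bs f))"
proof (induction n arbitrary: f)
  case 0
  then show ?case by auto
next
  case (Suc n)
  show ?case (is "?L \<longleftrightarrow> ?R")
  proof
    assume L: ?L
    show ?R
    proof (intro allI impI)
      fix bs :: "'a list" assume bs: "set bs \<subseteq> Basis \<and> length bs \<le> Suc n"
      show "iter_partial bs f differentiable_on UNIV \<and> rapid (iter_partial bs f)"
      proof (cases bs rule: rev_cases)
        case Nil
        then show ?thesis using L by auto
      next
        case (snoc cs c)
        then have "schwartz_upto n (pd c f)" "set cs \<subseteq> Basis \<and> length cs \<le> n" using L bs by auto
        then show ?thesis using Suc snoc by (auto simp: iter_partial_snoc)
      qed
    qed
  next
    assume R: ?R
    have "f differentiable_on UNIV \<and> rapid f" using R[rule_format, of "[]"] by simp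
    moreover have "schwartz_upto n (pd b f)" if "b \<in> Basis" for b
      unfolding Suc
    proof (intro allI impI)
      fix bs :: "'a list" assume bs: "set bs \<subseteq> Basis \<and> length bs \<le> n"
      then show "iter_partial bs (pd b f) differentiable_on UNIV \<and> rapid (iter_partial bs (pd b f))"
        using R[rule_format, of "bs @ [b]"] that by (simp add: iter_partial_snoc)
    qed
    ultimately show ?L by auto
  qed
qed

lemma schwartz_iff_upto: "f \<in> schwartz \<longleftrightarrow> (\<forall>n. schwartz_upto n f)"
proof -
  have "f \<in> schwartz \<longleftrightarrow> (\<forall>bs. set bs \<subseteq> Basis \<longrightarrow>
      iter_partial bs f differentiable_on UNIV \<and> rapid (iter_partial bs f))"
    unfolding schwartz_def bounded_range_rapid by simp
  also have "\<dots> \<longleftrightarrow> (\<forall>n. schwartz_upto n f)"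
    unfolding schwartz_upto_iff by blast
  finally show ?thesis .
qed

lemma schwartz_rapid: "f \<in> schwartz \<Longrightarrow> rapid f"
  and schwartz_differentiable_on: "f \<in> schwartz \<Longrightarrow> f differentiable_on UNIV"
  by (auto simp: schwartz_iff_upto dest: spec[of _ 0])

lemma schwartz_pd: "f \<in> schwartz \<Longrightarrow> b \<in> Basis \<Longrightarrow> pd b f \<in> schwartz"
  unfolding schwartz_iff_upto using schwartz_upto.simps(2) by blast

lemma schwartz_iter_partial: "f \<in> schwartz \<Longrightarrow> set bs \<subseteq> Basis \<Longrightarrow> iter_partial bs f \<in> schwartz"
  by (induction bs) (auto simp flip: pd_def intro: schwartz_pd)

lemma schwartz_has_derivative:
  "f \<in> schwartz \<Longrightarrow> (f has_derivative (\<lambda>h. frechet_derivative f (at x) h)) (at x)"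
  using schwartz_differentiable_on frechet_derivative_works by (auto simp: differentiable_on_def)

lemma schwartz_has_derivative_pd:
  assumes "f \<in> schwartz"
  shows "(f has_derivative (\<lambda>h. \<Sum>b\<in>Basis. (h \<bullet> b) *\<^sub>R pd b f x)) (at x)"
proof -
  have D: "(f has_derivative frechet_derivative f (at x)) (at x)"
    using schwartz_has_derivative[OF assms] .
  interpret bounded_linear "frechet_derivative f (at x)"
    using D by (rule has_derivative_bounded_linear)
  have "frechet_derivative f (at x) h = (\<Sum>b\<in>Basis. (h \<bullet> b) *\<^sub>R pd b f x)" for h
    by (subst euclidean_representation[symmetric, of h]) (simp add: sum scale pd_def del: euclidean_representation)
  then show ?thesis using D by (auto simp: fun_eq_iff elim: has_derivative_eq_rhs)
qed

lemma schwartz_continuous_on: "f \<in> schwartz \<Longrightarrow> continuous_on A f"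
  using schwartz_differentiable_on continuous_on_subset differentiable_imp_continuous_on by blast

lemma schwartz_measurable [measurable_dest]: "f \<in> schwartz \<Longrightarrow> f \<in> borel_measurable borel"
  by (intro borel_measurable_continuous_onI schwartz_continuous_on)

lemma pd_eqI: "(f has_derivative D) (at x) \<Longrightarrow> pd b f x = D b"
  unfolding pd_def using frechet_derivative_at by metis

text \<open>An explicit derivative \<open>D\<close> identifies \<open>pd b f\<close> with
  \<open>\<lambda>x. D x b\<close>, so each closure property below reduces to a differentiation
  rule, a decay estimate and the property at the previous order.\<close>

lemma schwartz_uptoI:
  assumes "\<And>x. (f has_derivative D x) (at x)" "rapid f"
    and "\<And>m b. n = Suc m \<Longrightarrow> b \<in> Basis \<Longrightarrow> schwartz_upto m (\<lambda>x. D x b)"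
  shows "schwartz_upto n f"
proof -
  have "pd b f = (\<lambda>x. D x b)" for b using pd_eqI assms(1) by blast
  then show ?thesis using assms
    by (cases n) (auto simp: differentiable_on_def intro: differentiableI differentiable_at_withinI)
qed

lemma schwartz_upto_mono: "schwartz_upto m f \<Longrightarrow> n \<le> m \<Longrightarrow> schwartz_upto n f"
  unfolding schwartz_upto_iff by auto

lemma schwartz_upto_D:
  assumes "schwartz_upto n f"
  shows "(f has_derivative frechet_derivative f (at x)) (at x)" "rapid f"
  using assms schwartz_upto_mono[OF assms, of 0] frechet_derivative_works
  by (auto simp: differentiable_on_def)

subsection \<open>Rapid decay\<close>

lemma one_plus_power_le: "(1 + t) ^ m \<le> 2 ^ m * (1 + t ^ m)" if "t \<ge> 0" for t :: real
proof -
  have "(1 + t) ^ m \<le> (2 * max 1 t) ^ m" by (intro power_mono) (use that in auto)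
  also have "\<dots> = 2 ^ m * max 1 t ^ m" by (simp add: power_mult_distrib)
  also have "\<dots> \<le> 2 ^ m * (1 + t ^ m)" using that by (auto simp: max_def)
  finally show ?thesis .
qed

lemma rapidD:
  assumes "rapid f"
  obtains C where "C \<ge> 0" "\<And>x. (1 + norm x) ^ m * norm (f x) \<le> C"
proof -
  from assms obtain C0 Cm where C: "\<And>x. norm x ^ 0 * norm (f x) \<le> C0" "\<And>x. norm x ^ m * norm (f x) \<le> Cm"
    unfolding rapid_def by metis
  have "(1 + norm x) ^ m * norm (f x) \<le> 2 ^ m * (C0 + Cm)" for x
  proof -
    have "(1 + norm x) ^ m * norm (f x) \<le> (2 ^ m * (1 + norm x ^ m)) * norm (f x)"
      by (intro mult_right_mono one_plus_power_le) auto
    also have "\<dots> = 2 ^ m * (norm x ^ 0 * norm (f x) + norm x ^ m * norm (f x))"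
      by (simp add: algebra_simps)
    also have "\<dots> \<le> 2 ^ m * (C0 + Cm)" using C[of x] by (intro mult_left_mono) auto
    finally show ?thesis .
  qed
  moreover from this[of 0] have "0 \<le> 2 ^ m * (C0 + Cm)"
    by (rule order_trans[rotated]) auto
  ultimately show ?thesis using that by blast
qed

lemma rapidI:
  assumes "\<And>m. \<exists>C. \<forall>x. (1 + norm x) ^ m * norm (f x) \<le> C"
  shows "rapid f"
  unfolding rapid_def
proof
  fix m
  from assms obtain C where C: "\<And>x. (1 + norm x) ^ m * norm (f x) \<le> C" by blast
  have "norm x ^ m * norm (f x) \<le> C" for x
    by (rule order_trans[OF _ C[of x]]) (intro mult_right_mono power_mono, auto)
  then show "\<exists>C. \<forall>x. norm x ^ m * norm (f x) \<le> C" by blast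
qed

lemma rapid_bound:
  assumes "rapid f" "\<And>x. norm (g x) \<le> K * (1 + norm x) ^ j * norm (f x)" "K \<ge> 0"
  shows "rapid g"
proof (rule rapidI)
  fix m
  obtain C where C: "C \<ge> 0" "\<And>x. (1 + norm x) ^ (m + j) * norm (f x) \<le> C" using rapidD[OF assms(1)] by metis
  have "(1 + norm x) ^ m * norm (g x) \<le> K * C" for x
  proof -
    have "(1 + norm x) ^ m * norm (g x) \<le> (1 + norm x) ^ m * (K * (1 + norm x) ^ j * norm (f x))"
      by (intro mult_left_mono assms) auto
    also have "\<dots> = K * ((1 + norm x) ^ (m + j) * norm (f x))" by (simp add: power_add)
    also have "\<dots> \<le> K * C" by (intro mult_left_mono C assms)
    finally show ?thesis .
  qed
  then show "\<exists>C. \<forall>x. (1 + norm x) ^ m * norm (g x) \<le> C" by blast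
qed

lemma rapid_add: "rapid f \<Longrightarrow> rapid g \<Longrightarrow> rapid (\<lambda>x. f x + g x)"
proof (rule rapidI)
  fix m assume "rapid f" "rapid g"
  then obtain C D where C: "\<And>x. (1 + norm x) ^ m * norm (f x) \<le> C" "\<And>x. (1 + norm x) ^ m * norm (g x) \<le> D"
    using rapidD by metis
  have "(1 + norm x) ^ m * norm (f x + g x) \<le> C + D" for x
  proof -
    have "(1 + norm x) ^ m * norm (f x + g x) \<le> (1 + norm x) ^ m * (norm (f x) + norm (g x))"
      by (intro mult_left_mono norm_triangle_ineq) auto
    then show ?thesis using C[of x] by (simp add: algebra_simps)
  qed
  then show "\<exists>C. \<forall>x. (1 + norm x) ^ m * norm (f x + g x) \<le> C" by blast
qed

lemma rapid_bounded: assumes "rapid f" obtains C where "C \<ge> 0" "\<And>x. norm (f x) \<le> C"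
  using rapidD[OF assms, of 0] by auto

lemma rapid_mult:
  fixes f g :: "'a::real_normed_vector \<Rightarrow> complex"
  assumes "rapid f" "rapid g" shows "rapid (\<lambda>x. f x * g x)"
proof -
  obtain C where C: "C \<ge> 0" "\<And>x. norm (f x) \<le> C" using rapid_bounded[OF assms(1)] by blast
  show ?thesis
    by (rule rapid_bound[OF assms(2), of _ C 0]) (use C in \<open>auto simp: norm_mult intro: mult_right_mono\<close>)
qed

lemma rapid_cmult: "rapid f \<Longrightarrow> rapid (\<lambda>x. c * f x)" for f :: "'a::real_normed_vector \<Rightarrow> complex"
  by (erule rapid_bound[of _ _ "norm c" 0]) (auto simp: norm_mult)

lemma rapid_inner: "rapid f \<Longrightarrow> rapid (\<lambda>x. of_real (x \<bullet> a) * f x)" for f :: "'a::euclidean_space \<Rightarrow> complex"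
proof (erule rapid_bound[of _ _ "norm a" 1])
  fix x
  have "\<bar>x \<bullet> a\<bar> \<le> norm x * norm a" by (rule Cauchy_Schwarz_ineq2)
  also have "\<dots> \<le> norm a * (1 + norm x)" by (simp add: algebra_simps)
  finally show "norm (of_real (x \<bullet> a) * f x) \<le> norm a * (1 + norm x) ^ 1 * norm (f x)"
    by (auto simp: norm_mult intro: mult_right_mono)
qed simp

lemma rapid_affine:
  fixes f :: "'a::real_normed_vector \<Rightarrow> 'b::real_normed_vector"
  assumes "rapid f" "t \<noteq> 0" shows "rapid (\<lambda>x. f (t *\<^sub>R x + a))"
proof (rule rapidI)
  fix m
  obtain C where C: "C \<ge> 0" "\<And>x. (1 + norm x) ^ m * norm (f x) \<le> C" using rapidD[OF assms(1)] by metis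
  \<comment> \<open>This \<open>K\<close> compares the weight at \<open>x\<close> with the weight at
    the image point: the shift costs \<open>1 + norm a\<close>, the dilation
    \<open>1 / \<bar>t\<bar>\<close>.\<close>
  define K where "K = 1 + (1 + norm a) / \<bar>t\<bar>"
  have K: "K \<ge> 1" using assms by (auto simp: K_def)
  have le: "1 + norm x \<le> K * (1 + norm (t *\<^sub>R x + a))" for x
  proof -
    have "\<bar>t\<bar> * norm x = norm (t *\<^sub>R x + a - a)" by simp
    also have "\<dots> \<le> norm (t *\<^sub>R x + a) + norm a" by (rule norm_triangle_ineq4)
    also have "\<dots> \<le> (1 + norm a) * (1 + norm (t *\<^sub>R x + a))" by (simp add: algebra_simps)
    finally have "norm x \<le> (1 + norm a) / \<bar>t\<bar> * (1 + norm (t *\<^sub>R x + a))"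
      using assms by (simp add: field_simps)
    then show ?thesis unfolding K_def distrib_right[of 1] mult_1 using norm_ge_zero[of "t *\<^sub>R x + a"] by linarith
  qed
  have "(1 + norm x) ^ m * norm (f (t *\<^sub>R x + a)) \<le> K ^ m * C" for x
  proof -
    have "(1 + norm x) ^ m * norm (f (t *\<^sub>R x + a)) \<le> (K * (1 + norm (t *\<^sub>R x + a))) ^ m * norm (f (t *\<^sub>R x + a))"
      by (intro mult_right_mono power_mono le) auto
    also have "\<dots> = K ^ m * ((1 + norm (t *\<^sub>R x + a)) ^ m * norm (f (t *\<^sub>R x + a)))" by (simp add: power_mult_distrib)
    also have "\<dots> \<le> K ^ m * C" using K by (intro mult_left_mono C) auto
    finally show ?thesis .
  qed
  then show "\<exists>C. \<forall>x. (1 + norm x) ^ m * norm (f (t *\<^sub>R x + a)) \<le> C" by blast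
qed

subsection \<open>Closure properties of the Schwartz space\<close>

lemma schwartz_upto_add: "schwartz_upto n f \<Longrightarrow> schwartz_upto n g \<Longrightarrow> schwartz_upto n (\<lambda>x. f x + g x)"
proof (induction n arbitrary: f g rule: less_induct)
  case (less n)
  show ?case
  proof (rule schwartz_uptoI)
    show "schwartz_upto m (\<lambda>x. frechet_derivative f (at x) b + frechet_derivative g (at x) b)"
      if "n = Suc m" "b \<in> Basis" for m b
      using less that by (auto simp flip: pd_def)
  qed (rule has_derivative_add rapid_add schwartz_upto_D less.prems)+
qed

lemma schwartz_upto_cmult: "schwartz_upto n f \<Longrightarrow> schwartz_upto n (\<lambda>x. c * f x)"
proof (induction n arbitrary: f rule: less_induct)
  case (less n)
  show ?case
  proof (rule schwartz_uptoI)
    show "schwartz_upto m (\<lambda>x. c * frechet_derivative f (at x) b)" if "n = Suc m" "b \<in> Basis" for m b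
      using less that by (auto simp flip: pd_def)
  qed (rule has_derivative_mult_right rapid_cmult schwartz_upto_D less.prems)+
qed

text \<open>Leibniz' rule leaves two products, each with one undifferentiated factor known to the
  higher order; \<open>schwartz_upto_mono\<close> lowers it so that the induction hypothesis fits
  both.\<close>

lemma schwartz_upto_mult: "schwartz_upto n f \<Longrightarrow> schwartz_upto n g \<Longrightarrow> schwartz_upto n (\<lambda>x. f x * g x)"
proof (induction n arbitrary: f g rule: less_induct)
  case (less n)
  show ?case
  proof (rule schwartz_uptoI)
    show "schwartz_upto m (\<lambda>x. f x * frechet_derivative g (at x) b + frechet_derivative f (at x) b * g x)"
      if "n = Suc m" "b \<in> Basis" for m b
      using less.prems that
      by (intro schwartz_upto_add less.IH) (auto simp flip: pd_def intro: schwartz_upto_mono[of n])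
  qed (rule has_derivative_mult rapid_mult schwartz_upto_D less.prems)+
qed

lemma schwartz_upto_inner: "schwartz_upto n f \<Longrightarrow> schwartz_upto n (\<lambda>x. of_real (x \<bullet> a) * f x)"
proof (induction n arbitrary: f rule: less_induct)
  case (less n)
  have "((\<lambda>x. of_real (x \<bullet> a) * f x) has_derivative
     (\<lambda>h. of_real (x \<bullet> a) * frechet_derivative f (at x) h + of_real (h \<bullet> a) * f x)) (at x)" for x
    by (intro has_derivative_mult has_derivative_of_real has_derivative_inner_left has_derivative_ident
        schwartz_upto_D[OF less.prems])
  then show ?case
  proof (rule schwartz_uptoI)
    show "schwartz_upto m (\<lambda>x. of_real (x \<bullet> a) * frechet_derivative f (at x) b + of_real (b \<bullet> a) * f x)"
      if "n = Suc m" "b \<in> Basis" for m b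
      using less.prems that
      by (intro schwartz_upto_add less.IH schwartz_upto_cmult)
        (auto simp flip: pd_def intro: schwartz_upto_mono[of n])
  qed (rule rapid_inner schwartz_upto_D less.prems)+
qed

lemma has_derivative_affine:
  assumes "\<And>x. (f has_derivative D x) (at x)"
  shows "((\<lambda>x. f (t *\<^sub>R x + a)) has_derivative (\<lambda>h. D (t *\<^sub>R x + a) (t *\<^sub>R h))) (at x)"
proof -
  have "((\<lambda>x. t *\<^sub>R x + a) has_derivative (\<lambda>h. t *\<^sub>R h)) (at x)"
    by (auto intro!: derivative_eq_intros)
  from has_derivative_compose[OF this assms] show ?thesis .
qed

lemma schwartz_upto_affine: "t \<noteq> 0 \<Longrightarrow> schwartz_upto n f \<Longrightarrow> schwartz_upto n (\<lambda>x. f (t *\<^sub>R x + a))"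
proof (induction n arbitrary: f rule: less_induct)
  case (less n)
  show ?case
  proof (rule schwartz_uptoI)
    fix m and b :: 'a assume b: "n = Suc m" "b \<in> Basis"
    have "frechet_derivative f (at x) (t *\<^sub>R b) = of_real t * pd b f x" for x
      using schwartz_upto_D(1)[OF less.prems(2), of x, THEN has_derivative_bounded_linear]
      by (simp add: linear_simps pd_def scaleR_conv_of_real)
    then show "schwartz_upto m (\<lambda>x. frechet_derivative f (at (t *\<^sub>R x + a)) (t *\<^sub>R b))"
      using less b by (auto intro: schwartz_upto_cmult)
  qed (rule has_derivative_affine rapid_affine schwartz_upto_D less.prems)+
qed

lemma has_derivative_cnj:
  "(f has_derivative D) F \<Longrightarrow> ((\<lambda>x. cnj (f x)) has_derivative (\<lambda>h. cnj (D h))) F"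
  by (rule bounded_linear.has_derivative[OF bounded_linear_cnj])

lemma rapid_cnj: "rapid f \<Longrightarrow> rapid (\<lambda>x. cnj (f x))"
  by (simp add: rapid_def)

lemma schwartz_upto_cnj: "schwartz_upto n f \<Longrightarrow> schwartz_upto n (\<lambda>x. cnj (f x))"
proof (induction n arbitrary: f rule: less_induct)
  case (less n)
  show ?case
  proof (rule schwartz_uptoI)
    show "schwartz_upto m (\<lambda>x. cnj (frechet_derivative f (at x) b))" if "n = Suc m" "b \<in> Basis" for m b
      using less that by (auto simp flip: pd_def)
  qed (rule has_derivative_cnj rapid_cnj schwartz_upto_D less.prems)+
qed

lemma schwartz_add: "f \<in> schwartz \<Longrightarrow> g \<in> schwartz \<Longrightarrow> (\<lambda>x. f x + g x) \<in> schwartz"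
  and schwartz_cmult: "f \<in> schwartz \<Longrightarrow> (\<lambda>x. c * f x) \<in> schwartz"
  and schwartz_mult: "f \<in> schwartz \<Longrightarrow> g \<in> schwartz \<Longrightarrow> (\<lambda>x. f x * g x) \<in> schwartz"
  and schwartz_inner: "f \<in> schwartz \<Longrightarrow> (\<lambda>x. of_real (x \<bullet> a) * f x) \<in> schwartz"
  and schwartz_affine: "f \<in> schwartz \<Longrightarrow> t \<noteq> 0 \<Longrightarrow> (\<lambda>x. f (t *\<^sub>R x + a)) \<in> schwartz"
  and schwartz_cnj: "f \<in> schwartz \<Longrightarrow> (\<lambda>x. cnj (f x)) \<in> schwartz"
  by (auto simp: schwartz_iff_upto intro: schwartz_upto_add schwartz_upto_cmult schwartz_upto_mult
      schwartz_upto_inner schwartz_upto_affine schwartz_upto_cnj)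

lemma schwartz_minus: "f \<in> schwartz \<Longrightarrow> (\<lambda>x. - f x) \<in> schwartz"
  using schwartz_cmult[of f "-1"] by simp

lemma schwartz_diff: "f \<in> schwartz \<Longrightarrow> g \<in> schwartz \<Longrightarrow> (\<lambda>x. f x - g x) \<in> schwartz"
  using schwartz_add[OF _ schwartz_minus, of f g] by simp

lemma schwartz_zero: "(\<lambda>x. 0) \<in> schwartz"
proof -
  have "schwartz_upto n (\<lambda>x::'a. 0)" for n
  proof (induction n rule: less_induct)
    case (less n)
    show ?case by (rule schwartz_uptoI[where D = "\<lambda>x h. 0"]) (auto simp: rapid_def less)
  qed
  then show ?thesis by (simp add: schwartz_iff_upto)
qed

lemma schwartz_sum: "finite I \<Longrightarrow> (\<And>i. i \<in> I \<Longrightarrow> f i \<in> schwartz) \<Longrightarrow> (\<lambda>x. \<Sum>i\<in>I. f i x) \<in> schwartz"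
  by (induction I rule: finite_induct) (auto intro: schwartz_zero schwartz_add)

lemma schwartz_reflect: "f \<in> schwartz \<Longrightarrow> (\<lambda>x. f (a - x)) \<in> schwartz"
  using schwartz_affine[of f "-1" a] by (simp add: algebra_simps)

lemma schwartz_dilate: "f \<in> schwartz \<Longrightarrow> t \<noteq> 0 \<Longrightarrow> (\<lambda>x. f (t *\<^sub>R x)) \<in> schwartz"
  using schwartz_affine[of f t 0] by simp

lemma iter_partial_add:
  assumes "f \<in> schwartz" "g \<in> schwartz" "set bs \<subseteq> Basis"
  shows "iter_partial bs (\<lambda>x. f x + g x) = (\<lambda>x. iter_partial bs f x + iter_partial bs g x)"
  using assms(3)
proof (induction bs)
  case (Cons b bs)
  then have "iter_partial bs f \<in> schwartz" "iter_partial bs g \<in> schwartz"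
    using assms schwartz_iter_partial by auto
  from this[THEN schwartz_has_derivative]
  have "pd b (\<lambda>x. iter_partial bs f x + iter_partial bs g x) x = pd b (iter_partial bs f) x + pd b (iter_partial bs g) x" for x
    unfolding pd_def[of _ "iter_partial _ _"] by (intro pd_eqI has_derivative_add)
  with Cons show ?case by (simp add: pd_def)
qed simp

lemma iter_partial_cmult:
  assumes "f \<in> schwartz" "set bs \<subseteq> Basis"
  shows "iter_partial bs (\<lambda>x. c * f x) = (\<lambda>x. c * iter_partial bs f x)"
  using assms(2)
proof (induction bs)
  case (Cons b bs)
  then have "iter_partial bs f \<in> schwartz"
    using assms schwartz_iter_partial by auto
  from this[THEN schwartz_has_derivative]
  have "pd b (\<lambda>x. c * iter_partial bs f x) x = c * pd b (iter_partial bs f) x" for x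
    unfolding pd_def[of _ "iter_partial _ _"] by (intro pd_eqI has_derivative_mult_right)
  with Cons show ?case by (simp add: pd_def)
qed simp

lemma iter_partial_diff:
  assumes "f \<in> schwartz" "g \<in> schwartz" "set bs \<subseteq> Basis"
  shows "iter_partial bs (\<lambda>x. f x - g x) = (\<lambda>x. iter_partial bs f x - iter_partial bs g x)"
  using iter_partial_add[OF assms(1) schwartz_cmult[OF assms(2), of "-1"] assms(3)]
  unfolding iter_partial_cmult[OF assms(2,3)] by simp

subsection \<open>Integrability\<close>

text \<open>A dyadic comparison takes the place of polar coordinates. The function lies below the
  sum over \<open>n\<close> of \<open>(2 / 2^n)^(d+1)\<close> times the indicator of the ball of
  radius \<open>2^n\<close>. That ball has volume \<open>2^(nd)\<close> times \<open>V\<close>, so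
  the one power beyond \<open>d\<close> leaves a geometric series of ratio 1/2.\<close>

lemma integrable_inverse_power_norm:
  "integrable lborel (\<lambda>x::'a::euclidean_space. 1 / (1 + norm x) ^ (DIM('a) + 1))"
proof (rule integrableI_bounded)
  define d where "d = DIM('a)"
  define V where "V = measure lborel (ball (0::'a) 1)"
  have V: "V \<ge> 0" by (simp add: V_def)
  have emb: "emeasure lborel (ball (0::'a) (2 ^ n)) = ennreal ((2 ^ n) ^ d * V)" for n
    using content_ball_conv_unit_ball[of "2 ^ n" "0::'a"]
    by (subst emeasure_eq_ennreal_measure) (use emeasure_lborel_ball_finite[of "0::'a" "2 ^ n"] in \<open>auto simp: d_def V_def\<close>)
  have pt: "ennreal (norm (1 / (1 + norm x) ^ (d + 1)))
     \<le> (\<Sum>n. ennreal ((2 / 2 ^ n) ^ (d + 1)) * indicator (ball 0 (2 ^ n)) x)" for x :: 'a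
  proof -
    \<comment> \<open>By minimality, \<open>norm x\<close> is at least half of \<open>2 ^ n\<close>
      unless \<open>n = 0\<close>; in both cases \<open>2 ^ n / 2 \<le> 1 + norm x\<close>.\<close>
    define n where "n = (LEAST n. norm x < 2 ^ n)"
    obtain n0 where n0: "norm x < 2 ^ n0" using real_arch_pow[of 2 "norm x"] by auto
    then have n: "norm x < 2 ^ n" unfolding n_def by (rule LeastI)
    have "2 ^ n / 2 \<le> 1 + norm x"
    proof (cases n)
      case (Suc m)
      then have "\<not> norm x < 2 ^ m" using not_less_Least[of m "\<lambda>n. norm x < 2 ^ n"] unfolding n_def by linarith
      with Suc show ?thesis by simp
    qed simp
    then have "1 / (1 + norm x) \<le> 2 / 2 ^ n"
      by (simp add: field_simps add_pos_nonneg)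
    then have "norm (1 / (1 + norm x) ^ (d + 1)) \<le> (2 / 2 ^ n) ^ (d + 1)"
      unfolding real_norm_def by (subst abs_of_nonneg) (auto simp: power_one_over[symmetric] simp del: power_Suc intro!: power_mono)
    then have "ennreal (norm (1 / (1 + norm x) ^ (d + 1))) \<le> ennreal ((2 / 2 ^ n) ^ (d + 1)) * indicator (ball 0 (2 ^ n)) x"
      using n by (simp add: ennreal_leI)
    also have "\<dots> = (\<Sum>k\<in>{n}. ennreal ((2 / 2 ^ k) ^ (d + 1)) * indicator (ball 0 (2 ^ k)) x)"
      by (simp only: sum.insert[OF finite.emptyI] sum.empty empty_iff not_False_eq_True add_0_right)
    also have "\<dots> \<le> (\<Sum>n. ennreal ((2 / 2 ^ n) ^ (d + 1)) * indicator (ball 0 (2 ^ n)) x)"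
      by (rule sum_le_suminf) auto
    finally show ?thesis .
  qed
  have "(\<integral>\<^sup>+ x. ennreal (norm (1 / (1 + norm x) ^ (DIM('a) + 1))) \<partial>(lborel::'a measure))
     \<le> (\<integral>\<^sup>+ x. (\<Sum>n. ennreal ((2 / 2 ^ n) ^ (d + 1)) * indicator (ball 0 (2 ^ n)) x) \<partial>(lborel::'a measure))"
    unfolding d_def[symmetric] by (intro nn_integral_mono pt)
  also have "\<dots> = (\<Sum>n. ennreal ((2 / 2 ^ n) ^ (d + 1)) * emeasure lborel (ball (0::'a) (2 ^ n)))"
    by (subst nn_integral_suminf)
      (simp_all only: measurable_lborel1 nn_integral_cmult_indicator sets_lborel borel_open open_ball
        borel_measurable_times_ennreal borel_measurable_const borel_measurable_indicator)
  also have "\<dots> = (\<Sum>n. ennreal (2 ^ (d + 1) * V * (1 / 2) ^ n))"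
  proof (intro suminf_cong)
    fix n
    have "(2 / 2 ^ n) ^ (d + 1) * ((2 ^ n) ^ d * V) = 2 ^ (d + 1) * V * (1 / 2 :: real) ^ n"
      by (simp add: power_divide)
    then show "ennreal ((2 / 2 ^ n) ^ (d + 1)) * emeasure lborel (ball (0::'a) (2 ^ n)) = ennreal (2 ^ (d + 1) * V * (1 / 2) ^ n)"
      unfolding emb using V by (subst ennreal_mult[symmetric]) simp_all
  qed
  also have "\<dots> < \<infinity>"
    using V by (subst suminf_ennreal2) (auto intro!: summable_mult summable_geometric)
  finally show "(\<integral>\<^sup>+ x. ennreal (norm (1 / (1 + norm x) ^ (DIM('a) + 1))) \<partial>(lborel::'a measure)) < \<infinity>" .
qed simp

lemma integrable_decay:
  fixes f :: "'a::euclidean_space \<Rightarrow> 'b::{banach, second_countable_topology}"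
  assumes "f \<in> borel_measurable borel" "\<And>x. (1 + norm x) ^ (DIM('a) + 1) * norm (f x) \<le> C"
  shows "integrable lborel f"
proof (rule Bochner_Integration.integrable_bound)
  show "integrable lborel (\<lambda>x::'a. C * (1 / (1 + norm x) ^ (DIM('a) + 1)))"
    by (intro integrable_mult_right integrable_inverse_power_norm)
  have "norm (f x) \<le> C * (1 / (1 + norm x) ^ (DIM('a) + 1))" for x
    using assms(2)[of x] by (simp add: pos_le_divide_eq add_pos_nonneg mult.commute)
  then show "AE x in lborel. norm (f x) \<le> norm (C * (1 / (1 + norm x) ^ (DIM('a) + 1)))"
    unfolding real_norm_def by (intro always_eventually allI order_trans[OF _ abs_ge_self])
qed (use assms in simp)

lemma rapid_integrable:
  fixes f :: "'a::euclidean_space \<Rightarrow> 'b::{banach, second_countable_topology}"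
  assumes "rapid f" "f \<in> borel_measurable borel"
  shows "integrable lborel f"
  using rapidD[OF assms(1)] integrable_decay[OF assms(2)] by metis

lemma rapid_weight: "rapid f \<Longrightarrow> rapid (\<lambda>x. (1 + norm x) ^ m *\<^sub>R f x)"
  by (erule rapid_bound[where K = 1 and j = m]) auto

lemma schwartz_integrable: "f \<in> schwartz \<Longrightarrow> integrable lborel f"
  by (intro rapid_integrable schwartz_rapid schwartz_measurable)

lemma schwartz_weight_integrable:
  assumes "f \<in> schwartz" shows "integrable lborel (\<lambda>x. (1 + norm x) ^ m * norm (f x))"
proof -
  have "integrable lborel (\<lambda>x. (1 + norm x) ^ m *\<^sub>R f x)"
    using assms by (intro rapid_integrable rapid_weight schwartz_rapid) (auto intro!: borel_measurable_scaleR schwartz_measurable)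
  from integrable_norm[OF this] show ?thesis by simp
qed

subsection \<open>Affine change of variables\<close>

lemma integral_affine:
  fixes f :: "'a::euclidean_space \<Rightarrow> 'b::{banach, second_countable_topology}"
  assumes [measurable]: "f \<in> borel_measurable borel" and "c \<noteq> 0"
  shows "(\<integral>x. f x \<partial>lborel) = \<bar>c\<bar> ^ DIM('a) *\<^sub>R (\<integral>x. f (a + c *\<^sub>R x) \<partial>lborel)"
proof -
  have "integral\<^sup>L lborel f = integral\<^sup>L (density (distr lborel borel (\<lambda>x. a + c *\<^sub>R x)) (\<lambda>_. ennreal (\<bar>c\<bar> ^ DIM('a)))) f"
    using lborel_affine[OF assms(2), of a] by simp
  also have "\<dots> = \<bar>c\<bar> ^ DIM('a) *\<^sub>R (\<integral>x. f (a + c *\<^sub>R x) \<partial>lborel)"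
    by (subst integral_density) (auto simp: integral_distr)
  finally show ?thesis .
qed

lemma integral_translate:
  fixes f :: "'a::euclidean_space \<Rightarrow> 'b::{banach, second_countable_topology}"
  assumes "f \<in> borel_measurable borel"
  shows "(\<integral>x. f (x + a) \<partial>lborel) = (\<integral>x. f x \<partial>lborel)"
  using integral_affine[OF assms, of 1 a] by (simp add: add.commute)

lemma integral_reflect:
  fixes f :: "'a::euclidean_space \<Rightarrow> 'b::{banach, second_countable_topology}"
  assumes "f \<in> borel_measurable borel"
  shows "(\<integral>x. f (a - x) \<partial>lborel) = (\<integral>x. f x \<partial>lborel)"
  using integral_affine[OF assms, of "-1" a] by simp

lemma nn_integral_affine:
  fixes f :: "'a::euclidean_space \<Rightarrow> ennreal"
  assumes [measurable]: "f \<in> borel_measurable borel" and "c \<noteq> 0"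
  shows "(\<integral>\<^sup>+x. f x \<partial>lborel) = ennreal (\<bar>c\<bar> ^ DIM('a)) * (\<integral>\<^sup>+x. f (a + c *\<^sub>R x) \<partial>lborel)"
proof -
  have "integral\<^sup>N lborel f = integral\<^sup>N (density (distr lborel borel (\<lambda>x. a + c *\<^sub>R x)) (\<lambda>_. ennreal (\<bar>c\<bar> ^ DIM('a)))) f"
    using lborel_affine[OF assms(2), of a] by simp
  also have "\<dots> = ennreal (\<bar>c\<bar> ^ DIM('a)) * (\<integral>\<^sup>+x. f (a + c *\<^sub>R x) \<partial>lborel)"
    by (subst nn_integral_density) (auto simp: nn_integral_distr nn_integral_cmult)
  finally show ?thesis .
qed

subsection \<open>Differentiation under the integral sign\<close>

text \<open>The mean value inequality on the convex set \<open>U\<close> turns the bound on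
  \<open>K'\<close> into a Lipschitz bound for \<open>K\<close> with the same integrable weight. The
  remainder quotients are therefore dominated by \<open>2 * w\<close>, and dominated convergence
  along sequences gives the derivative.\<close>

lemma has_derivative_integral_param:
  fixes K :: "'a::euclidean_space \<Rightarrow> 'b \<Rightarrow> complex"
  assumes U: "open U" "convex U" "y \<in> U"
    and intK: "\<And>z. z \<in> U \<Longrightarrow> integrable M (K z)"
    and meas: "\<And>h. (\<lambda>x. K' y x h) \<in> borel_measurable M"
    and D: "\<And>x z. z \<in> U \<Longrightarrow> ((\<lambda>y. K y x) has_derivative K' z x) (at z)"
    and w: "\<And>x z h. z \<in> U \<Longrightarrow> norm (K' z x h) \<le> w x * norm h" "integrable M w"
  shows "((\<lambda>y. \<integral>x. K y x \<partial>M) has_derivative (\<lambda>h. \<integral>x. K' y x h \<partial>M)) (at y)"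
proof -
  have w0: "w x \<ge> 0" for x
  proof -
    \<comment> \<open>Nonnegativity of \<open>w\<close> follows by testing its defining bound on a
      unit vector.\<close>
    obtain b :: 'a where "norm b = 1" using vector_choose_size[of 1] by auto
    then show ?thesis using order_trans[OF norm_ge_zero w(1)[OF U(3), of x b]] by simp
  qed
  have intK': "integrable M (\<lambda>x. K' y x h)" for h
    by (rule Bochner_Integration.integrable_bound[OF integrable_mult_left[OF w(2), of "norm h"] meas])
      (use w(1)[OF U(3)] w0 in auto)
  have lin: "bounded_linear (K' z x)" if "z \<in> U" for z x
    using D[OF that] by (rule has_derivative_bounded_linear)
  have bl: "bounded_linear (\<lambda>h. \<integral>x. K' y x h \<partial>M)"
  proof
    fix a b r
    show "(\<integral>x. K' y x (a + b) \<partial>M) = (\<integral>x. K' y x a \<partial>M) + (\<integral>x. K' y x b \<partial>M)"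
      using lin[OF U(3)] by (simp add: linear_simps intK')
    show "(\<integral>x. K' y x (r *\<^sub>R a) \<partial>M) = r *\<^sub>R (\<integral>x. K' y x a \<partial>M)"
      using lin[OF U(3)] by (simp add: linear_simps)
    have "norm (\<integral>x. K' y x h \<partial>M) \<le> norm h * (\<integral>x. w x \<partial>M)" for h
    proof -
      have "norm (\<integral>x. K' y x h \<partial>M) \<le> (\<integral>x. norm (K' y x h) \<partial>M)" by (rule integral_norm_bound)
      also have "\<dots> \<le> (\<integral>x. w x * norm h \<partial>M)"
        by (intro integral_mono integrable_norm intK' integrable_mult_left w U)
      finally show ?thesis by (simp add: mult.commute)
    qed
    then show "\<exists>C. \<forall>h. norm (\<integral>x. K' y x h \<partial>M) \<le> norm h * C" by blast
  qed
  define R where "R = (\<lambda>z x. (K z x - K y x - K' y x (z - y)) /\<^sub>R norm (z - y))"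
  have lip: "norm (K z x - K y x) \<le> w x * norm (z - y)" if "z \<in> U" for z x
  proof (rule differentiable_bound[OF U(2)])
    show "((\<lambda>z. K z x) has_derivative K' v x) (at v within U)" if "v \<in> U" for v
      using D[OF that] by (rule has_derivative_at_withinI)
    show "onorm (K' v x) \<le> w x" if "v \<in> U" for v
      by (rule onorm_bound) (use w0 w(1) that in auto)
  qed (use that U in auto)
  have R2: "norm (R z x) \<le> 2 * w x" if "z \<in> U" for z x
  proof (cases "z = y")
    case False
    have "norm (K z x - K y x - K' y x (z - y)) \<le> w x * norm (z - y) + w x * norm (z - y)"
      using norm_triangle_ineq4[of "K z x - K y x" "K' y x (z - y)"] lip[OF that, of x] w(1)[OF U(3), of x "z - y"] by linarith
    then show ?thesis using False unfolding R_def norm_scaleR by (simp add: divide_simps mult_ac)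
  qed (use w0 in \<open>simp add: R_def\<close>)
  have "((\<lambda>z. \<integral>x. R z x \<partial>M) \<longlongrightarrow> 0) (at y within U)"
    unfolding tendsto_at_iff_sequentially comp_def
  proof (intro allI impI)
    fix X assume X: "\<forall>i::nat. X i \<in> U - {y}" "X \<longlonglongrightarrow> y"
    have "(\<lambda>i. \<integral>x. R (X i) x \<partial>M) \<longlonglongrightarrow> (\<integral>x. 0 \<partial>M)"
    proof (rule integral_dominated_convergence)
      show "integrable M (\<lambda>x. 2 * w x)" using w by simp
      show "AE x in M. (\<lambda>i. R (X i) x) \<longlonglongrightarrow> 0"
      proof (intro always_eventually allI)
        fix x
        have "((\<lambda>z. R z x) \<longlongrightarrow> 0) (at y)"
          using D[OF U(3), of x] unfolding R_def
          unfolding has_derivative_at_within by blast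
        then show "(\<lambda>i. R (X i) x) \<longlonglongrightarrow> 0"
          using X unfolding tendsto_at_iff_sequentially comp_def by auto
      qed
      show "R (X i) \<in> borel_measurable M" for i
        unfolding R_def using X
        by (intro borel_measurable_scaleR borel_measurable_diff borel_measurable_integrable[OF intK] meas U) auto
      show "AE x in M. norm (R (X i) x) \<le> 2 * w x" for i using R2 X by auto
    qed simp
    then show "(\<lambda>i. \<integral>x. R (X i) x \<partial>M) \<longlonglongrightarrow> 0" by simp
  qed
  then have lim: "((\<lambda>z. \<integral>x. R z x \<partial>M) \<longlongrightarrow> 0) (at y)"
    using U at_within_open by metis
  have "\<forall>\<^sub>F z in at y. (\<integral>x. R z x \<partial>M)
      = ((\<integral>x. K z x \<partial>M) - (\<integral>x. K y x \<partial>M) - (\<integral>x. K' y x (z - y) \<partial>M)) /\<^sub>R norm (z - y)"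
    unfolding eventually_at_topological
    by (intro exI[of _ U] conjI U ballI impI) (simp add: R_def intK intK' U)
  from Lim_transform_eventually[OF lim this] bl show ?thesis
    unfolding has_derivative_at_within by simp
qed

subsection \<open>The Fourier transform on the Schwartz space\<close>

lemma norm_cis_mult [simp]: "norm (z * cis t) = norm z" "norm (cis t * z) = norm z"
  by (simp_all add: norm_mult)

lemma measurable_cis_inner [measurable]:
  "f \<in> borel_measurable M \<Longrightarrow> (\<lambda>x. cis (f x)) \<in> borel_measurable M"
  unfolding cis_conv_exp by measurable

lemma fourier_integrable:
  assumes "integrable lborel f"
  shows "integrable lborel (\<lambda>x. f x * cis (- 2 * pi * (x \<bullet> \<xi>)))"
  by (rule Bochner_Integration.integrable_bound[OF assms]) (use assms in \<open>auto simp: norm_mult\<close>)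

lemma norm_fourier_le: "norm (fourier f \<xi>) \<le> (\<integral>x. norm (f x) \<partial>lborel)"
  unfolding fourier_def by (rule order_trans[OF integral_norm_bound]) simp

lemma has_derivative_cis [derivative_intros]:
  assumes "(f has_derivative D) (at x within S)"
  shows "((\<lambda>x. cis (f x)) has_derivative (\<lambda>h. \<i> * of_real (D h) * cis (f x))) (at x within S)"
proof -
  have "((\<lambda>x. exp (\<i> * of_real (f x))) has_derivative (\<lambda>h. \<i> * of_real (D h) * exp (\<i> * of_real (f x)))) (at x within S)"
    using has_derivative_compose[OF has_derivative_mult_right[OF has_derivative_of_real[OF assms], of "\<i>"]
        DERIV_exp[unfolded has_field_derivative_def]]
    by (simp add: mult_ac)
  then show ?thesis by (simp add: cis_conv_exp)
qed

text \<open>Writing the derivative as the transform of another Schwartz function is what lets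
  \<open>fourier_schwartz\<close> proceed by induction on the order.\<close>

lemma fourier_has_derivative:
  assumes f: "f \<in> schwartz"
  shows "(fourier f has_derivative (\<lambda>h. fourier (\<lambda>x. (- 2 * pi * \<i>) * (of_real (x \<bullet> h) * f x)) \<xi>)) (at \<xi>)"
proof -
  note [measurable] = schwartz_measurable[OF f]
  have "((\<lambda>y. \<integral>x. f x * cis (- 2 * pi * (x \<bullet> y)) \<partial>lborel) has_derivative
      (\<lambda>h. \<integral>x. f x * (\<i> * of_real (- 2 * pi * (x \<bullet> h)) * cis (- 2 * pi * (x \<bullet> \<xi>))) \<partial>lborel)) (at \<xi>)"
  proof (rule has_derivative_integral_param[where U = UNIV and w = "\<lambda>x. 2 * pi * ((1 + norm x) ^ 1 * norm (f x))"])
    show "integrable lborel (\<lambda>x. 2 * pi * ((1 + norm x) ^ 1 * norm (f x)))"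
      by (intro integrable_mult_right schwartz_weight_integrable f)
    show "integrable lborel (\<lambda>x. f x * cis (- 2 * pi * (x \<bullet> z)))" for z
      by (intro fourier_integrable schwartz_integrable f)
    show "((\<lambda>y. f x * cis (- 2 * pi * (x \<bullet> y))) has_derivative
        (\<lambda>h. f x * (\<i> * of_real (- 2 * pi * (x \<bullet> h)) * cis (- 2 * pi * (x \<bullet> z))))) (at z)" for x z
      by (auto intro!: derivative_eq_intros)
    fix x z h :: 'a
    have "norm (x \<bullet> h) \<le> (1 + norm x) * norm h"
      using Cauchy_Schwarz_ineq2[of x h] norm_ge_zero[of h] unfolding real_norm_def distrib_right mult_1 by linarith
    then have le: "2 * pi * norm (f x) * norm (x \<bullet> h) \<le> 2 * pi * norm (f x) * ((1 + norm x) * norm h)"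
      by (intro mult_left_mono) auto
    have "norm (f x * (\<i> * of_real (- 2 * pi * (x \<bullet> h)) * cis (- 2 * pi * (x \<bullet> z)))) = 2 * pi * norm (f x) * norm (x \<bullet> h)"
      by (simp add: norm_mult abs_mult)
    also note le
    also have "2 * pi * norm (f x) * ((1 + norm x) * norm h) = 2 * pi * ((1 + norm x) ^ 1 * norm (f x)) * norm h"
      by (simp only: power_one_right mult_ac)
    finally show "norm (f x * (\<i> * of_real (- 2 * pi * (x \<bullet> h)) * cis (- 2 * pi * (x \<bullet> z)))) \<le> 2 * pi * ((1 + norm x) ^ 1 * norm (f x)) * norm h"
      .
  qed auto
  then show ?thesis
    by (simp add: fourier_def[abs_def] mult_ac)
qed

text \<open>In place of an integration by parts, the transform of the translate of \<open>f\<close>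
  by \<open>t\<close> times \<open>b\<close> is differentiated at \<open>t = 0\<close> in two ways:
  under the integral, and through the factor \<open>cis (2 * pi * t * (b \<bullet> \<xi>))\<close>
  that a translation produces.\<close>

lemma fourier_pd:
  assumes f: "f \<in> schwartz" and b: "b \<in> Basis"
  shows "fourier (pd b f) \<xi> = 2 * pi * \<i> * of_real (b \<bullet> \<xi>) * fourier f \<xi>"
proof -
  define m where "m = DIM('a) + 1"
  note [measurable] = schwartz_measurable[OF f]
  have pdm: "pd b f \<in> borel_measurable borel"
    using schwartz_measurable[OF schwartz_pd[OF f b]] .
  obtain C where C: "C \<ge> 0" "\<And>x. (1 + norm x) ^ m * norm (pd b f x) \<le> C"
    using rapidD[OF schwartz_rapid[OF schwartz_pd[OF f b]]] by metis
  \<comment> \<open>A majorant independent of \<open>t\<close>: for \<open>|t| < 1\<close> the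
    weight at \<open>x\<close> is at most twice the weight at the shifted point.\<close>
  have bnd: "norm (pd b f (x + t *\<^sub>R b)) \<le> 2 ^ m * C * (1 / (1 + norm x) ^ m)" if "t \<in> ball 0 1" for t x
  proof -
    have "norm x \<le> norm (x + t *\<^sub>R b) + norm (t *\<^sub>R b)"
      using norm_triangle_ineq4[of "x + t *\<^sub>R b" "t *\<^sub>R b"] by simp
    also have "norm (t *\<^sub>R b) \<le> 1" using that b by simp
    finally have "norm x \<le> norm (x + t *\<^sub>R b) + 1" by simp
    moreover have "1 + u \<le> 2 * (1 + v)" if "u \<le> v + 1" "0 \<le> v" for u v :: real
      using that by simp
    ultimately have "1 + norm x \<le> 2 * (1 + norm (x + t *\<^sub>R b))"
      using norm_ge_zero by blast
    then have "(1 + norm x) ^ m \<le> (2 * (1 + norm (x + t *\<^sub>R b))) ^ m" by (intro power_mono) auto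
    then have "(1 + norm x) ^ m * norm (pd b f (x + t *\<^sub>R b)) \<le> (2 * (1 + norm (x + t *\<^sub>R b))) ^ m * norm (pd b f (x + t *\<^sub>R b))"
      by (intro mult_right_mono) auto
    also have "\<dots> = 2 ^ m * ((1 + norm (x + t *\<^sub>R b)) ^ m * norm (pd b f (x + t *\<^sub>R b)))" by (simp only: power_mult_distrib mult.assoc)
    also have "\<dots> \<le> 2 ^ m * C" by (intro mult_left_mono C) auto
    finally show ?thesis by (simp add: pos_le_divide_eq add_pos_nonneg mult.commute)
  qed
  have 1: "((\<lambda>t::real. \<integral>x. f (x + t *\<^sub>R b) * cis (- 2 * pi * (x \<bullet> \<xi>)) \<partial>lborel) has_derivative
     (\<lambda>h. \<integral>x. h *\<^sub>R (pd b f (x + 0 *\<^sub>R b) * cis (- 2 * pi * (x \<bullet> \<xi>))) \<partial>lborel)) (at 0)"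
  proof (rule has_derivative_integral_param[where U = "ball 0 1" and w = "\<lambda>x. 2 ^ m * C * (1 / (1 + norm x) ^ m)"])
    show "integrable lborel (\<lambda>x::'a. 2 ^ m * C * (1 / (1 + norm x) ^ m) :: real)"
      unfolding m_def by (intro integrable_mult_right integrable_inverse_power_norm)
    show "integrable lborel (\<lambda>x. f (x + t *\<^sub>R b) * cis (- 2 * pi * (x \<bullet> \<xi>)))" for t
      using schwartz_affine[OF f, of 1] by (intro fourier_integrable schwartz_integrable) auto
    show "((\<lambda>t. f (x + t *\<^sub>R b) * cis (- 2 * pi * (x \<bullet> \<xi>))) has_derivative
      (\<lambda>h. h *\<^sub>R (pd b f (x + z *\<^sub>R b) * cis (- 2 * pi * (x \<bullet> \<xi>))))) (at z)" for x z
    proof -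
      have "((\<lambda>t. x + t *\<^sub>R b) has_derivative (\<lambda>h. h *\<^sub>R b)) (at z)" by (auto intro!: derivative_eq_intros)
      from has_derivative_compose[OF this schwartz_has_derivative[OF f]]
      have "((\<lambda>t. f (x + t *\<^sub>R b)) has_derivative (\<lambda>h. frechet_derivative f (at (x + z *\<^sub>R b)) (h *\<^sub>R b))) (at z)" .
      moreover have "frechet_derivative f (at (x + z *\<^sub>R b)) (h *\<^sub>R b) = h *\<^sub>R pd b f (x + z *\<^sub>R b)" for h
        using schwartz_has_derivative[OF f, THEN has_derivative_bounded_linear] by (simp add: pd_def linear_simps)
      ultimately show ?thesis
        by (auto intro!: derivative_eq_intros)
    qed
    fix x and z h :: real
    assume "z \<in> ball 0 1"
    then have "norm h * norm (pd b f (x + z *\<^sub>R b)) \<le> norm h * (2 ^ m * C * (1 / (1 + norm x) ^ m))"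
      by (intro mult_left_mono bnd) auto
    then show "norm (h *\<^sub>R (pd b f (x + z *\<^sub>R b) * cis (- 2 * pi * (x \<bullet> \<xi>)))) \<le> 2 ^ m * C * (1 / (1 + norm x) ^ m) * norm h"
      by (simp add: mult_ac)
  qed (use pdm in auto)
  have "(\<integral>x. f (x + t *\<^sub>R b) * cis (- 2 * pi * (x \<bullet> \<xi>)) \<partial>lborel) = cis (2 * pi * t * (b \<bullet> \<xi>)) * fourier f \<xi>" for t
  proof -
    have "(\<integral>x. f (x + t *\<^sub>R b) * cis (- 2 * pi * (x \<bullet> \<xi>)) \<partial>lborel)
       = (\<integral>x. (\<lambda>x. f x * cis (- 2 * pi * ((x - t *\<^sub>R b) \<bullet> \<xi>))) (x + t *\<^sub>R b) \<partial>lborel)" by simp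
    also have "\<dots> = (\<integral>x. f x * cis (- 2 * pi * ((x - t *\<^sub>R b) \<bullet> \<xi>)) \<partial>lborel)"
      by (rule integral_translate) measurable
    also have "\<dots> = (\<integral>x. cis (2 * pi * t * (b \<bullet> \<xi>)) * (f x * cis (- 2 * pi * (x \<bullet> \<xi>))) \<partial>lborel)"
      by (simp add: inner_diff_left algebra_simps cis_mult)
    also have "\<dots> = cis (2 * pi * t * (b \<bullet> \<xi>)) * fourier f \<xi>" unfolding fourier_def by simp
    finally show ?thesis .
  qed
  with 1 have 2: "((\<lambda>t::real. cis (2 * pi * t * (b \<bullet> \<xi>)) * fourier f \<xi>) has_derivative
     (\<lambda>h. h *\<^sub>R fourier (pd b f) \<xi>)) (at 0)" by (simp add: fourier_def)
  have "((\<lambda>t::real. cis (2 * pi * t * (b \<bullet> \<xi>)) * fourier f \<xi>) has_derivative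
     (\<lambda>h. (\<i> * of_real (2 * pi * h * (b \<bullet> \<xi>)) * cis (2 * pi * 0 * (b \<bullet> \<xi>))) * fourier f \<xi>)) (at 0)"
    by (auto intro!: derivative_eq_intros)
  from has_derivative_unique[OF 2 this] have "1 *\<^sub>R fourier (pd b f) \<xi>
     = (\<i> * of_real (2 * pi * 1 * (b \<bullet> \<xi>)) * cis (2 * pi * 0 * (b \<bullet> \<xi>))) * fourier f \<xi>" by metis
  then show ?thesis by (simp add: mult_ac)
qed

text \<open>Each power of \<open>norm \<xi>\<close> is paid for by one derivative of
  \<open>f\<close>: the norm is at most the sum of the absolute coordinates, and
  \<open>fourier_pd\<close> absorbs a coordinate into the transform of a partial derivative.\<close>

lemma fourier_rapid:
  assumes f: "f \<in> schwartz" shows "rapid (fourier f)"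
proof -
  have "\<exists>C. \<forall>\<xi>. norm \<xi> ^ m * norm (fourier f \<xi>) \<le> C" for m
    using f
  proof (induction m arbitrary: f)
    case 0
    then show ?case using norm_fourier_le by auto
  next
    case (Suc m)
    have "\<exists>C. \<forall>b\<in>Basis. \<forall>\<xi>. norm \<xi> ^ m * norm (fourier (pd b f) \<xi>) \<le> C b"
      using Suc.IH[OF schwartz_pd[OF Suc.prems]] by metis
    then obtain C where C: "\<And>b \<xi>. b \<in> Basis \<Longrightarrow> norm \<xi> ^ m * norm (fourier (pd b f) \<xi>) \<le> C b" by blast
    have "norm \<xi> ^ Suc m * norm (fourier f \<xi>) \<le> (\<Sum>b\<in>Basis. C b / (2 * pi))" for \<xi>
    proof -
      have "norm \<xi> ^ Suc m * norm (fourier f \<xi>) \<le> (\<Sum>b\<in>Basis. \<bar>\<xi> \<bullet> b\<bar>) * (norm \<xi> ^ m * norm (fourier f \<xi>))"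
        using mult_right_mono[OF norm_le_l1[of \<xi>], of "norm \<xi> ^ m * norm (fourier f \<xi>)"] by (simp add: mult_ac)
      also have "\<dots> = (\<Sum>b\<in>Basis. norm \<xi> ^ m * norm (fourier (pd b f) \<xi>) / (2 * pi))"
        unfolding sum_distrib_right
        by (intro sum.cong refl) (simp add: fourier_pd[OF Suc.prems] norm_mult inner_commute)
      also have "\<dots> \<le> (\<Sum>b\<in>Basis. C b / (2 * pi))"
        by (intro sum_mono divide_right_mono C) auto
      finally show ?thesis .
    qed
    then show ?case by blast
  qed
  then show ?thesis by (simp add: rapid_def)
qed

lemma fourier_schwartz: assumes "f \<in> schwartz" shows "fourier f \<in> schwartz"
proof -
  have "schwartz_upto n (fourier f)" for n
    using assms
  proof (induction n arbitrary: f rule: less_induct)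
    case (less n)
    show ?case
    proof (rule schwartz_uptoI[OF fourier_has_derivative fourier_rapid])
      show "schwartz_upto m (\<lambda>\<xi>. fourier (\<lambda>x. (- 2 * pi * \<i>) * (of_real (x \<bullet> b) * f x)) \<xi>)" if "n = Suc m" for m b
        by (intro less schwartz_cmult schwartz_inner) (simp add: that)
    qed (rule less.prems)+
  qed
  then show ?thesis by (simp add: schwartz_iff_upto)
qed

lemma integrable_pair_mult_bounded:
  fixes f :: "'a::euclidean_space \<Rightarrow> complex" and g :: "'b::euclidean_space \<Rightarrow> complex"
  assumes "integrable lborel f" "integrable lborel g"
    and [measurable]: "case_prod K \<in> borel_measurable (lborel \<Otimes>\<^sub>M lborel)"
    and "\<And>x y. norm (K x y) \<le> C"
  shows "integrable (lborel \<Otimes>\<^sub>M lborel) (\<lambda>(x, y). f x * g y * K x y)"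
proof -
  have [measurable]: "f \<in> borel_measurable borel" "g \<in> borel_measurable borel" using assms by auto
  have *: "integrable (lborel \<Otimes>\<^sub>M lborel) (\<lambda>(x, y). f x * g y)"
    by (rule lborel_pair.Fubini_integrable) (use assms in \<open>auto simp: norm_mult\<close>)
  show ?thesis
  proof (rule Bochner_Integration.integrable_bound)
    show "integrable (lborel \<Otimes>\<^sub>M lborel) (\<lambda>p. of_real C * (case p of (x, y) \<Rightarrow> f x * g y))"
      using * by (rule integrable_mult_right)
    have "norm (f x * g y) * norm (K x y) \<le> norm (f x * g y) * \<bar>C\<bar>" for x y
      using assms(4)[of x y] by (intro mult_left_mono) auto
    then show "AE p in lborel \<Otimes>\<^sub>M lborel. norm (case p of (x, y) \<Rightarrow> f x * g y * K x y) \<le> norm (of_real C * (case p of (x, y) \<Rightarrow> f x * g y))"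
      by (auto simp: norm_mult mult_ac)
  qed measurable
qed

lemma fourier_multiplication:
  assumes "integrable lborel f" "integrable lborel g"
  shows "(\<integral>x. fourier f x * g x \<partial>lborel) = (\<integral>x. f x * fourier g x \<partial>lborel)"
proof -
  have "(\<integral>y. (\<integral>x. f x * g y * cis (- 2 * pi * (x \<bullet> y)) \<partial>lborel) \<partial>lborel)
     = (\<integral>x. (\<integral>y. f x * g y * cis (- 2 * pi * (x \<bullet> y)) \<partial>lborel) \<partial>lborel)"
    by (rule lborel_pair.Fubini_integral, rule integrable_pair_mult_bounded[where C = 1]) (use assms in auto)
  moreover have "(\<integral>x. f x * g y * cis (- 2 * pi * (x \<bullet> y)) \<partial>lborel) = fourier f y * g y" for y
    unfolding fourier_def integral_mult_left_zero[symmetric] by (simp add: mult_ac)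
  moreover have "(\<integral>y. f x * g y * cis (- 2 * pi * (x \<bullet> y)) \<partial>lborel) = f x * fourier g x" for x
    unfolding fourier_def integral_mult_right_zero[symmetric] by (simp add: mult_ac inner_commute)
  ultimately show ?thesis by simp
qed

subsection \<open>Inversion and Parseval's identity\<close>

lemma fourier_schwartz_integrable: "f \<in> schwartz \<Longrightarrow> integrable lborel (fourier f)"
  by (intro schwartz_integrable fourier_schwartz)

lemma fourier_schwartz_measurable: "f \<in> schwartz \<Longrightarrow> fourier f \<in> borel_measurable borel"
  by (intro schwartz_measurable fourier_schwartz)

lemma fourier_dilate:
  fixes f :: "'a::euclidean_space \<Rightarrow> complex"
  assumes [measurable]: "f \<in> borel_measurable borel" and t: "t > 0"
  shows "fourier f (\<xi> /\<^sub>R t) = t ^ DIM('a) *\<^sub>R fourier (\<lambda>x. f (t *\<^sub>R x)) \<xi>"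
  unfolding fourier_def using t
  by (subst integral_affine[where c = t and a = 0]) (auto simp: field_simps)

lemma dilate_null_sequence:
  fixes f g :: "'a::euclidean_space \<Rightarrow> complex"
  assumes f: "f \<in> schwartz" and g: "integrable lborel g"
  shows "(\<lambda>n. \<integral>x. f ((1 / real (Suc n)) *\<^sub>R x) * g x \<partial>lborel) \<longlonglongrightarrow> f 0 * (\<integral>x. g x \<partial>lborel)"
proof -
  obtain C where C: "C \<ge> 0" "\<And>x. norm (f x) \<le> C" using rapid_bounded[OF schwartz_rapid[OF f]] by blast
  have [measurable]: "f \<in> borel_measurable borel" "g \<in> borel_measurable borel"
    using f g by (auto intro: schwartz_measurable)
  have "(\<lambda>n. \<integral>x. f ((1 / real (Suc n)) *\<^sub>R x) * g x \<partial>lborel) \<longlonglongrightarrow> (\<integral>x. f 0 * g x \<partial>lborel)"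
  proof (rule integral_dominated_convergence)
    show "integrable lborel (\<lambda>x. C * norm (g x))" using g by simp
    show "AE x in lborel. (\<lambda>n. f ((1 / real (Suc n)) *\<^sub>R x) * g x) \<longlonglongrightarrow> f 0 * g x"
    proof (intro always_eventually allI tendsto_mult tendsto_const)
      fix x :: 'a
      have "(\<lambda>n. (1 / real (Suc n)) *\<^sub>R x) \<longlonglongrightarrow> 0 *\<^sub>R x"
        by (intro tendsto_scaleR LIMSEQ_Suc[OF lim_1_over_n] tendsto_const)
      moreover have "isCont f 0"
        using schwartz_continuous_on[OF f, of UNIV] by (simp add: continuous_on_eq_continuous_at)
      ultimately show "(\<lambda>n. f ((1 / real (Suc n)) *\<^sub>R x)) \<longlonglongrightarrow> f 0"
        by (auto intro: isCont_tendsto_compose)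
    qed
    show "AE x in lborel. norm (f ((1 / real (Suc n)) *\<^sub>R x) * g x) \<le> C * norm (g x)" for n
      using C by (auto simp: norm_mult intro!: mult_right_mono)
  qed measurable
  then show ?thesis by simp
qed

text \<open>After the multiplication formula, a change of variables moves the dilation from
  \<open>\<eta>\<close> onto \<open>f\<close>. Letting the dilation parameter tend to 0,
  \<open>dilate_null_sequence\<close> evaluates \<open>\<eta>\<close> at the origin on one side and
  \<open>f\<close> on the other.\<close>

lemma fourier_integral_ratio:
  fixes f \<eta> :: "'a::euclidean_space \<Rightarrow> complex"
  assumes f: "f \<in> schwartz" and \<eta>: "\<eta> \<in> schwartz"
  shows "\<eta> 0 * (\<integral>\<xi>. fourier f \<xi> \<partial>lborel) = f 0 * (\<integral>\<xi>. fourier \<eta> \<xi> \<partial>lborel)"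
proof -
  have "(\<integral>x. \<eta> ((1 / real (Suc n)) *\<^sub>R x) * fourier f x \<partial>lborel)
      = (\<integral>x. f ((1 / real (Suc n)) *\<^sub>R x) * fourier \<eta> x \<partial>lborel)" for n
  proof -
    define t where "t = 1 / real (Suc n)"
    have t: "t > 0" by (simp add: t_def)
    have [measurable]: "fourier \<eta> \<in> borel_measurable borel" "f \<in> borel_measurable borel" "\<eta> \<in> borel_measurable borel"
      using f \<eta> by (auto intro: schwartz_measurable fourier_schwartz)
    have \<eta>t: "(\<lambda>x. \<eta> (t *\<^sub>R x)) \<in> schwartz" using \<eta> t by (intro schwartz_dilate) auto
    have "(\<integral>x. \<eta> (t *\<^sub>R x) * fourier f x \<partial>lborel) = (\<integral>x. f x * fourier (\<lambda>x. \<eta> (t *\<^sub>R x)) x \<partial>lborel)"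
      using fourier_multiplication[OF schwartz_integrable[OF f] schwartz_integrable[OF \<eta>t]] by (simp add: mult.commute)
    also have "\<dots> = (\<integral>x. f x * ((1 / t ^ DIM('a)) *\<^sub>R fourier \<eta> (x /\<^sub>R t)) \<partial>lborel)"
      using t by (subst fourier_dilate) auto
    also have "\<dots> = (\<integral>x. f (t *\<^sub>R x) * fourier \<eta> x \<partial>lborel)"
      using t by (subst integral_affine[where c = t and a = 0]) auto
    finally show ?thesis unfolding t_def .
  qed
  then have "(\<lambda>n. \<integral>x. \<eta> ((1 / real (Suc n)) *\<^sub>R x) * fourier f x \<partial>lborel) \<longlonglongrightarrow> f 0 * (\<integral>\<xi>. fourier \<eta> \<xi> \<partial>lborel)"
    using dilate_null_sequence[OF f fourier_schwartz_integrable[OF \<eta>]] by simp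
  from LIMSEQ_unique[OF dilate_null_sequence[OF \<eta> fourier_schwartz_integrable[OF f]] this] show ?thesis .
qed

lemma fourier_translate:
  assumes [measurable]: "f \<in> borel_measurable borel"
  shows "fourier (\<lambda>x. f (x + a)) \<xi> = cis (2 * pi * (a \<bullet> \<xi>)) * fourier f \<xi>"
proof -
  have "fourier (\<lambda>x. f (x + a)) \<xi> = (\<integral>x. (\<lambda>x. f x * cis (- 2 * pi * ((x - a) \<bullet> \<xi>))) (x + a) \<partial>lborel)"
    by (simp add: fourier_def)
  also have "\<dots> = (\<integral>x. f x * cis (- 2 * pi * ((x - a) \<bullet> \<xi>)) \<partial>lborel)"
    by (rule integral_translate) measurable
  also have "\<dots> = (\<integral>x. cis (2 * pi * (a \<bullet> \<xi>)) * (f x * cis (- 2 * pi * (x \<bullet> \<xi>))) \<partial>lborel)"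
    by (simp add: inner_diff_left algebra_simps cis_mult)
  finally show ?thesis unfolding fourier_def by simp
qed

lemma fourier_modulate:
  "fourier (\<lambda>x. f x * cis (- 2 * pi * (x \<bullet> a))) \<xi> = fourier f (\<xi> + a)"
  unfolding fourier_def by (simp add: inner_add_right algebra_simps cis_mult)

text \<open>A convolution theorem without an inverse transform: the character of the outer transform
  is merged with \<open>b\<close>, where it becomes a translation of \<open>fourier b\<close>, and
  the multiplication formula does the rest.\<close>

lemma fourier_mult_conv:
  assumes a: "a \<in> schwartz" and b: "b \<in> schwartz"
  shows "fourier (\<lambda>\<xi>. fourier a \<xi> * b \<xi>) y = (\<integral>x. a (x - y) * fourier b x \<partial>lborel)"
proof -
  have [measurable]: "a \<in> borel_measurable borel" "fourier b \<in> borel_measurable borel"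
    using a b by (auto intro: schwartz_measurable fourier_schwartz)
  have "fourier (\<lambda>\<xi>. fourier a \<xi> * b \<xi>) y = (\<integral>\<xi>. fourier a \<xi> * (b \<xi> * cis (- 2 * pi * (\<xi> \<bullet> y))) \<partial>lborel)"
    by (simp add: fourier_def[of "\<lambda>\<xi>. fourier a \<xi> * b \<xi>"] mult.assoc)
  also have "\<dots> = (\<integral>x. a x * fourier b (x + y) \<partial>lborel)"
    using fourier_multiplication[OF schwartz_integrable[OF a] fourier_integrable[OF schwartz_integrable[OF b], of y]]
    unfolding fourier_modulate .
  also have "\<dots> = (\<integral>x. (\<lambda>x. a (x - y) * fourier b x) (x + y) \<partial>lborel)" by simp
  also have "\<dots> = (\<integral>x. a (x - y) * fourier b x \<partial>lborel)" by (rule integral_translate) measurable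
  finally show ?thesis .
qed

lemma schwartz_square_integrable: "f \<in> schwartz \<Longrightarrow> integrable lborel (\<lambda>x. (norm (f x))\<^sup>2)"
proof -
  assume f: "f \<in> schwartz"
  have "integrable lborel (\<lambda>x. norm (f x * f x))" by (intro integrable_norm schwartz_integrable schwartz_mult f)
  then show ?thesis by (simp add: norm_mult power2_eq_square)
qed

lemma schwartz_square_pos:
  assumes f: "f \<in> schwartz" and "f x0 \<noteq> 0" shows "(\<integral>x. (norm (f x))\<^sup>2 \<partial>lborel) > 0"
proof -
  have "(\<integral>x. (norm (f x))\<^sup>2 \<partial>lborel) \<noteq> 0"
  proof
    assume "(\<integral>x. (norm (f x))\<^sup>2 \<partial>lborel) = 0"
    then have "AE x in lborel. (norm (f x))\<^sup>2 = 0"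
      using integral_nonneg_eq_0_iff_AE[OF schwartz_square_integrable[OF f]] by simp
    then have "AE x in lborel. f x = 0" by simp
    moreover have op: "open {x. f x \<noteq> 0}"
      using schwartz_continuous_on[OF f, of UNIV] by (intro open_Collect_neq) auto
    ultimately have "{x. f x \<noteq> 0} \<in> null_sets lborel" by (subst (asm) AE_iff_null) auto
    then have "negligible {x. f x \<noteq> 0}" by (auto simp: negligible_iff_null_sets intro: null_sets_completionI)
    with op assms show False using open_not_negligible by blast
  qed
  then show ?thesis using Bochner_Integration.integral_nonneg[of lborel "\<lambda>x. (norm (f x))\<^sup>2"] by (simp add: less_le)
qed

text \<open>The transform \<open>bump\<close> of one fixed generator serves three purposes: it
  normalises the inversion formula, it acts as a mollifier, and its dilates give the dyadic
  partition of frequency space.\<close>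

locale lp_gen =
  fixes \<phi> :: "'a::euclidean_space \<Rightarrow> complex"
  assumes gen: "lp_generator \<phi>"
begin

definition bump :: "'a \<Rightarrow> complex" where "bump = fourier \<phi>"

text \<open>Its value is 1, but only its positivity matters here.\<close>

definition inv_const :: real where "inv_const = Re (\<integral>\<xi>. fourier bump \<xi> \<partial>lborel)"

lemma phi_schwartz: "\<phi> \<in> schwartz" using gen by (simp add: lp_generator_def)
lemma bump_schwartz: "bump \<in> schwartz" unfolding bump_def by (intro fourier_schwartz phi_schwartz)
lemma bump_1: "norm \<xi> \<le> 1 \<Longrightarrow> bump \<xi> = 1" using gen by (simp add: lp_generator_def bump_def)
lemma bump_0: "norm \<xi> \<ge> 2 \<Longrightarrow> bump \<xi> = 0" using gen by (simp add: lp_generator_def bump_def)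

text \<open>The radial profile decreases from \<open>h 0 = 1\<close> to \<open>h 2 = 0\<close> and
  vanishes beyond 2.\<close>

lemma bump_range: "\<exists>r. bump \<xi> = of_real r \<and> 0 \<le> r \<and> r \<le> 1"
proof -
  obtain h :: "real \<Rightarrow> real" where h: "antimono_on {0..} h" "\<And>\<xi>. bump \<xi> = of_real (h (norm \<xi>))"
    using gen unfolding lp_generator_def bump_def by blast
  obtain e :: 'a where e: "norm e = 2" using vector_choose_size[of 2] by auto
  have h2: "h 2 = 0" using h(2)[of e] bump_0[of e] e by simp
  have h0: "h 0 = 1" using h(2)[of 0] bump_1[of 0] of_real_eq_1_iff[of "h 0", where 'a = complex] by simp
  have "h (norm \<xi>) \<le> 1" using monotone_onD[OF h(1), of 0 "norm \<xi>"] h0 by simp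
  moreover have "h (norm \<xi>) \<ge> 0"
  proof (cases "norm \<xi> \<le> 2")
    case True
    then show ?thesis using monotone_onD[OF h(1), of "norm \<xi>" 2] h2 by simp
  next
    case False
    then show ?thesis using h(2)[of \<xi>] bump_0[of \<xi>] by simp
  qed
  ultimately show ?thesis using h by blast
qed

lemma fourier_integral_complex: "(f :: 'a \<Rightarrow> complex) \<in> schwartz \<Longrightarrow> (\<integral>\<xi>. fourier f \<xi> \<partial>lborel) = (\<integral>\<xi>. fourier bump \<xi> \<partial>lborel) * f 0"
  using fourier_integral_ratio[OF _ bump_schwartz, of f] bump_1[of 0] by (simp add: mult.commute)

lemma fourier_fourier_complex:
  fixes f :: "'a \<Rightarrow> complex"
  assumes f: "f \<in> schwartz"
  shows "fourier (fourier f) x = (\<integral>\<xi>. fourier bump \<xi> \<partial>lborel) * f (- x)"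
proof -
  have "(\<lambda>z. f (z + (- x))) \<in> schwartz" using schwartz_affine[OF f, of 1 "- x"] by simp
  from fourier_integral_complex[OF this]
  have "(\<integral>\<xi>. fourier (\<lambda>z. f (z + (- x))) \<xi> \<partial>lborel) = (\<integral>\<xi>. fourier bump \<xi> \<partial>lborel) * f (- x)" by simp
  also have "(\<integral>\<xi>. fourier (\<lambda>z. f (z + (- x))) \<xi> \<partial>lborel) = fourier (fourier f) x"
    unfolding fourier_translate[OF schwartz_measurable[OF f], of "- x"] fourier_def[of "fourier f"]
    by (simp add: mult.commute inner_commute)
  finally show ?thesis .
qed

text \<open>The multiplication formula is applied to \<open>f\<close> and the conjugate of
  \<open>fourier f\<close>. Conjugation makes the latter a reflected transform of
  \<open>cnj f\<close>, whose own transform is known up to the inversion constant; that constant is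
  still a complex number here.\<close>

lemma parseval_complex:
  fixes f :: "'a \<Rightarrow> complex"
  assumes f: "f \<in> schwartz"
  shows "of_real (\<integral>\<xi>. (norm (fourier f \<xi>))\<^sup>2 \<partial>lborel) = (\<integral>\<xi>. fourier bump \<xi> \<partial>lborel) * of_real (\<integral>x. (norm (f x))\<^sup>2 \<partial>lborel)"
proof -
  let ?g = "\<lambda>x. cnj (f x)"
  have g: "?g \<in> schwartz" by (intro schwartz_cnj f)
  have cf: "cnj (fourier f \<xi>) = fourier ?g (- \<xi>)" for \<xi>
    unfolding fourier_def by (subst Bochner_Integration.integral_cnj[symmetric]) (simp add: cis_cnj)
  have [measurable]: "fourier ?g \<in> borel_measurable borel" by (intro schwartz_measurable fourier_schwartz g)
  have ff: "fourier (\<lambda>\<xi>. cnj (fourier f \<xi>)) x = (\<integral>\<xi>. fourier bump \<xi> \<partial>lborel) * ?g x" for x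
  proof -
    have "fourier (\<lambda>\<xi>. cnj (fourier f \<xi>)) x = (\<integral>\<xi>. (\<lambda>\<xi>. fourier ?g \<xi> * cis (- 2 * pi * (\<xi> \<bullet> (- x)))) (0 - \<xi>) \<partial>lborel)"
      unfolding cf fourier_def[of "\<lambda>\<xi>. fourier ?g (- \<xi>)"] by simp
    also have "\<dots> = (\<integral>\<xi>. fourier ?g \<xi> * cis (- 2 * pi * (\<xi> \<bullet> (- x))) \<partial>lborel)"
      by (rule integral_reflect) measurable
    also have "\<dots> = fourier (fourier ?g) (- x)" by (simp add: fourier_def[of "fourier ?g"])
    finally show ?thesis using fourier_fourier_complex[OF g, of "- x"] by simp
  qed
  have "complex_of_real (\<integral>\<xi>. (norm (fourier f \<xi>))\<^sup>2 \<partial>lborel) = (\<integral>\<xi>. fourier f \<xi> * cnj (fourier f \<xi>) \<partial>lborel)"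
    by (simp only: complex_norm_square[symmetric] integral_complex_of_real)
  also have "\<dots> = (\<integral>x. f x * fourier (\<lambda>\<xi>. cnj (fourier f \<xi>)) x \<partial>lborel)"
    by (intro fourier_multiplication schwartz_integrable f schwartz_cnj fourier_schwartz)
  also have "\<dots> = (\<integral>x. (\<integral>\<xi>. fourier bump \<xi> \<partial>lborel) * of_real ((norm (f x))\<^sup>2) \<partial>lborel)"
    unfolding ff complex_norm_square by (simp add: mult_ac)
  also have "\<dots> = (\<integral>\<xi>. fourier bump \<xi> \<partial>lborel) * of_real (\<integral>x. (norm (f x))\<^sup>2 \<partial>lborel)"
    by (simp only: integral_mult_right_zero integral_complex_of_real)
  finally show ?thesis .
qed

text \<open>Parseval for \<open>\<phi>\<close> itself exhibits the constant as a quotient of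
  positive reals. Its left side is positive because \<open>fourier \<phi>\<close> is continuous with
  value 1 at the origin, and this forces the integral of \<open>\<phi>\<close> squared on the right
  to be positive too.\<close>

lemma inv_const_complex: "(\<integral>\<xi>. fourier bump \<xi> \<partial>lborel) = of_real inv_const"
  and inv_const_pos: "inv_const > 0"
proof -
  let ?A = "\<integral>\<xi>. (norm (fourier \<phi> \<xi>))\<^sup>2 \<partial>lborel" and ?B = "\<integral>x. (norm (\<phi> x))\<^sup>2 \<partial>lborel"
  let ?c = "\<integral>\<xi>. fourier bump \<xi> \<partial>lborel"
  have A: "?A > 0"
    using bump_1[of 0] by (intro schwartz_square_pos[of _ 0] fourier_schwartz phi_schwartz) (simp add: bump_def)
  have B: "?B \<ge> 0" by simp
  have eq: "of_real ?A = ?c * of_real ?B" by (rule parseval_complex[OF phi_schwartz])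
  with A B have B: "?B > 0" by (metis less_le mult_zero_right of_real_0 of_real_eq_iff)
  have "?c = of_real (?A / ?B)" using eq B by (simp add: field_simps)
  then show "?c = of_real inv_const" "inv_const > 0" unfolding inv_const_def using A B by auto
qed

lemma fourier_fourier: "(f :: 'a \<Rightarrow> complex) \<in> schwartz \<Longrightarrow> fourier (fourier f) x = of_real inv_const * f (- x)"
  using fourier_fourier_complex inv_const_complex by simp

lemma parseval: "(f :: 'a \<Rightarrow> complex) \<in> schwartz \<Longrightarrow> (\<integral>\<xi>. (norm (fourier f \<xi>))\<^sup>2 \<partial>lborel) = inv_const * (\<integral>x. (norm (f x))\<^sup>2 \<partial>lborel)"
  using parseval_complex[of f] unfolding inv_const_complex by (metis of_real_eq_iff of_real_mult)

lemma fourier_inj: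
  fixes f :: "'a \<Rightarrow> complex"
  assumes "f \<in> schwartz" "g \<in> schwartz" "fourier f = fourier g" shows "f = g"
proof
  fix x show "f x = g x"
    using fourier_fourier[OF assms(1), of "- x"] fourier_fourier[OF assms(2), of "- x"] assms(3) inv_const_pos by simp
qed

text \<open>The preimage is the reflected transform divided by \<open>inv_const\<close>. The lemma
  is what makes the description defining \<open>lp_piece\<close> denote something.\<close>

lemma fourier_surj:
  fixes f :: "'a \<Rightarrow> complex"
  assumes "f \<in> schwartz" obtains g where "g \<in> schwartz" "fourier g = f"
proof
  let ?g = "\<lambda>x. of_real (1 / inv_const) * fourier f (- x)"
  show "?g \<in> schwartz"
    using schwartz_reflect[OF fourier_schwartz[OF assms], of 0] by (intro schwartz_cmult) simp
  have [measurable]: "fourier f \<in> borel_measurable borel" by (intro schwartz_measurable fourier_schwartz assms)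
  have "fourier ?g \<xi> = f \<xi>" for \<xi>
  proof -
    have "fourier ?g \<xi> = (\<integral>x. of_real (1 / inv_const) * (fourier f (- x) * cis (- 2 * pi * (x \<bullet> \<xi>))) \<partial>lborel)"
      unfolding fourier_def[of ?g] by (simp add: mult_ac)
    also have "\<dots> = of_real (1 / inv_const) * (\<integral>x. (\<lambda>x. fourier f x * cis (- 2 * pi * (x \<bullet> - \<xi>))) (0 - x) \<partial>lborel)"
      by simp
    also have "(\<integral>x. (\<lambda>x. fourier f x * cis (- 2 * pi * (x \<bullet> - \<xi>))) (0 - x) \<partial>lborel) = fourier (fourier f) (- \<xi>)"
      unfolding fourier_def[of "fourier f"] by (rule integral_reflect) measurable
    also have "\<dots> = of_real inv_const * f \<xi>" using fourier_fourier[OF assms, of "- \<xi>"] by simp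
    finally show ?thesis using inv_const_pos by simp
  qed
  then show "fourier ?g = f" by blast
qed

end

subsection \<open>Superpositions of translates\<close>

text \<open>With \<open>\<sigma>\<close> the identity this is the convolution of \<open>h\<close>
  with the reflected \<open>\<psi>\<close>; with \<open>\<sigma>\<close> a simple function it is a
  finite combination of reflected translates of \<open>\<psi>\<close>. One definition for both turns
  the passage from finite sums to the integral into a limit in \<open>\<sigma>\<close>.\<close>

definition superpose :: "('a::euclidean_space \<Rightarrow> 'a) \<Rightarrow> ('a \<Rightarrow> complex) \<Rightarrow> ('a \<Rightarrow> complex) \<Rightarrow> 'a \<Rightarrow> complex" where
  "superpose \<sigma> h \<psi> = (\<lambda>y. \<integral>x. \<psi> (\<sigma> x - y) * h x \<partial>lborel)"

text \<open>The class contains the Schwartz functions and also bounded measurable functions cut off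
  to a ball, which need not be continuous but become Schwartz after superposition.\<close>

definition moments :: "('a::euclidean_space \<Rightarrow> complex) \<Rightarrow> bool" where
  "moments h \<longleftrightarrow> h \<in> borel_measurable borel \<and> (\<forall>m. integrable lborel (\<lambda>x. (1 + norm x) ^ m * norm (h x)))"

lemma moments_measurable: "moments h \<Longrightarrow> h \<in> borel_measurable borel"
  by (simp add: moments_def)

lemma moments_weight: "moments h \<Longrightarrow> integrable lborel (\<lambda>x. (1 + norm x) ^ m * norm (h x))"
  by (simp add: moments_def)

lemma moments_integrable: "moments h \<Longrightarrow> integrable lborel h"
  using moments_weight[of h 0] moments_measurable[of h] by (simp add: integrable_norm_iff)

lemma schwartz_moments: "f \<in> schwartz \<Longrightarrow> moments f"
  unfolding moments_def using schwartz_weight_integrable schwartz_measurable by blast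

lemma superpose_integrand_integrable:
  assumes "\<psi> \<in> schwartz" and [measurable]: "\<sigma> \<in> borel_measurable borel" and h: "integrable lborel h"
  shows "integrable lborel (\<lambda>x. \<psi> (\<sigma> x - y) * h x)"
proof -
  obtain C where C: "C \<ge> 0" "\<And>x. norm (\<psi> x) \<le> C" using rapid_bounded[OF schwartz_rapid[OF assms(1)]] by blast
  have [measurable]: "\<psi> \<in> borel_measurable borel" "h \<in> borel_measurable borel" using assms by (auto intro: schwartz_measurable)
  show ?thesis
    by (rule Bochner_Integration.integrable_bound[OF integrable_mult_right[OF h, of "of_real C"]])
       (use C in \<open>auto simp: norm_mult intro!: mult_right_mono\<close>)
qed

text \<open>All derivatives fall on \<open>\<psi>\<close>, whose partial derivatives are bounded, so
  a multiple of \<open>norm (h x)\<close> serves as majorant.\<close>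

lemma superpose_has_derivative:
  assumes \<psi>: "\<psi> \<in> schwartz" and [measurable]: "\<sigma> \<in> borel_measurable borel" and h: "integrable lborel h"
  shows "(superpose \<sigma> h \<psi> has_derivative
    (\<lambda>k. \<integral>x. (- (\<Sum>b\<in>Basis. (k \<bullet> b) *\<^sub>R pd b \<psi> (\<sigma> x - y))) * h x \<partial>lborel)) (at y)"
proof -
  have "\<exists>C. \<forall>b\<in>Basis. \<forall>x. norm (pd b \<psi> x) \<le> C b"
  proof -
    have "\<exists>C. \<forall>x. norm (pd b \<psi> x) \<le> C" if "b \<in> Basis" for b
      using rapid_bounded[OF schwartz_rapid[OF schwartz_pd[OF \<psi> that]]] by metis
    then show ?thesis by metis
  qed
  then obtain C where C: "\<And>b x. b \<in> Basis \<Longrightarrow> norm (pd b \<psi> x) \<le> C b" by blast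
  have C0: "C b \<ge> 0" if "b \<in> Basis" for b using order_trans[OF norm_ge_zero C[OF that]] .
  note [measurable] = borel_measurable_integrable[OF h] schwartz_measurable[OF \<psi>]
  show ?thesis
    unfolding superpose_def
  proof (rule has_derivative_integral_param[where U = UNIV and w = "\<lambda>x. (\<Sum>b\<in>Basis. C b) * norm (h x)"])
    show "integrable lborel (\<lambda>x. \<psi> (\<sigma> x - z) * h x)" for z
      by (rule superpose_integrand_integrable) fact+
    show "(\<lambda>x. (- (\<Sum>b\<in>Basis. (k \<bullet> b) *\<^sub>R pd b \<psi> (\<sigma> x - y))) * h x) \<in> borel_measurable lborel" for k
      using h by (auto intro!: borel_measurable_times borel_measurable_sum borel_measurable_scaleR
           measurable_compose[OF _ schwartz_measurable[OF schwartz_pd[OF \<psi>]]])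
    show "((\<lambda>z. \<psi> (\<sigma> x - z) * h x) has_derivative
        (\<lambda>k. (- (\<Sum>b\<in>Basis. (k \<bullet> b) *\<^sub>R pd b \<psi> (\<sigma> x - z))) * h x)) (at z)" for x z
    proof -
      have "((\<lambda>z. \<sigma> x - z) has_derivative (\<lambda>k. - k)) (at z)" by (auto intro!: derivative_eq_intros)
      from has_derivative_compose[OF this schwartz_has_derivative_pd[OF \<psi>]]
      have "((\<lambda>z. \<psi> (\<sigma> x - z)) has_derivative (\<lambda>k. - (\<Sum>b\<in>Basis. (k \<bullet> b) *\<^sub>R pd b \<psi> (\<sigma> x - z)))) (at z)"
        by (simp add: sum_negf)
      then show ?thesis by (rule has_derivative_mult_left)
    qed
    fix x z k :: 'a
    have "norm (\<Sum>b\<in>Basis. (k \<bullet> b) *\<^sub>R pd b \<psi> (\<sigma> x - z)) \<le> (\<Sum>b\<in>Basis. norm k * C b)"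
      using C C0 by (intro sum_norm_le) (auto intro!: mult_mono Basis_le_norm)
    also have "\<dots> = (\<Sum>b\<in>Basis. C b) * norm k" by (simp add: sum_distrib_right mult.commute[of "norm k"])
    finally have "norm (\<Sum>b\<in>Basis. (k \<bullet> b) *\<^sub>R pd b \<psi> (\<sigma> x - z)) * norm (h x) \<le> ((\<Sum>b\<in>Basis. C b) * norm k) * norm (h x)"
      by (rule mult_right_mono) simp
    then show "norm (- (\<Sum>b\<in>Basis. (k \<bullet> b) *\<^sub>R pd b \<psi> (\<sigma> x - z)) * h x) \<le> (\<Sum>b\<in>Basis. C b) * norm (h x) * norm k"
      by (simp only: norm_mult norm_minus_cancel mult_ac)
    show "integrable lborel (\<lambda>x. (\<Sum>b\<in>Basis. C b) * norm (h x))" using h by simp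
  qed auto
qed

lemma pd_superpose:
  assumes \<psi>: "\<psi> \<in> schwartz" and \<sigma>: "\<sigma> \<in> borel_measurable borel" and h: "integrable lborel h" and b: "b \<in> Basis"
  shows "pd b (superpose \<sigma> h \<psi>) y = - superpose \<sigma> h (pd b \<psi>) y"
proof -
  have "(\<Sum>i\<in>Basis. (b \<bullet> i) *\<^sub>R pd i \<psi> (\<sigma> x - y)) = pd b \<psi> (\<sigma> x - y)" for x
    using b by (simp add: inner_Basis if_distrib[of "\<lambda>c. c *\<^sub>R _"] sum.delta cong: if_cong)
  then show ?thesis
    using pd_eqI[OF superpose_has_derivative[OF \<psi> \<sigma> h], of b y] unfolding superpose_def by simp
qed

lemma iter_partial_superpose:
  assumes \<psi>: "\<psi> \<in> schwartz" and \<sigma>: "\<sigma> \<in> borel_measurable borel" and h: "integrable lborel h"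
    and bs: "set bs \<subseteq> Basis"
  shows "iter_partial bs (superpose \<sigma> h \<psi>) = (\<lambda>y. (- 1) ^ length bs * superpose \<sigma> h (iter_partial bs \<psi>) y)"
  using bs
proof (induction bs)
  case (Cons b bs)
  have S: "iter_partial bs \<psi> \<in> schwartz" using Cons by (intro schwartz_iter_partial \<psi>) auto
  have b: "b \<in> Basis" using Cons by simp
  have "iter_partial (b # bs) (superpose \<sigma> h \<psi>) y = pd b (\<lambda>y. (- 1) ^ length bs * superpose \<sigma> h (iter_partial bs \<psi>) y) y" for y
    using Cons by (simp add: pd_def)
  also have "\<dots> y = (- 1) ^ length bs * pd b (superpose \<sigma> h (iter_partial bs \<psi>)) y" for y
    using pd_eqI[OF has_derivative_mult_right[OF superpose_has_derivative[OF S \<sigma> h]]]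
      pd_eqI[OF superpose_has_derivative[OF S \<sigma> h]] by metis
  also have "\<dots> y = (- 1) ^ length (b # bs) * superpose \<sigma> h (iter_partial (b # bs) \<psi>) y" for y
    unfolding pd_superpose[OF S \<sigma> h b] by (simp add: pd_def)
  finally show ?case by blast
qed simp

text \<open>From \<open>norm y \<le> 2 * norm x + norm (\<sigma> x - y)\<close> the weight in
  \<open>y\<close> is shared between the moments of \<open>h\<close> and the decay of
  \<open>\<psi>\<close>. The bound on \<open>\<sigma>\<close> is the one that the usual simple
  approximations of the identity satisfy.\<close>

lemma superpose_rapid:
  assumes \<psi>: "\<psi> \<in> schwartz" and \<sigma>: "\<sigma> \<in> borel_measurable borel" "\<And>x. norm (\<sigma> x) \<le> 2 * norm x" and h: "moments h"
  shows "rapid (superpose \<sigma> h \<psi>)"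
  unfolding rapid_def
proof
  fix m
  obtain C where C: "C \<ge> 0" "\<And>x. (1 + norm x) ^ m * norm (\<psi> x) \<le> C" using rapidD[OF schwartz_rapid[OF \<psi>]] by metis
  have "norm y ^ m * norm (superpose \<sigma> h \<psi> y) \<le> (\<integral>x. 2 ^ m * C * ((1 + norm x) ^ m * norm (h x)) \<partial>lborel)" for y
  proof -
    have int: "integrable lborel (\<lambda>x. \<psi> (\<sigma> x - y) * h x)"
      by (rule superpose_integrand_integrable) (use assms moments_integrable in auto)
    have pt: "norm y ^ m * norm (\<psi> (\<sigma> x - y) * h x) \<le> 2 ^ m * C * ((1 + norm x) ^ m * norm (h x))" for x
    proof -
      have "norm y \<le> norm (\<sigma> x) + norm (\<sigma> x - y)" using norm_triangle_ineq4[of "\<sigma> x" "\<sigma> x - y"] by simp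
      also have "\<dots> \<le> 2 * norm x + norm (\<sigma> x - y)" using \<sigma> by simp
      also have "\<dots> \<le> 2 * (1 + norm x) * (1 + norm (\<sigma> x - y))" by (simp add: algebra_simps)
      finally have "norm y ^ m \<le> (2 * (1 + norm x) * (1 + norm (\<sigma> x - y))) ^ m" by (rule power_mono) simp
      then have "norm y ^ m * norm (\<psi> (\<sigma> x - y) * h x) \<le> (2 * (1 + norm x) * (1 + norm (\<sigma> x - y))) ^ m * norm (\<psi> (\<sigma> x - y) * h x)"
        by (rule mult_right_mono) simp
      also have "\<dots> = (2 ^ m * ((1 + norm x) ^ m * norm (h x))) * ((1 + norm (\<sigma> x - y)) ^ m * norm (\<psi> (\<sigma> x - y)))"
        by (simp only: power_mult_distrib norm_mult mult_ac)
      also have "\<dots> \<le> (2 ^ m * ((1 + norm x) ^ m * norm (h x))) * C" by (intro mult_left_mono C) auto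
      finally show ?thesis by (simp only: mult_ac)
    qed
    have "norm y ^ m * norm (superpose \<sigma> h \<psi> y) \<le> norm y ^ m * (\<integral>x. norm (\<psi> (\<sigma> x - y) * h x) \<partial>lborel)"
      unfolding superpose_def by (intro mult_left_mono integral_norm_bound) auto
    also have "\<dots> = (\<integral>x. norm y ^ m * norm (\<psi> (\<sigma> x - y) * h x) \<partial>lborel)" by simp
    also have "\<dots> \<le> (\<integral>x. 2 ^ m * C * ((1 + norm x) ^ m * norm (h x)) \<partial>lborel)"
      by (intro integral_mono integrable_mult_right integrable_norm int moments_weight h pt)
    finally show ?thesis .
  qed
  then show "\<exists>C. \<forall>y. norm y ^ m * norm (superpose \<sigma> h \<psi> y) \<le> C" by blast
qed

lemma superpose_schwartz:
  assumes \<psi>: "\<psi> \<in> schwartz" and \<sigma>: "\<sigma> \<in> borel_measurable borel" "\<And>x. norm (\<sigma> x) \<le> 2 * norm x" and h: "moments h"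
  shows "superpose \<sigma> h \<psi> \<in> schwartz"
  unfolding schwartz_def bounded_range_rapid mem_Collect_eq
proof (intro allI impI conjI)
  fix bs :: "'a list" assume bs: "set bs \<subseteq> Basis"
  have S: "iter_partial bs \<psi> \<in> schwartz" using bs by (intro schwartz_iter_partial \<psi>) auto
  show "iter_partial bs (superpose \<sigma> h \<psi>) differentiable_on UNIV"
    unfolding iter_partial_superpose[OF \<psi> \<sigma>(1) moments_integrable[OF h] bs] differentiable_on_def
    by (rule ballI, rule differentiableI, rule has_derivative_mult_right)
      (rule superpose_has_derivative[OF S \<sigma>(1) moments_integrable[OF h]])
  show "rapid (iter_partial bs (superpose \<sigma> h \<psi>))"
    unfolding iter_partial_superpose[OF \<psi> \<sigma>(1) moments_integrable[OF h] bs]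
    by (intro rapid_cmult superpose_rapid S \<sigma> h)
qed

text \<open>The mean value inequality is used on the segment from \<open>z - y\<close> to
  \<open>x - y\<close>. A point \<open>w\<close> of it expresses \<open>y\<close> as a convex
  combination of \<open>x\<close> and \<open>z\<close> minus \<open>w\<close>, so
  \<open>norm y ^ m\<close> splits into a power of \<open>1 + norm x + norm z\<close> and a power of
  \<open>1 + norm w\<close>, and the decay of the partial derivatives at \<open>w\<close> absorbs
  the latter.\<close>

lemma schwartz_translate_lipschitz:
  assumes \<psi>: "\<psi> \<in> schwartz"
  shows "\<exists>C\<ge>0. \<forall>x z y. norm y ^ m * norm (\<psi> (x - y) - \<psi> (z - y)) \<le> C * norm (x - z) * (1 + norm x + norm z) ^ m"
proof -
  have "\<exists>C. C \<ge> 0 \<and> (\<forall>x. (1 + norm x) ^ m * norm (pd b \<psi> x) \<le> C)" if "b \<in> Basis" for b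
    using rapidD[OF schwartz_rapid[OF schwartz_pd[OF \<psi> that]]] by metis
  then have ex: "\<exists>C. \<forall>b\<in>Basis. C b \<ge> 0 \<and> (\<forall>x. (1 + norm x) ^ m * norm (pd b \<psi> x) \<le> C b)"
    by (intro bchoice ballI)
  obtain C where "\<forall>b\<in>Basis. C b \<ge> 0 \<and> (\<forall>x. (1 + norm x) ^ m * norm (pd b \<psi> x) \<le> C b)"
    using ex by (rule exE)
  then have C: "\<And>b. b \<in> Basis \<Longrightarrow> C b \<ge> 0" "\<And>b x. b \<in> Basis \<Longrightarrow> (1 + norm x) ^ m * norm (pd b \<psi> x) \<le> C b"
    by auto
  define S where "S = (\<Sum>b\<in>Basis. C b)"
  have S: "S \<ge> 0" unfolding S_def by (rule sum_nonneg) (rule C(1))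
  have "norm y ^ m * norm (\<psi> (x - y) - \<psi> (z - y)) \<le> S * norm (x - z) * (1 + norm x + norm z) ^ m" for x z y :: 'a
  proof -
    define B where "B = S * (1 + norm x + norm z) ^ m"
    have "norm (norm y ^ m *\<^sub>R \<psi> (x - y) - norm y ^ m *\<^sub>R \<psi> (z - y)) \<le> B * norm ((x - y) - (z - y))"
    proof (rule differentiable_bound[OF convex_closed_segment])
      show "((\<lambda>w. norm y ^ m *\<^sub>R \<psi> w) has_derivative (\<lambda>h. norm y ^ m *\<^sub>R (\<Sum>b\<in>Basis. (h \<bullet> b) *\<^sub>R pd b \<psi> w)))
         (at w within closed_segment (z - y) (x - y))" for w
        by (rule has_derivative_scaleR_right[OF has_derivative_at_withinI[OF schwartz_has_derivative_pd[OF \<psi>]]])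
      fix w assume "w \<in> closed_segment (z - y) (x - y)"
      then obtain u where u: "0 \<le> u" "u \<le> 1" "w = (1 - u) *\<^sub>R (z - y) + u *\<^sub>R (x - y)"
        unfolding in_segment by blast
      have y: "y = (1 - u) *\<^sub>R z + u *\<^sub>R x - w" using u by (simp add: algebra_simps)
      then have "norm y = norm ((1 - u) *\<^sub>R z + u *\<^sub>R x - w)" by (rule arg_cong)
      then have "norm y \<le> norm ((1 - u) *\<^sub>R z) + norm (u *\<^sub>R x) + norm w"
        using norm_triangle_ineq4[of "(1 - u) *\<^sub>R z + u *\<^sub>R x" w] norm_triangle_ineq[of "(1 - u) *\<^sub>R z" "u *\<^sub>R x"]
        by linarith
      also have "\<dots> \<le> norm z + norm x + norm w"
        using u by (simp add: add_mono mult_left_le_one_le)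
      also have "\<dots> \<le> (1 + norm x + norm z) * (1 + norm w)" by (simp add: algebra_simps)
      finally have "norm y ^ m \<le> ((1 + norm x + norm z) * (1 + norm w)) ^ m" by (rule power_mono) simp
      then have ym: "norm y ^ m \<le> (1 + norm x + norm z) ^ m * (1 + norm w) ^ m" by (simp add: power_mult_distrib)
      show "onorm (\<lambda>h. norm y ^ m *\<^sub>R (\<Sum>b\<in>Basis. (h \<bullet> b) *\<^sub>R pd b \<psi> w)) \<le> B"
      proof (rule onorm_bound)
        show "B \<ge> 0" unfolding B_def using S by simp
        fix h :: 'a
        have "norm (\<Sum>b\<in>Basis. (h \<bullet> b) *\<^sub>R pd b \<psi> w) \<le> (\<Sum>b\<in>Basis. norm h * norm (pd b \<psi> w))"
          by (intro sum_norm_le) (auto intro!: mult_mono Basis_le_norm)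
        then have "norm (norm y ^ m *\<^sub>R (\<Sum>b\<in>Basis. (h \<bullet> b) *\<^sub>R pd b \<psi> w)) \<le> norm y ^ m * (\<Sum>b\<in>Basis. norm h * norm (pd b \<psi> w))"
          by (simp add: mult_left_mono)
        also have "\<dots> \<le> ((1 + norm x + norm z) ^ m * (1 + norm w) ^ m) * (\<Sum>b\<in>Basis. norm h * norm (pd b \<psi> w))"
          by (intro mult_right_mono ym sum_nonneg) auto
        also have "\<dots> = (1 + norm x + norm z) ^ m * norm h * (\<Sum>b\<in>Basis. (1 + norm w) ^ m * norm (pd b \<psi> w))"
          by (simp add: sum_distrib_left mult_ac)
        also have "\<dots> \<le> (1 + norm x + norm z) ^ m * norm h * S"
          unfolding S_def by (intro mult_left_mono sum_mono C) auto
        finally show "norm (norm y ^ m *\<^sub>R (\<Sum>b\<in>Basis. (h \<bullet> b) *\<^sub>R pd b \<psi> w)) \<le> B * norm h"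
          by (simp add: B_def mult_ac)
      qed
    qed auto
    then show ?thesis unfolding B_def scaleR_diff_right[symmetric] norm_scaleR by (simp add: mult_ac)
  qed
  then show ?thesis using S by blast
qed

subsection \<open>Tempered distributions\<close>

lemma tempered_add: "u \<in> tempered \<Longrightarrow> f \<in> schwartz \<Longrightarrow> g \<in> schwartz \<Longrightarrow> u (\<lambda>x. f x + g x) = u f + u g"
  and tempered_cmult: "u \<in> tempered \<Longrightarrow> f \<in> schwartz \<Longrightarrow> u (\<lambda>x. c * f x) = c * u f"
  by (auto simp: tempered_def)

lemma tempered_diff: "u \<in> tempered \<Longrightarrow> f \<in> schwartz \<Longrightarrow> g \<in> schwartz \<Longrightarrow> u (\<lambda>x. f x - g x) = u f - u g"
  using tempered_add[of u f "\<lambda>x. - 1 * g x"] tempered_cmult[of u g "- 1"] schwartz_cmult[of g "- 1"] by simp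

lemma tempered_zero: "u \<in> tempered \<Longrightarrow> u (\<lambda>x. 0) = 0"
  using tempered_cmult[of u "\<lambda>x. 0" 0] schwartz_zero by simp

lemma tempered_sum:
  assumes "u \<in> tempered" "finite I" "\<And>i. i \<in> I \<Longrightarrow> f i \<in> schwartz"
  shows "u (\<lambda>x. \<Sum>i\<in>I. f i x) = (\<Sum>i\<in>I. u (f i))"
  using assms(2,3)
proof (induction I rule: finite_induct)
  case (insert i I)
  then have "u (\<lambda>x. f i x + (\<Sum>i\<in>I. f i x)) = u (f i) + u (\<lambda>x. \<Sum>i\<in>I. f i x)"
    by (intro tempered_add schwartz_sum assms(1)) auto
  with insert show ?case by simp
qed (simp add: tempered_zero assms(1))

text \<open>This trades the sum of suprema for one pointwise bound \<open>B\<close>, the form in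
  which estimates of Schwartz functions are obtained below. The number of seminorms involved enters
  the constant.\<close>

lemma tempered_bound:
  fixes u :: "('a::euclidean_space \<Rightarrow> complex) \<Rightarrow> complex"
  assumes "u \<in> tempered"
  obtains C N where "C \<ge> 0" and "\<And>f B. f \<in> schwartz \<Longrightarrow>
    (\<And>m bs y. m \<le> N \<Longrightarrow> set bs \<subseteq> Basis \<Longrightarrow> length bs \<le> N \<Longrightarrow> norm y ^ m * norm (iter_partial bs f y) \<le> B) \<Longrightarrow>
    norm (u f) \<le> C * B"
proof -
  from assms obtain C N where CN: "\<And>f. f \<in> schwartz \<Longrightarrow> norm (u f) \<le>
        C * (\<Sum>m\<le>N. \<Sum>bs | set bs \<subseteq> Basis \<and> length bs \<le> N. schwartz_seminorm m bs f)"
    unfolding tempered_def by blast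
  define L where "L = {bs :: 'a list. set bs \<subseteq> Basis \<and> length bs \<le> N}"
  have L: "finite L" unfolding L_def by (rule finite_lists_length_le) simp
  define C' where "C' = \<bar>C\<bar> * (real (Suc N) * real (card L))"
  have "norm (u f) \<le> C' * B" if f: "f \<in> schwartz"
    and B: "\<And>m bs y. m \<le> N \<Longrightarrow> set bs \<subseteq> Basis \<Longrightarrow> length bs \<le> N \<Longrightarrow> norm y ^ m * norm (iter_partial bs f y) \<le> B" for f B
  proof -
    have "schwartz_seminorm m bs f \<le> B" if "m \<le> N" "bs \<in> L" for m bs
      unfolding schwartz_seminorm_def using that B by (intro cSUP_least) (auto simp: L_def)
    \<comment> \<open>The seminorm is a supremum of reals; the bound \<open>B\<close> makes the set
      bounded above, so that the supremum dominates its nonnegative value at the origin.\<close>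
    moreover have "0 \<le> schwartz_seminorm m bs f" if "m \<le> N" "bs \<in> L" for m bs
    proof -
      have "0 \<le> norm (0::'a) ^ m * norm (iter_partial bs f 0)" by simp
      also have "\<dots> \<le> schwartz_seminorm m bs f"
        unfolding schwartz_seminorm_def using that B by (intro cSUP_upper bdd_aboveI2[where M = B]) (auto simp: L_def)
      finally show ?thesis .
    qed
    ultimately have "0 \<le> schwartz_seminorm m bs f \<and> schwartz_seminorm m bs f \<le> B" if "m \<in> {..N}" "bs \<in> L" for m bs
      using that by simp
    then have s: "0 \<le> (\<Sum>m\<le>N. \<Sum>bs\<in>L. schwartz_seminorm m bs f)"
        "(\<Sum>m\<le>N. \<Sum>bs\<in>L. schwartz_seminorm m bs f) \<le> (\<Sum>m\<le>N. \<Sum>bs\<in>L. B)"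
      by (blast intro: sum_nonneg, intro sum_mono, blast)
    have "norm (u f) \<le> C * (\<Sum>m\<le>N. \<Sum>bs\<in>L. schwartz_seminorm m bs f)" using CN[OF f] unfolding L_def .
    also have "\<dots> \<le> \<bar>C\<bar> * (\<Sum>m\<le>N. \<Sum>bs\<in>L. schwartz_seminorm m bs f)" using s by (intro mult_right_mono) auto
    also have "\<dots> \<le> \<bar>C\<bar> * (\<Sum>m\<le>N. \<Sum>bs\<in>L. B)" using s by (intro mult_left_mono) auto
    also have "\<dots> = C' * B" by (simp add: C'_def algebra_simps)
    finally show ?thesis .
  qed
  moreover have "C' \<ge> 0" by (simp add: C'_def)
  ultimately show ?thesis using that by blast
qed

text \<open>The constants of the finitely many seminorms occurring in \<open>tempered_bound\<close>
  are added up, so that one constant serves them all.\<close>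

lemma translate_lipschitz_uniform:
  fixes \<psi> :: "'a::euclidean_space \<Rightarrow> complex"
  assumes \<psi>: "\<psi> \<in> schwartz"
  obtains C where "C \<ge> 0" "\<And>m bs x z y. m \<le> N \<Longrightarrow> set bs \<subseteq> Basis \<Longrightarrow> length bs \<le> N \<Longrightarrow>
      norm y ^ m * norm (iter_partial bs \<psi> (x - y) - iter_partial bs \<psi> (z - y)) \<le> C * norm (x - z) * (1 + norm x + norm z) ^ N"
proof -
  define L where "L = {bs :: 'a list. set bs \<subseteq> Basis \<and> length bs \<le> N}"
  have L: "finite L" unfolding L_def by (rule finite_lists_length_le) simp
  have "\<exists>C\<ge>0. \<forall>x z y. norm y ^ m * norm (iter_partial bs \<psi> (x - y) - iter_partial bs \<psi> (z - y)) \<le> C * norm (x - z) * (1 + norm x + norm z) ^ m"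
    if "bs \<in> L" for m bs
    using that by (intro schwartz_translate_lipschitz schwartz_iter_partial \<psi>) (auto simp: L_def)
  then have "\<exists>C. \<forall>bs\<in>L. 0 \<le> C bs \<and> (\<forall>x z y. norm y ^ m * norm (iter_partial bs \<psi> (x - y) - iter_partial bs \<psi> (z - y)) \<le> C bs * norm (x - z) * (1 + norm x + norm z) ^ m)"
    for m by (intro bchoice ballI)
  then have ex: "\<exists>C. \<forall>m. \<forall>bs\<in>L. 0 \<le> C m bs \<and> (\<forall>x z y. norm y ^ m * norm (iter_partial bs \<psi> (x - y) - iter_partial bs \<psi> (z - y)) \<le> C m bs * norm (x - z) * (1 + norm x + norm z) ^ m)"
    by (intro choice allI)
  obtain C where "\<forall>m. \<forall>bs\<in>L. 0 \<le> C m bs \<and> (\<forall>x z y. norm y ^ m * norm (iter_partial bs \<psi> (x - y) - iter_partial bs \<psi> (z - y)) \<le> C m bs * norm (x - z) * (1 + norm x + norm z) ^ m)"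
    using ex by (rule exE)
  then have C: "\<And>m bs. bs \<in> L \<Longrightarrow> C m bs \<ge> 0"
    "\<And>m bs x z y. bs \<in> L \<Longrightarrow> norm y ^ m * norm (iter_partial bs \<psi> (x - y) - iter_partial bs \<psi> (z - y)) \<le> C m bs * norm (x - z) * (1 + norm x + norm z) ^ m"
    by auto
  define D where "D = (\<Sum>m\<le>N. \<Sum>bs\<in>L. C m bs)"
  have le: "C m bs \<le> D" if "m \<le> N" "bs \<in> L" for m bs
  proof -
    have "C m bs \<le> (\<Sum>bs\<in>L. C m bs)" using L that C by (intro member_le_sum) auto
    also have "\<dots> \<le> D" unfolding D_def using that C by (intro member_le_sum) (auto intro: sum_nonneg)
    finally show ?thesis .
  qed
  have "norm y ^ m * norm (iter_partial bs \<psi> (x - y) - iter_partial bs \<psi> (z - y)) \<le> D * norm (x - z) * (1 + norm x + norm z) ^ N"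
    if "m \<le> N" "bs \<in> L" for m bs x z y
  proof -
    have "norm y ^ m * norm (iter_partial bs \<psi> (x - y) - iter_partial bs \<psi> (z - y)) \<le> C m bs * norm (x - z) * (1 + norm x + norm z) ^ m"
      using C that by blast
    also have "\<dots> \<le> D * norm (x - z) * (1 + norm x + norm z) ^ N"
      using le[OF that] C(1)[OF that(2), of m] that
      by (intro mult_mono power_increasing mult_nonneg_nonneg) auto
    finally show ?thesis .
  qed
  moreover have "D \<ge> 0" unfolding D_def using C by (intro sum_nonneg) auto
  ultimately show ?thesis using that unfolding L_def by blast
qed

lemma iter_partial_reflect:
  assumes \<psi>: "\<psi> \<in> schwartz" and bs: "set bs \<subseteq> Basis"
  shows "iter_partial bs (\<lambda>y. \<psi> (x - y)) = (\<lambda>y. (- 1) ^ length bs * iter_partial bs \<psi> (x - y))"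
  using bs
proof (induction bs)
  case (Cons b bs)
  have S: "iter_partial bs \<psi> \<in> schwartz" using Cons by (intro schwartz_iter_partial \<psi>) auto
  have "((\<lambda>y. x - y) has_derivative (\<lambda>k. - k)) (at y)" for y by (auto intro!: derivative_eq_intros)
  from has_derivative_compose[OF this schwartz_has_derivative[OF S]]
  have "((\<lambda>y. iter_partial bs \<psi> (x - y)) has_derivative (\<lambda>h. frechet_derivative (iter_partial bs \<psi>) (at (x - y)) (- h))) (at y)" for y .
  from pd_eqI[OF has_derivative_mult_right[OF this]]
  have "pd b (\<lambda>y. (- 1) ^ length bs * iter_partial bs \<psi> (x - y)) y = (- 1) ^ length bs * frechet_derivative (iter_partial bs \<psi>) (at (x - y)) (- b)" for y .
  moreover have "frechet_derivative (iter_partial bs \<psi>) (at (x - y)) (- b) = - iter_partial (b # bs) \<psi> (x - y)" for y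
    using schwartz_has_derivative[OF S, THEN has_derivative_bounded_linear] by (simp add: linear_simps)
  ultimately show ?case using Cons by (auto simp: pd_def)
qed simp

text \<open>The seminorm bound for \<open>u\<close> transports the Lipschitz dependence of the
  translates to their values under \<open>u\<close>. Continuity and polynomial growth of
  \<open>conv_distr \<psi> u\<close> are both read off from this estimate.\<close>

lemma tempered_translate_lipschitz:
  assumes u: "u \<in> tempered" and \<psi>: "\<psi> \<in> schwartz"
  shows "\<exists>C\<ge>0. \<exists>N. \<forall>x z. norm (conv_distr \<psi> u x - conv_distr \<psi> u z) \<le> C * norm (x - z) * (1 + norm x + norm z) ^ N"
proof -
  obtain C N where CN: "C \<ge> 0" "\<And>f B. f \<in> schwartz \<Longrightarrow>
    (\<And>m bs y. m \<le> N \<Longrightarrow> set bs \<subseteq> Basis \<Longrightarrow> length bs \<le> N \<Longrightarrow> norm y ^ m * norm (iter_partial bs f y) \<le> B) \<Longrightarrow>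
    norm (u f) \<le> C * B" using tempered_bound[OF u] by metis
  obtain D where D: "D \<ge> 0" "\<And>m bs x z y. m \<le> N \<Longrightarrow> set bs \<subseteq> Basis \<Longrightarrow> length bs \<le> N \<Longrightarrow>
      norm y ^ m * norm (iter_partial bs \<psi> (x - y) - iter_partial bs \<psi> (z - y)) \<le> D * norm (x - z) * (1 + norm x + norm z) ^ N"
    using translate_lipschitz_uniform[OF \<psi>] by metis
  have "norm (conv_distr \<psi> u x - conv_distr \<psi> u z) \<le> C * D * norm (x - z) * (1 + norm x + norm z) ^ N" for x z
  proof -
    have "conv_distr \<psi> u x - conv_distr \<psi> u z = u (\<lambda>y. \<psi> (x - y) - \<psi> (z - y))"
      unfolding conv_distr_def by (intro tempered_diff[symmetric] u schwartz_reflect \<psi>)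
    also have "norm \<dots> \<le> C * (D * norm (x - z) * (1 + norm x + norm z) ^ N)"
    proof (rule CN(2))
      show "(\<lambda>y. \<psi> (x - y) - \<psi> (z - y)) \<in> schwartz" by (intro schwartz_diff schwartz_reflect \<psi>)
      fix m y and bs :: "'a list" assume as: "m \<le> N" "set bs \<subseteq> Basis" "length bs \<le> N"
      have "norm (iter_partial bs (\<lambda>y. \<psi> (x - y) - \<psi> (z - y)) y) = norm (iter_partial bs \<psi> (x - y) - iter_partial bs \<psi> (z - y))"
        unfolding iter_partial_diff[OF schwartz_reflect[OF \<psi>] schwartz_reflect[OF \<psi>] as(2)] iter_partial_reflect[OF \<psi> as(2)]
        by (simp flip: right_diff_distrib add: norm_mult norm_power)
      then show "norm y ^ m * norm (iter_partial bs (\<lambda>y. \<psi> (x - y) - \<psi> (z - y)) y) \<le> D * norm (x - z) * (1 + norm x + norm z) ^ N"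
        using D(2)[OF as] by simp
    qed
    finally show ?thesis by (simp add: mult_ac)
  qed
  then show ?thesis using CN(1) D(1) by (intro exI[of _ "C * D"]) auto
qed

lemma conv_distr_continuous:
  assumes u: "u \<in> tempered" and \<psi>: "\<psi> \<in> schwartz"
  shows "continuous_on UNIV (conv_distr \<psi> u)"
proof -
  obtain C N where C: "C \<ge> 0" "\<And>x z. norm (conv_distr \<psi> u x - conv_distr \<psi> u z) \<le> C * norm (x - z) * (1 + norm x + norm z) ^ N"
    using tempered_translate_lipschitz[OF assms] by metis
  have "((\<lambda>z. C * norm (z - x) * (1 + norm z + norm x) ^ N) \<longlongrightarrow> C * norm (x - x) * (1 + norm x + norm x) ^ N) (at x)" for x
    by (intro tendsto_intros)
  then have "((\<lambda>z. conv_distr \<psi> u z - conv_distr \<psi> u x) \<longlongrightarrow> 0) (at x)" for x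
    by (intro Lim_null_comparison[OF always_eventually[OF allI[OF C(2)]]]) simp
  then have "(conv_distr \<psi> u \<longlongrightarrow> conv_distr \<psi> u x) (at x)" for x by (rule Lim_null[THEN iffD2])
  then show ?thesis by (simp add: continuous_on_def)
qed

lemma conv_distr_measurable: "u \<in> tempered \<Longrightarrow> \<psi> \<in> schwartz \<Longrightarrow> conv_distr \<psi> u \<in> borel_measurable borel"
  by (intro borel_measurable_continuous_onI conv_distr_continuous)

lemma conv_distr_growth:
  assumes u: "u \<in> tempered" and \<psi>: "\<psi> \<in> schwartz"
  shows "\<exists>C\<ge>0. \<exists>N. \<forall>x. norm (conv_distr \<psi> u x) \<le> C * (1 + norm x) ^ N"
proof -
  obtain C N where C: "C \<ge> 0" "\<And>x z. norm (conv_distr \<psi> u x - conv_distr \<psi> u z) \<le> C * norm (x - z) * (1 + norm x + norm z) ^ N"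
    using tempered_translate_lipschitz[OF assms] by metis
  have "norm (conv_distr \<psi> u x) \<le> (C + norm (conv_distr \<psi> u 0)) * (1 + norm x) ^ Suc N" for x
  proof -
    have "norm (conv_distr \<psi> u x) \<le> norm (conv_distr \<psi> u x - conv_distr \<psi> u 0) + norm (conv_distr \<psi> u 0)"
      by (metis diff_add_cancel norm_triangle_ineq)
    also have "\<dots> \<le> C * norm x * (1 + norm x) ^ N + norm (conv_distr \<psi> u 0) * 1" using C(2)[of x 0] by simp
    also have "\<dots> \<le> C * (1 + norm x) * (1 + norm x) ^ N + norm (conv_distr \<psi> u 0) * (1 + norm x) ^ Suc N"
      using C(1) by (intro add_mono mult_mono mult_right_mono mult_left_mono one_le_power order_refl) auto
    finally show ?thesis by (simp add: algebra_simps)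
  qed
  then show ?thesis using C(1) by (intro exI[of _ "C + norm (conv_distr \<psi> u 0)"] conjI exI[of _ "Suc N"]) auto
qed

lemma integral_simple_superposition:
  fixes p h :: "'a::euclidean_space \<Rightarrow> complex"
  assumes s: "simple_function lborel s" and h: "integrable lborel h"
  shows "(\<integral>x. p (s x) * h x \<partial>lborel) = (\<Sum>z\<in>range s. p z * (\<integral>x. indicator (s -` {z}) x *\<^sub>R h x \<partial>lborel))"
proof -
  have fin: "finite (range s)" using simple_functionD(1)[OF s] by simp
  have meas: "s -` {z} \<in> sets lborel" for z using simple_functionD(2)[OF s, of "{z}"] by simp
  have pt: "p (s x) * h x = (\<Sum>z\<in>range s. p z * (indicator (s -` {z}) x *\<^sub>R h x))" for x
  proof -
    have "(\<Sum>z\<in>range s. p z * (indicator (s -` {z}) x *\<^sub>R h x)) = (\<Sum>z\<in>range s. if z = s x then p z * h x else 0)"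
      by (intro sum.cong refl) (auto simp: indicator_def)
    then show ?thesis using fin by (simp add: sum.delta')
  qed
  show ?thesis
    unfolding pt
    by (subst Bochner_Integration.integral_sum)
      (rule integrable_mult_right, rule integrable_mult_indicator[OF meas h], simp only: integral_mult_right_zero)
qed

text \<open>The identity map is approximated by simple functions \<open>s n\<close>, for which the
  superposition is a finite sum and linearity of \<open>u\<close> applies. The left sides converge
  because \<open>Hn n\<close> tends to \<open>H\<close> in the seminorms that bound
  \<open>u\<close>, the right sides because \<open>conv_distr \<psi> u\<close> is continuous and of
  polynomial growth; the moments of \<open>h\<close> provide the majorants in both limits.\<close>

lemma tempered_integral:
  assumes u: "u \<in> tempered" and \<psi>: "\<psi> \<in> schwartz" and h: "moments h"
  shows "u (\<lambda>y. \<integral>x. \<psi> (x - y) * h x \<partial>lborel) = (\<integral>x. conv_distr \<psi> u x * h x \<partial>lborel)"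
proof -
  have hi: "integrable lborel h" by (rule moments_integrable[OF h])
  note [measurable] = moments_measurable[OF h] conv_distr_measurable[OF u \<psi>]
  have "(\<lambda>x::'a. x) \<in> borel_measurable lborel" by simp
  from borel_measurable_implies_sequence_metric[OF this, of 0]
  obtain s where s': "\<forall>i. simple_function lborel (s i)" "\<forall>x\<in>space lborel. (\<lambda>i. s i x) \<longlonglongrightarrow> (x :: 'a)"
      "\<forall>i. \<forall>x\<in>space lborel. dist (s i x) 0 \<le> 2 * dist x 0" by (elim exE conjE)
  have s: "\<And>i. simple_function lborel (s i)" "\<And>x. (\<lambda>i. s i x) \<longlonglongrightarrow> x" "\<And>i x. norm (s i x) \<le> 2 * norm x"
    using s' by simp_all
  note sn = s(3)
  have sm [measurable]: "s i \<in> borel_measurable borel" for i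
    using borel_measurable_simple_function[OF s(1)] by simp
  have id_meas: "(\<lambda>x. x) \<in> borel_measurable borel" by simp
  define H where "H = superpose (\<lambda>x. x) h \<psi>"
  define Hn where "Hn n = superpose (s n) h \<psi>" for n
  have H: "H \<in> schwartz" unfolding H_def by (rule superpose_schwartz[OF \<psi> id_meas _ h]) simp
  have Hn: "Hn n \<in> schwartz" for n unfolding Hn_def by (rule superpose_schwartz[OF \<psi> sm sn h])
  obtain C N where CN: "C \<ge> 0" "\<And>f B. f \<in> schwartz \<Longrightarrow>
    (\<And>m bs y. m \<le> N \<Longrightarrow> set bs \<subseteq> Basis \<Longrightarrow> length bs \<le> N \<Longrightarrow> norm y ^ m * norm (iter_partial bs f y) \<le> B) \<Longrightarrow>
    norm (u f) \<le> C * B" using tempered_bound[OF u] by metis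
  obtain D where D: "D \<ge> 0" "\<And>m bs x z y. m \<le> N \<Longrightarrow> set bs \<subseteq> Basis \<Longrightarrow> length bs \<le> N \<Longrightarrow>
      norm y ^ m * norm (iter_partial bs \<psi> (x - y) - iter_partial bs \<psi> (z - y)) \<le> D * norm (x - z) * (1 + norm x + norm z) ^ N"
    using translate_lipschitz_uniform[OF \<psi>] by metis
  \<comment> \<open>The integral of \<open>w n\<close> bounds the distance between
    \<open>Hn n\<close> and \<open>H\<close> in every seminorm of order at most \<open>N\<close>.
    \<open>W\<close> majorises \<open>w n\<close> uniformly in \<open>n\<close>; its factors 3 come
    from \<open>norm (s n x) \<le> 2 * norm x\<close>.\<close>
  define w where "w n x = D * norm (s n x - x) * (1 + norm (s n x) + norm x) ^ N * norm (h x)" for n x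
  define W where "W x = D * 3 * 3 ^ N * ((1 + norm x) ^ Suc N * norm (h x))" for x
  have W: "integrable lborel W" unfolding W_def by (intro integrable_mult_right moments_weight h)
  have wW: "norm (w n x) \<le> W x" for n x
  proof -
    have "norm (s n x - x) \<le> 3 * (1 + norm x)" using norm_triangle_ineq4[of "s n x" x] sn[of n x] by simp
    moreover have "(1 + norm (s n x) + norm x) ^ N \<le> (3 * (1 + norm x)) ^ N"
      using sn[of n x] by (intro power_mono) auto
    ultimately have "w n x \<le> D * (3 * (1 + norm x)) * (3 * (1 + norm x)) ^ N * norm (h x)"
      unfolding w_def using D(1)
      by (intro mult_mono mult_nonneg_nonneg order_refl zero_le_power add_nonneg_nonneg norm_ge_zero zero_le_one zero_le_numeral)
    also have "\<dots> = W x" by (simp only: W_def power_mult_distrib power_Suc mult_ac)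
    finally show ?thesis using D(1) by (simp add: w_def)
  qed
  have wm [measurable]: "w n \<in> borel_measurable lborel" for n
    unfolding w_def measurable_lborel1 by measurable
  have wi: "integrable lborel (w n)" for n
    by (rule Bochner_Integration.integrable_bound[OF W wm]) (use order_trans[OF wW abs_ge_self] in auto)
  have w0: "(\<lambda>n. \<integral>x. w n x \<partial>lborel) \<longlonglongrightarrow> integral\<^sup>L (lborel :: 'a measure) (\<lambda>x. 0 :: real)"
  proof (rule integral_dominated_convergence[where w = W])
    have "(\<lambda>n. w n x) \<longlonglongrightarrow> D * norm (x - x) * (1 + norm x + norm x) ^ N * norm (h x)" for x
      unfolding w_def by (intro tendsto_intros s)
    then show "AE x in lborel. (\<lambda>n. w n x) \<longlonglongrightarrow> 0" by simp
  qed (use wW W in auto)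
  have diff: "norm (u (Hn n) - u H) \<le> C * (\<integral>x. w n x \<partial>lborel)" for n
  proof -
    have "u (Hn n) - u H = u (\<lambda>y. Hn n y - H y)" by (intro tempered_diff[symmetric] u H Hn)
    also have "norm \<dots> \<le> C * (\<integral>x. w n x \<partial>lborel)"
    proof (rule CN(2)[OF schwartz_diff[OF Hn H]])
      fix m y and bs :: "'a list" assume as: "m \<le> N" "set bs \<subseteq> Basis" "length bs \<le> N"
      let ?\<psi> = "iter_partial bs \<psi>"
      have S: "?\<psi> \<in> schwartz" by (intro schwartz_iter_partial \<psi> as)
      note int = superpose_integrand_integrable[OF S sm hi, of n y] superpose_integrand_integrable[OF S id_meas hi, of y]
      have "norm (iter_partial bs (\<lambda>y. Hn n y - H y) y) = norm (superpose (s n) h ?\<psi> y - superpose (\<lambda>x. x) h ?\<psi> y)"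
        unfolding iter_partial_diff[OF Hn H as(2)] unfolding Hn_def H_def
          iter_partial_superpose[OF \<psi> sm hi as(2)] iter_partial_superpose[OF \<psi> id_meas hi as(2)]
        by (simp flip: right_diff_distrib add: norm_mult norm_power)
      also have "superpose (s n) h ?\<psi> y - superpose (\<lambda>x. x) h ?\<psi> y = (\<integral>x. ?\<psi> (s n x - y) * h x - ?\<psi> (x - y) * h x \<partial>lborel)"
        unfolding superpose_def by (intro Bochner_Integration.integral_diff[symmetric] int)
      also have "norm \<dots> \<le> (\<integral>x. norm (?\<psi> (s n x - y) * h x - ?\<psi> (x - y) * h x) \<partial>lborel)" by (rule integral_norm_bound)
      finally have "norm y ^ m * norm (iter_partial bs (\<lambda>y. Hn n y - H y) y)
          \<le> norm y ^ m * (\<integral>x. norm (?\<psi> (s n x - y) * h x - ?\<psi> (x - y) * h x) \<partial>lborel)" by (intro mult_left_mono) auto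
      also have "\<dots> = (\<integral>x. norm y ^ m * norm (?\<psi> (s n x - y) * h x - ?\<psi> (x - y) * h x) \<partial>lborel)" by simp
      also have "\<dots> \<le> (\<integral>x. w n x \<partial>lborel)"
      proof (intro integral_mono integrable_mult_right integrable_norm Bochner_Integration.integrable_diff int wi)
        fix x
        have "norm y ^ m * norm (?\<psi> (s n x - y) * h x - ?\<psi> (x - y) * h x) = (norm y ^ m * norm (?\<psi> (s n x - y) - ?\<psi> (x - y))) * norm (h x)"
          by (simp flip: left_diff_distrib add: norm_mult)
        also have "\<dots> \<le> w n x" unfolding w_def by (intro mult_right_mono D as) auto
        finally show "norm y ^ m * norm (?\<psi> (s n x - y) * h x - ?\<psi> (x - y) * h x) \<le> w n x" .
      qed
      finally show "norm y ^ m * norm (iter_partial bs (\<lambda>y. Hn n y - H y) y) \<le> (\<integral>x. w n x \<partial>lborel)" .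
    qed
    finally show ?thesis .
  qed
  have "(\<lambda>n. C * (\<integral>x. w n x \<partial>lborel)) \<longlonglongrightarrow> C * 0" using w0 by (intro tendsto_mult tendsto_const) simp
  then have "(\<lambda>n. u (Hn n) - u H) \<longlonglongrightarrow> 0"
    by (intro Lim_null_comparison[OF always_eventually[OF allI[OF diff]]]) simp
  then have lim1: "(\<lambda>n. u (Hn n)) \<longlonglongrightarrow> u H" by (rule Lim_null[THEN iffD2])
  have eq: "u (Hn n) = (\<integral>x. conv_distr \<psi> u (s n x) * h x \<partial>lborel)" for n
  proof -
    \<comment> \<open>The coefficient of the translate by \<open>z\<close> is the integral of
      \<open>h\<close> over the fibre where \<open>s n\<close> takes the value
      \<open>z\<close>.\<close>
    define c where "c z = (\<integral>x. indicator (s n -` {z}) x *\<^sub>R h x \<partial>lborel)" for z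
    have Hn_eq: "Hn n = (\<lambda>y. \<Sum>z\<in>range (s n). c z * \<psi> (z - y))"
      unfolding Hn_def superpose_def c_def
      by (subst integral_simple_superposition[OF s(1) hi, of "\<lambda>v. \<psi> (v - _)"]) (simp add: mult.commute)
    have "u (Hn n) = (\<Sum>z\<in>range (s n). u (\<lambda>y. c z * \<psi> (z - y)))"
      unfolding Hn_eq using simple_functionD(1)[OF s(1)] by (intro tempered_sum u schwartz_cmult schwartz_reflect \<psi>) auto
    also have "\<dots> = (\<Sum>z\<in>range (s n). conv_distr \<psi> u z * c z)"
      unfolding conv_distr_def by (intro sum.cong refl) (simp add: tempered_cmult[OF u schwartz_reflect[OF \<psi>]])
    also have "\<dots> = (\<integral>x. conv_distr \<psi> u (s n x) * h x \<partial>lborel)"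
      unfolding c_def by (rule integral_simple_superposition[OF s(1) hi, symmetric])
    finally show ?thesis .
  qed
  obtain G M where G: "G \<ge> 0" "\<And>x. norm (conv_distr \<psi> u x) \<le> G * (1 + norm x) ^ M"
    using conv_distr_growth[OF u \<psi>] by metis
  have lim2: "(\<lambda>n. \<integral>x. conv_distr \<psi> u (s n x) * h x \<partial>lborel) \<longlonglongrightarrow> (\<integral>x. conv_distr \<psi> u x * h x \<partial>lborel)"
  proof (rule integral_dominated_convergence)
    show "integrable lborel (\<lambda>x. G * 2 ^ M * ((1 + norm x) ^ M * norm (h x)))"
      by (intro integrable_mult_right moments_weight h)
    show "AE x in lborel. (\<lambda>n. conv_distr \<psi> u (s n x) * h x) \<longlonglongrightarrow> conv_distr \<psi> u x * h x"
      using continuous_on_tendsto_compose[OF conv_distr_continuous[OF u \<psi>] s(2)]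
      by (intro always_eventually allI tendsto_mult tendsto_const) auto
    show "AE x in lborel. norm (conv_distr \<psi> u (s n x) * h x) \<le> G * 2 ^ M * ((1 + norm x) ^ M * norm (h x))" for n
    proof (intro always_eventually allI)
      fix x
      have "norm (conv_distr \<psi> u (s n x)) \<le> G * (1 + norm (s n x)) ^ M" by (rule G)
      also have "\<dots> \<le> G * (2 * (1 + norm x)) ^ M" using G(1) sn[of n x] by (intro mult_left_mono power_mono) auto
      finally have "norm (conv_distr \<psi> u (s n x)) * norm (h x) \<le> (G * (2 * (1 + norm x)) ^ M) * norm (h x)"
        by (rule mult_right_mono) simp
      then show "norm (conv_distr \<psi> u (s n x) * h x) \<le> G * 2 ^ M * ((1 + norm x) ^ M * norm (h x))"
        by (simp only: norm_mult power_mult_distrib mult_ac)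
    qed
  qed measurable
  from LIMSEQ_unique[OF lim1 lim2[folded eq]] show ?thesis by (simp add: H_def superpose_def)
qed

subsection \<open>Square-integrable functions\<close>

lemma cball_measurable [measurable]: "cball a r \<in> sets borel" for a :: "'a::metric_space"
  by simp

text \<open>Cauchy-Schwarz for the measure with density \<open>P (x - z)\<close> in
  \<open>z\<close>, followed by Tonelli; each step contributes one factor of the total mass of
  \<open>P\<close>.\<close>

lemma young_L2:
  fixes P W :: "'a::euclidean_space \<Rightarrow> ennreal"
  assumes [measurable]: "P \<in> borel_measurable borel" "W \<in> borel_measurable borel"
  shows "(\<integral>\<^sup>+x. (\<integral>\<^sup>+z. P (x - z) * W z \<partial>lborel)\<^sup>2 \<partial>lborel) \<le> (\<integral>\<^sup>+x. P x \<partial>lborel)\<^sup>2 * (\<integral>\<^sup>+x. (W x)\<^sup>2 \<partial>lborel)"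
proof -
  let ?A = "\<integral>\<^sup>+x. P x \<partial>lborel"
  have refl: "(\<integral>\<^sup>+z. P (x - z) \<partial>lborel) = ?A" for x
    using nn_integral_affine[of P "-1" x] by simp
  have trans: "(\<integral>\<^sup>+x. P (x - z) \<partial>lborel) = ?A" for z
    using nn_integral_affine[of P 1 "-z"] by simp
  have "(\<integral>\<^sup>+z. P (x - z) * W z \<partial>lborel)\<^sup>2 \<le> ?A * (\<integral>\<^sup>+z. P (x - z) * (W z)\<^sup>2 \<partial>lborel)" for x
  proof -
    define D where "D = density lborel (\<lambda>z. P (x - z))"
    have [measurable_cong]: "sets D = sets borel" by (simp add: D_def)
    have "(\<integral>\<^sup>+z. P (x - z) * W z \<partial>lborel)\<^sup>2 = (\<integral>\<^sup>+z. 1 * W z \<partial>D)\<^sup>2"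
      unfolding D_def by (subst nn_integral_density) auto
    also have "\<dots> \<le> (\<integral>\<^sup>+z. 1\<^sup>2 \<partial>D) * (\<integral>\<^sup>+z. (W z)\<^sup>2 \<partial>D)"
      by (rule Cauchy_Schwarz_nn_integral) measurable
    also have "(\<integral>\<^sup>+z. 1\<^sup>2 \<partial>D) = ?A"
      unfolding D_def by (subst nn_integral_density) (auto simp: refl)
    also have "(\<integral>\<^sup>+z. (W z)\<^sup>2 \<partial>D) = (\<integral>\<^sup>+z. P (x - z) * (W z)\<^sup>2 \<partial>lborel)"
      unfolding D_def by (subst nn_integral_density) auto
    finally show ?thesis .
  qed
  then have "(\<integral>\<^sup>+x. (\<integral>\<^sup>+z. P (x - z) * W z \<partial>lborel)\<^sup>2 \<partial>lborel) \<le> (\<integral>\<^sup>+x. ?A * (\<integral>\<^sup>+z. P (x - z) * (W z)\<^sup>2 \<partial>lborel) \<partial>lborel)"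
    by (intro nn_integral_mono)
  also have "\<dots> = ?A * (\<integral>\<^sup>+x. (\<integral>\<^sup>+z. P (x - z) * (W z)\<^sup>2 \<partial>lborel) \<partial>lborel)"
    by (intro nn_integral_cmult) measurable
  also have "(\<integral>\<^sup>+x. (\<integral>\<^sup>+z. P (x - z) * (W z)\<^sup>2 \<partial>lborel) \<partial>lborel) = (\<integral>\<^sup>+z. (\<integral>\<^sup>+x. P (x - z) * (W z)\<^sup>2 \<partial>lborel) \<partial>lborel)"
    by (rule lborel_pair.Fubini'[symmetric, of "\<lambda>x z. P (x - z) * (W z)\<^sup>2"]) measurable
  also have "\<dots> = (\<integral>\<^sup>+z. ?A * (W z)\<^sup>2 \<partial>lborel)"
    by (simp add: nn_integral_multc trans)
  also have "\<dots> = ?A * (\<integral>\<^sup>+z. (W z)\<^sup>2 \<partial>lborel)" by (intro nn_integral_cmult) measurable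
  finally show ?thesis by (simp add: power2_eq_square mult.assoc)
qed

abbreviation nn_sq :: "'b measure \<Rightarrow> ('b \<Rightarrow> complex) \<Rightarrow> ennreal" where
  "nn_sq M f \<equiv> \<integral>\<^sup>+x. ennreal ((norm (f x))\<^sup>2) \<partial>M"

text \<open>The weights \<open>4 ^ i\<close> against the bounds \<open>(1 / 8) ^ i\<close> leave a
  convergent series of integrals. Almost everywhere the weighted squares are therefore summable,
  hence bounded, and consecutive differences are of order \<open>(1 / 2) ^ i\<close>.\<close>

lemma AE_convergent_of_L2_fast:
  fixes h :: "nat \<Rightarrow> 'b \<Rightarrow> complex"
  assumes [measurable]: "\<And>n. h n \<in> borel_measurable M"
    and fast: "\<And>i. (nn_sq M (\<lambda>x. h (Suc i) x - h i x)) \<le> ennreal ((1 / 8) ^ i)"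
  shows "AE x in M. convergent (\<lambda>i. h i x)"
proof -
  have "(\<integral>\<^sup>+x. (\<Sum>i. ennreal (4 ^ i * (norm (h (Suc i) x - h i x))\<^sup>2)) \<partial>M)
      = (\<Sum>i. \<integral>\<^sup>+x. ennreal (4 ^ i) * ennreal ((norm (h (Suc i) x - h i x))\<^sup>2) \<partial>M)"
    by (subst nn_integral_suminf) (simp_all add: ennreal_mult)
  also have "\<dots> \<le> (\<Sum>i. ennreal ((1 / 2) ^ i))"
  proof (rule suminf_le)
    fix i
    have "(\<integral>\<^sup>+x. ennreal (4 ^ i) * ennreal ((norm (h (Suc i) x - h i x))\<^sup>2) \<partial>M) = ennreal (4 ^ i) * (nn_sq M (\<lambda>x. h (Suc i) x - h i x))"
      by (intro nn_integral_cmult) measurable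
    also have "\<dots> \<le> ennreal (4 ^ i) * ennreal ((1 / 8) ^ i)" by (intro mult_left_mono fast) auto
    also have "\<dots> = ennreal ((1 / 2) ^ i)"
      by (subst ennreal_mult[symmetric]) (simp_all flip: power_mult_distrib)
    finally show "(\<integral>\<^sup>+x. ennreal (4 ^ i) * ennreal ((norm (h (Suc i) x - h i x))\<^sup>2) \<partial>M) \<le> ennreal ((1 / 2) ^ i)" .
  qed auto
  also have "\<dots> < \<infinity>" by (subst suminf_ennreal2) (auto intro: summable_geometric)
  finally have "AE x in M. (\<Sum>i. ennreal (4 ^ i * (norm (h (Suc i) x - h i x))\<^sup>2)) \<noteq> \<infinity>"
    by (intro nn_integral_PInf_AE) auto
  then show ?thesis
  proof (rule AE_mp, intro always_eventually allI impI)
    fix x assume fin: "(\<Sum>i. ennreal (4 ^ i * (norm (h (Suc i) x - h i x))\<^sup>2)) \<noteq> \<infinity>"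
    have sm: "summable (\<lambda>i. 4 ^ i * (norm (h (Suc i) x - h i x))\<^sup>2)"
      using fin by (intro summable_suminf_not_top) auto
    then have "Bseq (\<lambda>i. 4 ^ i * (norm (h (Suc i) x - h i x))\<^sup>2)"
      using summable_LIMSEQ_zero convergentI Bseq_eq_bounded convergent_imp_Bseq by blast
    then obtain K where K: "K > 0" "\<And>i. norm (4 ^ i * (norm (h (Suc i) x - h i x))\<^sup>2) \<le> K" by (auto elim: BseqE)
    have le: "norm (h (Suc i) x - h i x) \<le> sqrt K * (1 / 2) ^ i" for i
    proof -
      have "(2 ^ i * norm (h (Suc i) x - h i x))\<^sup>2 \<le> K"
      proof -
        have "(4::real) ^ i = (2 ^ i)\<^sup>2" by (simp add: power2_eq_square flip: power_mult_distrib)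
        then show ?thesis using K(2)[of i] by (simp add: power_mult_distrib)
      qed
      then have "2 ^ i * norm (h (Suc i) x - h i x) \<le> sqrt K" by (rule real_le_rsqrt)
      then show ?thesis by (simp add: field_simps power_one_over)
    qed
    have "summable (\<lambda>i. h (Suc i) x - h i x)"
      by (rule summable_comparison_test'[OF summable_mult[OF summable_geometric[of "1/2"], of "sqrt K"]]) (use le in auto)
    then have "convergent (\<lambda>n. \<Sum>i<n. h (Suc i) x - h i x)" by (simp add: summable_iff_convergent)
    then have "convergent (\<lambda>n. h n x - h 0 x)" unfolding sum_lessThan_telescope[of "\<lambda>i. h i x"] .
    then show "convergent (\<lambda>n. h n x)" using convergent_diff_const_right_iff by blast
  qed
qed

text \<open>The Riesz-Fischer argument: the limit is taken pointwise along a rapidly convergent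
  subsequence, and Fatou's lemma carries the Cauchy estimate over to it.\<close>

lemma L2_complete:
  fixes h :: "nat \<Rightarrow> 'b \<Rightarrow> complex"
  assumes [measurable]: "\<And>n. h n \<in> borel_measurable M"
    and Cauchy: "\<And>e. e > 0 \<Longrightarrow> \<exists>N. \<forall>m\<ge>N. \<forall>n\<ge>N. (nn_sq M (\<lambda>x. h m x - h n x)) \<le> ennreal e"
  obtains g where "g \<in> borel_measurable M"
    "\<And>e. e > 0 \<Longrightarrow> \<exists>N. \<forall>n\<ge>N. (nn_sq M (\<lambda>x. g x - h n x)) \<le> ennreal e"
proof -
  have "\<exists>r. \<forall>i. \<forall>m\<ge>r i. \<forall>n\<ge>r i. (nn_sq M (\<lambda>x. h m x - h n x)) \<le> ennreal ((1 / 8) ^ i)"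
    by (intro choice allI Cauchy) simp
  then obtain r where r: "\<And>i m n. m \<ge> r i \<Longrightarrow> n \<ge> r i \<Longrightarrow> (nn_sq M (\<lambda>x. h m x - h n x)) \<le> ennreal ((1 / 8) ^ i)"
    by blast
  \<comment> \<open>The partial sums make \<open>R i\<close> and \<open>R (Suc i)\<close> both at
    least \<open>r i\<close>, as each consecutive difference requires; the added index makes
    \<open>R\<close> tend to infinity.\<close>
  define R where "R i = i + (\<Sum>j\<le>i. r j)" for i :: nat
  have R: "R i \<ge> i" "R i \<ge> r i" "R (Suc i) \<ge> r i" for i
    using member_le_sum[of i "{..i}" r] by (auto simp: R_def)
  define g where "g x = lim (\<lambda>i. h (R i) x)" for x
  have [measurable]: "g \<in> borel_measurable M" unfolding g_def by measurable
  have "AE x in M. convergent (\<lambda>i. h (R i) x)"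
    by (rule AE_convergent_of_L2_fast) (auto intro!: r R)
  then have lim: "AE x in M. (\<lambda>i. h (R i) x) \<longlonglongrightarrow> g x"
    unfolding g_def by (simp add: convergent_LIMSEQ_iff)
  have "\<exists>N. \<forall>n\<ge>N. (nn_sq M (\<lambda>x. g x - h n x)) \<le> ennreal e" if e: "e > 0" for e
  proof -
    obtain N where N: "\<And>m n. m \<ge> N \<Longrightarrow> n \<ge> N \<Longrightarrow> (nn_sq M (\<lambda>x. h m x - h n x)) \<le> ennreal e"
      using Cauchy[OF e] by blast
    have "(nn_sq M (\<lambda>x. g x - h n x)) \<le> ennreal e" if "n \<ge> N" for n
    proof -
      have "(nn_sq M (\<lambda>x. g x - h n x)) = (\<integral>\<^sup>+x. liminf (\<lambda>i. ennreal ((norm (h (R i) x - h n x))\<^sup>2)) \<partial>M)"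
      proof (rule nn_integral_cong_AE, rule AE_mp[OF lim], intro always_eventually allI impI)
        fix x assume "(\<lambda>i. h (R i) x) \<longlonglongrightarrow> g x"
        then have "(\<lambda>i. ennreal ((norm (h (R i) x - h n x))\<^sup>2)) \<longlonglongrightarrow> ennreal ((norm (g x - h n x))\<^sup>2)"
          by (intro tendsto_ennrealI tendsto_power tendsto_norm tendsto_diff tendsto_const)
        then show "ennreal ((norm (g x - h n x))\<^sup>2) = liminf (\<lambda>i. ennreal ((norm (h (R i) x - h n x))\<^sup>2))"
          by (intro lim_imp_Liminf[symmetric]) auto
      qed
      also have "\<dots> \<le> liminf (\<lambda>i. \<integral>\<^sup>+x. ennreal ((norm (h (R i) x - h n x))\<^sup>2) \<partial>M)"
        by (rule nn_integral_liminf) measurable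
      also have "\<dots> \<le> ennreal e"
        using that R(1) by (intro Liminf_le eventually_sequentiallyI[of N] N) (auto intro: order_trans)
      finally show ?thesis .
    qed
    then show ?thesis by blast
  qed
  with that[of g] show ?thesis by simp
qed

lemma integral_pairing_L2:
  fixes f g :: "'b \<Rightarrow> complex"
  assumes "integrable M (\<lambda>x. f x * g x)" and [measurable]: "f \<in> borel_measurable M" "g \<in> borel_measurable M"
  shows "(ennreal (norm (\<integral>x. f x * g x \<partial>M)))\<^sup>2 \<le> (nn_sq M f) * (nn_sq M g)"
proof -
  have "ennreal (norm (\<integral>x. f x * g x \<partial>M)) \<le> (\<integral>\<^sup>+x. ennreal (norm (f x)) * ennreal (norm (g x)) \<partial>M)"
    using integral_norm_bound_ennreal[OF assms(1)] by (simp add: norm_mult ennreal_mult)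
  then have "(ennreal (norm (\<integral>x. f x * g x \<partial>M)))\<^sup>2 \<le> (\<integral>\<^sup>+x. ennreal (norm (f x)) * ennreal (norm (g x)) \<partial>M)\<^sup>2"
    by (rule power_mono) simp
  also have "\<dots> \<le> (\<integral>\<^sup>+x. (ennreal (norm (f x)))\<^sup>2 \<partial>M) * (\<integral>\<^sup>+x. (ennreal (norm (g x)))\<^sup>2 \<partial>M)"
    by (rule Cauchy_Schwarz_nn_integral) measurable
  finally show ?thesis by (simp add: ennreal_power)
qed

lemma integrable_mult_L2:
  fixes f g :: "'b \<Rightarrow> complex"
  assumes [measurable]: "f \<in> borel_measurable M" "g \<in> borel_measurable M"
    and "(nn_sq M f) < \<infinity>" "(nn_sq M g) < \<infinity>"
  shows "integrable M (\<lambda>x. f x * g x)"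
proof (rule integrableI_bounded)
  have "(\<integral>\<^sup>+x. ennreal (norm (f x * g x)) \<partial>M)\<^sup>2 = (\<integral>\<^sup>+x. ennreal (norm (f x)) * ennreal (norm (g x)) \<partial>M)\<^sup>2"
    by (simp add: norm_mult ennreal_mult)
  also have "\<dots> \<le> (\<integral>\<^sup>+x. (ennreal (norm (f x)))\<^sup>2 \<partial>M) * (\<integral>\<^sup>+x. (ennreal (norm (g x)))\<^sup>2 \<partial>M)"
    by (rule Cauchy_Schwarz_nn_integral) measurable
  also have "\<dots> < \<infinity>" using assms by (simp add: ennreal_power ennreal_mult_less_top)
  finally show "(\<integral>\<^sup>+x. ennreal (norm (f x * g x)) \<partial>M) < \<infinity>"
    by (simp add: power_less_top_ennreal)
qed measurable

lemma norm_diff_square_le: "(norm (a - b))\<^sup>2 \<le> 2 * (norm a)\<^sup>2 + 2 * (norm b)\<^sup>2" for a b :: "'x::real_normed_vector"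
proof -
  have "(norm (a - b))\<^sup>2 \<le> (norm a + norm b)\<^sup>2" by (intro power_mono norm_triangle_ineq4) auto
  also have "\<dots> \<le> 2 * (norm a)\<^sup>2 + 2 * (norm b)\<^sup>2"
    using sum_squares_bound[of "norm a" "norm b"] by (simp add: power2_sum)
  finally show ?thesis .
qed

lemma integrable_on_cball:
  fixes f :: "'a::euclidean_space \<Rightarrow> real"
  assumes [measurable]: "f \<in> borel_measurable borel" and "\<And>x. norm x \<le> r \<Longrightarrow> \<bar>f x\<bar> \<le> C"
  shows "integrable lborel (\<lambda>x. indicator (cball 0 r) x * f x)"
proof (rule Bochner_Integration.integrable_bound)
  show "integrable lborel (\<lambda>x::'a. indicator (cball 0 r) x *\<^sub>R C)"
    using emeasure_lborel_cball_finite[of "0::'a" r] by simp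
  show "AE x in lborel. norm (indicator (cball 0 r) x * f x) \<le> norm (indicator (cball 0 r) x *\<^sub>R C)"
    using order_trans[OF assms(2) abs_ge_self] by (intro always_eventually allI) (auto simp: indicator_def)
qed measurable

lemma moments_cutoff:
  fixes v :: "'a::euclidean_space \<Rightarrow> complex"
  assumes [measurable]: "v \<in> borel_measurable borel" and B: "\<And>x. norm (v x) \<le> B"
  shows "moments (\<lambda>x. indicator (cball 0 r) x * v x)"
  unfolding moments_def
proof (intro conjI allI)
  fix m
  have "integrable lborel (\<lambda>x::'a. indicator (cball 0 r) x * ((1 + norm x) ^ m * norm (v x)))"
  proof (rule integrable_on_cball)
    fix x :: 'a assume x: "norm x \<le> r"
    have "r \<ge> 0" using order_trans[OF norm_ge_zero x] .
    with x have "(1 + norm x) ^ m * norm (v x) \<le> (1 + r) ^ m * B"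
      by (intro mult_mono power_mono B) auto
    then show "\<bar>(1 + norm x) ^ m * norm (v x)\<bar> \<le> (1 + r) ^ m * B" by simp
  qed measurable
  moreover have eq: "(1 + norm x) ^ m * norm (indicator (cball 0 r) x * v x) = indicator (cball 0 r) x * ((1 + norm x) ^ m * norm (v x))" for x
    by (auto simp: indicator_def)
  ultimately show "integrable lborel (\<lambda>x. (1 + norm x) ^ m * norm (indicator (cball 0 r) x * v x))" unfolding eq by simp
qed measurable

lemma nn_integral_tail_tendsto_0:
  fixes F :: "'a::euclidean_space \<Rightarrow> ennreal"
  assumes [measurable]: "F \<in> borel_measurable borel" and "(\<integral>\<^sup>+x. F x \<partial>lborel) < \<infinity>"
  shows "(\<lambda>n. \<integral>\<^sup>+x. F x * indicator (- cball 0 (real n)) x \<partial>lborel) \<longlonglongrightarrow> 0"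
proof -
  have "(\<lambda>n. \<integral>\<^sup>+x. F x * indicator (- cball 0 (real n)) x \<partial>lborel) \<longlonglongrightarrow> integral\<^sup>N (lborel :: 'a measure) (\<lambda>x. 0)"
  proof (rule nn_integral_dominated_convergence[where w = F])
    show "AE x in lborel. (\<lambda>n. F x * indicator (- cball 0 (real n)) x) \<longlonglongrightarrow> 0"
    proof (intro always_eventually allI)
      fix x :: 'a
      obtain N :: nat where "norm x \<le> N" using real_arch_simple by blast
      then have "\<forall>\<^sub>F n in sequentially. F x * indicator (- cball 0 (real n)) x = 0"
        by (intro eventually_sequentiallyI[of N]) auto
      then show "(\<lambda>n. F x * indicator (- cball 0 (real n)) x) \<longlonglongrightarrow> 0" by (rule tendsto_eventually)
    qed
  qed (use assms in \<open>auto simp: indicator_def\<close>)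
  then show ?thesis by simp
qed

context lp_gen
begin

lemma parseval_nn:
  fixes f :: "'a \<Rightarrow> complex"
  assumes "f \<in> schwartz"
  shows "(nn_sq lborel (fourier f)) = ennreal inv_const * (nn_sq lborel f)"
proof -
  have "(nn_sq lborel (fourier f)) = ennreal (\<integral>x. (norm (fourier f x))\<^sup>2 \<partial>lborel)"
    by (intro nn_integral_eq_integral schwartz_square_integrable fourier_schwartz assms) auto
  also have "\<dots> = ennreal inv_const * ennreal (\<integral>x. (norm (f x))\<^sup>2 \<partial>lborel)"
    unfolding parseval[OF assms] using inv_const_pos by (intro ennreal_mult) auto
  also have "ennreal (\<integral>x. (norm (f x))\<^sup>2 \<partial>lborel) = (nn_sq lborel f)"
    by (intro nn_integral_eq_integral[symmetric] schwartz_square_integrable assms) auto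
  finally show ?thesis .
qed

text \<open>For a function \<open>v\<close> reproduced by convolution with \<open>\<Phi>\<close>, the convolutions of its truncations with
  \<open>\<Phi>\<close> are Schwartz functions approximating it, which gives Plancherel's theorem without density
  arguments.\<close>

lemma plancherel_reproduced:
  fixes v \<Phi> :: "'a \<Rightarrow> complex"
  assumes \<Phi>: "\<Phi> \<in> schwartz" and v [measurable]: "v \<in> borel_measurable borel" and B: "\<And>x. norm (v x) \<le> B"
    and v2: "(nn_sq lborel v) < \<infinity>"
    and rep: "\<And>x. v x = (\<integral>z. \<Phi> (x - z) * v z \<partial>lborel)"
  obtains g where "g \<in> borel_measurable borel"
    "(nn_sq lborel g)
       \<le> ennreal (2 * inv_const) * (\<integral>\<^sup>+x. ennreal (norm (\<Phi> x)) \<partial>lborel)\<^sup>2 * (nn_sq lborel v)"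
    "\<And>\<psi>. \<psi> \<in> schwartz \<Longrightarrow> (\<integral>x. v x * fourier \<psi> x \<partial>lborel) = (\<integral>x. g x * \<psi> x \<partial>lborel)"
proof -
  note [measurable] = schwartz_measurable[OF \<Phi>]
  define A where "A = (\<integral>\<^sup>+x. ennreal (norm (\<Phi> x)) \<partial>lborel)"
  have A: "A < \<infinity>" unfolding A_def using schwartz_integrable[OF \<Phi>] by (simp add: integrable_iff_bounded)
  have A2: "A\<^sup>2 < \<infinity>" using A by (simp add: power2_eq_square ennreal_mult_less_top)
  define V where "V = (nn_sq lborel v)"
  define vn where "vn n x = indicator (cball 0 (real n)) x * v x" for n :: nat and x
  have [measurable]: "vn n \<in> borel_measurable borel" for n unfolding vn_def by measurable
  have vn_le: "norm (vn n x) \<le> norm (v x)" for n x by (auto simp: vn_def indicator_def)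
  have mom: "moments (vn n)" for n unfolding vn_def by (rule moments_cutoff[OF v B])
  have B0: "B \<ge> 0" using B[of 0] norm_ge_zero order_trans by blast
  \<comment> \<open>The kernel is reflected because \<open>superpose\<close> evaluates it at the
    integration variable minus the free one.\<close>
  define h where "h n = superpose (\<lambda>x. x) (vn n) (\<lambda>w. \<Phi> (- w))" for n
  have \<Phi>': "(\<lambda>w. \<Phi> (- w)) \<in> schwartz" using schwartz_reflect[OF \<Phi>, of 0] by simp
  have h: "h n \<in> schwartz" for n
    unfolding h_def by (rule superpose_schwartz[OF \<Phi>' _ _ mom]) auto
  note [measurable] = schwartz_measurable[OF h] fourier_schwartz_measurable[OF h]
  have h_eq: "h n x = (\<integral>z. \<Phi> (x - z) * vn n z \<partial>lborel)" for n x
    by (simp add: h_def superpose_def)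
  have int: "integrable lborel (\<lambda>z. \<Phi> (x - z) * w z)" if "w \<in> borel_measurable borel" "\<And>x. norm (w x) \<le> B" for x w
  proof (rule Bochner_Integration.integrable_bound)
    show "integrable lborel (\<lambda>z. of_real B * \<Phi> (x - z))"
      by (intro integrable_mult_right schwartz_integrable schwartz_reflect \<Phi>)
    show "AE z in lborel. norm (\<Phi> (x - z) * w z) \<le> norm (of_real B * \<Phi> (x - z))"
      using that B0 by (auto simp: norm_mult mult.commute[of B] intro!: mult_left_mono)
  qed (use that in measurable)
  have intn: "integrable lborel (\<lambda>z. \<Phi> (x - z) * vn n z)" for x n
    by (rule int) (use order_trans[OF vn_le B] in auto)
  have young: "(nn_sq lborel F) \<le> A\<^sup>2 * (nn_sq lborel w)"
    if [measurable]: "w \<in> borel_measurable borel" and F: "\<And>x. F x = (\<integral>z. \<Phi> (x - z) * w z \<partial>lborel)"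
      "\<And>x. integrable lborel (\<lambda>z. \<Phi> (x - z) * w z)" for F w
  proof -
    have "ennreal ((norm (F x))\<^sup>2) \<le> (\<integral>\<^sup>+z. ennreal (norm (\<Phi> (x - z))) * ennreal (norm (w z)) \<partial>lborel)\<^sup>2" for x
      using power_mono[OF integral_norm_bound_ennreal[OF F(2)[of x]], of 2]
      by (simp add: F(1) norm_mult ennreal_mult ennreal_power)
    then have "(nn_sq lborel F) \<le> (\<integral>\<^sup>+x. (\<integral>\<^sup>+z. ennreal (norm (\<Phi> (x - z))) * ennreal (norm (w z)) \<partial>lborel)\<^sup>2 \<partial>lborel)"
      by (intro nn_integral_mono)
    also have "\<dots> \<le> A\<^sup>2 * (\<integral>\<^sup>+x. (ennreal (norm (w x)))\<^sup>2 \<partial>lborel)"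
      unfolding A_def by (rule young_L2) measurable
    finally show ?thesis by (simp add: ennreal_power)
  qed
  \<comment> \<open>Truncations at radii of at least \<open>N\<close> differ only outside the ball
    of radius \<open>N\<close>, so the tail \<open>T N\<close> of the square integral of
    \<open>v\<close> controls their distance.\<close>
  define T where "T n = (\<integral>\<^sup>+x. ennreal ((norm (v x))\<^sup>2) * indicator (- cball 0 (real n)) x \<partial>lborel)" for n :: nat
  have T: "T \<longlonglongrightarrow> 0" unfolding T_def by (rule nn_integral_tail_tendsto_0[OF _ v2]) measurable
  have diffle: "(nn_sq lborel (\<lambda>x. fourier (h m) x - fourier (h n) x)) \<le> ennreal inv_const * (A\<^sup>2 * T N)"
    if "m \<ge> N" "n \<ge> N" for m n N
  proof -
    have feq: "fourier (h m) x - fourier (h n) x = fourier (\<lambda>x. h m x - h n x) x" for x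
      unfolding fourier_def left_diff_distrib
      by (intro Bochner_Integration.integral_diff[symmetric] fourier_integrable schwartz_integrable h)
    have "(nn_sq lborel (\<lambda>x. fourier (h m) x - fourier (h n) x)) = ennreal inv_const * (nn_sq lborel (\<lambda>x. h m x - h n x))"
      unfolding feq by (intro parseval_nn schwartz_diff h)
    also have "(nn_sq lborel (\<lambda>x. h m x - h n x)) \<le> A\<^sup>2 * (nn_sq lborel (\<lambda>x. vn m x - vn n x))"
    proof (rule young)
      show "h m x - h n x = (\<integral>z. \<Phi> (x - z) * (vn m z - vn n z) \<partial>lborel)" for x
        unfolding h_eq right_diff_distrib by (intro Bochner_Integration.integral_diff[symmetric] intn)
      show "integrable lborel (\<lambda>z. \<Phi> (x - z) * (vn m z - vn n z))" for x
        unfolding right_diff_distrib by (intro Bochner_Integration.integrable_diff intn)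
    qed measurable
    also have "(nn_sq lborel (\<lambda>x. vn m x - vn n x)) \<le> T N"
      unfolding T_def using that by (intro nn_integral_mono) (auto simp: vn_def indicator_def)
    finally show ?thesis by (simp add: mult_left_mono)
  qed
  have AT: "(\<lambda>n. ennreal inv_const * (A\<^sup>2 * T n)) \<longlonglongrightarrow> ennreal inv_const * (A\<^sup>2 * 0)"
    by (rule tendsto_mult_ennreal[OF tendsto_const tendsto_mult_ennreal[OF tendsto_const T]])
       (use A2 in \<open>auto simp: less_top[symmetric]\<close>)
  have Cauchy: "\<exists>N. \<forall>m\<ge>N. \<forall>n\<ge>N. (nn_sq lborel (\<lambda>x. fourier (h m) x - fourier (h n) x)) \<le> ennreal e" if "e > 0" for e
  proof -
    have "\<forall>\<^sub>F n in sequentially. ennreal inv_const * (A\<^sup>2 * T n) < ennreal e"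
      using order_tendstoD(2)[OF AT, of "ennreal e"] that by simp
    then obtain N where "ennreal inv_const * (A\<^sup>2 * T N) < ennreal e" by (auto simp: eventually_sequentially)
    then show ?thesis using diffle[of N] by (meson less_imp_le order_trans)
  qed
  obtain g where g: "g \<in> borel_measurable lborel"
    "\<And>e. e > 0 \<Longrightarrow> \<exists>N. \<forall>n\<ge>N. (nn_sq lborel (\<lambda>x. g x - fourier (h n) x)) \<le> ennreal e"
    using L2_complete[of "\<lambda>n. fourier (h n)" lborel, OF _ Cauchy] by auto
  have [measurable]: "g \<in> borel_measurable borel" using g by simp
  have Fh: "(nn_sq lborel (fourier (h n))) \<le> ennreal inv_const * (A\<^sup>2 * V)" for n
  proof -
    have "(nn_sq lborel (h n)) \<le> A\<^sup>2 * (nn_sq lborel (vn n))"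
      by (rule young[OF _ h_eq intn]) measurable
    also have "\<dots> \<le> A\<^sup>2 * V"
      unfolding V_def by (intro mult_left_mono nn_integral_mono ennreal_leI power_mono vn_le) auto
    finally show ?thesis unfolding parseval_nn[OF h] by (rule mult_left_mono) simp
  qed
  \<comment> \<open>The factor 2 is the price of \<open>norm_diff_square_le\<close>, which stands in
    for the triangle inequality of the square norm; the same factor on the error term is why it is
    taken at most \<open>e / 2\<close>.\<close>
  have g2: "(nn_sq lborel g) \<le> ennreal (2 * inv_const) * A\<^sup>2 * V"
  proof (rule ennreal_le_epsilon)
    fix e :: real assume "e > 0"
    then obtain n where n: "(nn_sq lborel (\<lambda>x. g x - fourier (h n) x)) \<le> ennreal (e / 2)"
      using g(2)[of "e / 2"] by auto
    have "ennreal ((norm (g x))\<^sup>2) \<le> 2 * ennreal ((norm (fourier (h n) x))\<^sup>2) + 2 * ennreal ((norm (g x - fourier (h n) x))\<^sup>2)" for x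
      using norm_diff_square_le[of "fourier (h n) x" "fourier (h n) x - g x"]
      by (simp add: ennreal_leI norm_minus_commute flip: ennreal_plus ennreal_mult' ennreal_numeral)
    then have "(nn_sq lborel g) \<le> (\<integral>\<^sup>+x. 2 * ennreal ((norm (fourier (h n) x))\<^sup>2) + 2 * ennreal ((norm (g x - fourier (h n) x))\<^sup>2) \<partial>lborel)"
      by (intro nn_integral_mono)
    also have "\<dots> = 2 * (nn_sq lborel (fourier (h n))) + 2 * (nn_sq lborel (\<lambda>x. g x - fourier (h n) x))"
      by (subst nn_integral_add) (auto simp: nn_integral_cmult)
    also have "\<dots> \<le> 2 * (ennreal inv_const * (A\<^sup>2 * V)) + 2 * ennreal (e / 2)"
      by (intro add_mono mult_left_mono Fh n) auto
    also have "2 * ennreal (e / 2) = ennreal e" using \<open>e > 0\<close> by (simp flip: ennreal_mult' ennreal_numeral)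
    also have "2 * (ennreal inv_const * (A\<^sup>2 * V)) = ennreal (2 * inv_const) * A\<^sup>2 * V"
      using inv_const_pos by (simp add: ennreal_mult mult.assoc)
    finally show "(nn_sq lborel g) \<le> ennreal (2 * inv_const) * A\<^sup>2 * V + ennreal e" .
  qed
  have g2fin: "(nn_sq lborel g) < \<infinity>"
    using A2 v2 by (intro order_le_less_trans[OF g2]) (auto simp: V_def ennreal_mult_less_top)
  have pair: "(\<integral>x. v x * fourier \<psi> x \<partial>lborel) = (\<integral>x. g x * \<psi> x \<partial>lborel)" if \<psi>: "\<psi> \<in> schwartz" for \<psi>
  proof -
    note [measurable] = schwartz_measurable[OF \<psi>] fourier_schwartz_measurable[OF \<psi>]
    define P where "P = (nn_sq lborel \<psi>)"
    have P: "P < \<infinity>" unfolding P_def using schwartz_square_integrable[OF \<psi>] by (simp add: integrable_iff_bounded)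
    \<comment> \<open>The truncated convolutions are bounded by \<open>B\<close> times the L1 norm
      of \<open>\<Phi>\<close>, and by the reproducing identity they converge pointwise to
      \<open>v\<close>.\<close>
    have 1: "(\<lambda>n. \<integral>x. h n x * fourier \<psi> x \<partial>lborel) \<longlonglongrightarrow> (\<integral>x. v x * fourier \<psi> x \<partial>lborel)"
    proof (rule integral_dominated_convergence[where w = "\<lambda>x. B * enn2real A * norm (fourier \<psi> x)"])
      show "integrable lborel (\<lambda>x. B * enn2real A * norm (fourier \<psi> x))"
        by (intro integrable_mult_right integrable_norm fourier_schwartz_integrable \<psi>)
      show "AE x in lborel. (\<lambda>n. h n x * fourier \<psi> x) \<longlonglongrightarrow> v x * fourier \<psi> x"
      proof (intro always_eventually allI tendsto_mult tendsto_const)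
        fix x :: 'a
        have "(\<lambda>n. \<integral>z. \<Phi> (x - z) * vn n z \<partial>lborel) \<longlonglongrightarrow> (\<integral>z. \<Phi> (x - z) * v z \<partial>lborel)"
        proof (rule integral_dominated_convergence[where w = "\<lambda>z. norm (\<Phi> (x - z) * v z)"])
          show "integrable lborel (\<lambda>z. norm (\<Phi> (x - z) * v z))" by (intro integrable_norm int v B)
          show "AE z in lborel. (\<lambda>n. \<Phi> (x - z) * vn n z) \<longlonglongrightarrow> \<Phi> (x - z) * v z"
          proof (intro always_eventually allI tendsto_mult tendsto_const)
            fix z :: 'a
            obtain N :: nat where "norm z \<le> N" using real_arch_simple by blast
            then have "\<forall>\<^sub>F n in sequentially. vn n z = v z"
              by (intro eventually_sequentiallyI[of N]) (auto simp: vn_def)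
            then show "(\<lambda>n. vn n z) \<longlonglongrightarrow> v z" by (rule tendsto_eventually)
          qed
          show "AE z in lborel. norm (\<Phi> (x - z) * vn n z) \<le> norm (\<Phi> (x - z) * v z)" for n
            using vn_le by (auto simp: norm_mult intro!: mult_left_mono)
        qed measurable
        then show "(\<lambda>n. h n x) \<longlonglongrightarrow> v x" unfolding h_eq rep[of x, symmetric] .
      qed
      show "AE x in lborel. norm (h n x * fourier \<psi> x) \<le> B * enn2real A * norm (fourier \<psi> x)" for n
      proof (intro always_eventually allI)
        fix x :: 'a
        have "norm (h n x) \<le> (\<integral>z. norm (\<Phi> (x - z) * vn n z) \<partial>lborel)" unfolding h_eq by (rule integral_norm_bound)
        also have "\<dots> \<le> (\<integral>z. B * norm (\<Phi> (x - z)) \<partial>lborel)"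
          using order_trans[OF vn_le B]
          by (intro integral_mono integrable_norm intn integrable_mult_right schwartz_integrable schwartz_reflect \<Phi>)
             (auto simp: norm_mult mult.commute[of B] intro!: mult_left_mono)
        also have "\<dots> = B * (\<integral>z. norm (\<Phi> z) \<partial>lborel)"
          using integral_reflect[of "\<lambda>z. norm (\<Phi> z)" x] by simp
        also have "(\<integral>z. norm (\<Phi> z) \<partial>lborel) = enn2real A" unfolding A_def by (rule integral_eq_nn_integral) auto
        finally show "norm (h n x * fourier \<psi> x) \<le> B * enn2real A * norm (fourier \<psi> x)"
          by (auto simp: norm_mult intro: mult_right_mono)
      qed
    qed measurable
    have eqn: "(\<integral>x. h n x * fourier \<psi> x \<partial>lborel) = (\<integral>x. fourier (h n) x * \<psi> x \<partial>lborel)" for n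
      by (intro fourier_multiplication[symmetric] schwartz_integrable h \<psi>)
    have igp: "integrable lborel (\<lambda>x. g x * \<psi> x)"
      by (rule integrable_mult_L2) (use g2fin P in \<open>auto simp: P_def\<close>)
    have ihp: "integrable lborel (\<lambda>x. fourier (h n) x * \<psi> x)" for n
      by (intro schwartz_integrable schwartz_mult fourier_schwartz h \<psi>)
    have 2: "(\<lambda>n. \<integral>x. fourier (h n) x * \<psi> x \<partial>lborel) \<longlonglongrightarrow> (\<integral>x. g x * \<psi> x \<partial>lborel)"
    proof (rule LIMSEQ_I)
      fix e :: real assume e: "e > 0"
      \<comment> \<open>Chosen so that \<open>\<delta>\<close> times \<open>P\<close> stays below
        \<open>e\<^sup>2\<close> in the Cauchy-Schwarz estimate; the added 1 covers
        \<open>P = 0\<close>.\<close>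
      define \<delta> where "\<delta> = e\<^sup>2 / (2 * (enn2real P + 1))"
      have \<delta>: "\<delta> > 0" unfolding \<delta>_def using e by (simp add: add_nonneg_pos)
      then obtain N where N: "\<And>n. n \<ge> N \<Longrightarrow> (nn_sq lborel (\<lambda>x. g x - fourier (h n) x)) \<le> ennreal \<delta>"
        using g(2) by blast
      have "norm ((\<integral>x. fourier (h n) x * \<psi> x \<partial>lborel) - (\<integral>x. g x * \<psi> x \<partial>lborel)) < e" if "n \<ge> N" for n
      proof -
        let ?d = "\<integral>x. (g x - fourier (h n) x) * \<psi> x \<partial>lborel"
        have id: "integrable lborel (\<lambda>x. (g x - fourier (h n) x) * \<psi> x)"
          unfolding left_diff_distrib by (intro Bochner_Integration.integrable_diff igp ihp)
        have d: "?d = (\<integral>x. g x * \<psi> x \<partial>lborel) - (\<integral>x. fourier (h n) x * \<psi> x \<partial>lborel)"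
          unfolding left_diff_distrib by (intro Bochner_Integration.integral_diff igp ihp)
        have "(ennreal (norm ?d))\<^sup>2 \<le> (nn_sq lborel (\<lambda>x. g x - fourier (h n) x)) * P"
          unfolding P_def by (rule integral_pairing_L2[OF id]) measurable
        also have "\<dots> \<le> ennreal \<delta> * P" by (intro mult_right_mono N that) auto
        also have "P = ennreal (enn2real P)" using P by simp
        finally have "ennreal ((norm ?d)\<^sup>2) \<le> ennreal (\<delta> * enn2real P)"
          using \<delta> by (simp add: ennreal_power ennreal_mult)
        then have "(norm ?d)\<^sup>2 \<le> \<delta> * enn2real P" using \<delta> by (subst (asm) ennreal_le_iff) auto
        also have "\<dots> < e\<^sup>2"
        proof -
          have "\<delta> * enn2real P \<le> \<delta> * (enn2real P + 1)" using \<delta> by (intro mult_left_mono) auto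
          also have "\<dots> = e\<^sup>2 / 2" unfolding \<delta>_def
            using enn2real_nonneg[of P] by (simp add: field_simps add_nonneg_eq_0_iff)
          also have "\<dots> < e\<^sup>2" using e by simp
          finally show ?thesis .
        qed
        finally have "norm ?d < e" using e by (simp add: power2_less_imp_less)
        then show ?thesis unfolding d by (simp add: norm_minus_commute)
      qed
      then show "\<exists>no. \<forall>n\<ge>no. norm ((\<integral>x. fourier (h n) x * \<psi> x \<partial>lborel) - (\<integral>x. g x * \<psi> x \<partial>lborel)) < e" by blast
    qed
    from LIMSEQ_unique[OF 1[unfolded eqn] 2] show ?thesis .
  qed
  from that[OF _ g2[unfolded A_def V_def] pair] show ?thesis by measurable
qed

end

subsection \<open>Littlewood--Paley pieces\<close>

text \<open>A crude substitute for Hoelder's inequality, from \<open>t \<le> 1 + t powr p\<close>.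
  It is not homogeneous in \<open>g\<close>, but it serves to establish finiteness.\<close>

lemma nn_integral_mult_le_Lp:
  fixes \<psi> g :: "'b \<Rightarrow> complex"
  assumes [measurable]: "\<psi> \<in> borel_measurable M" "g \<in> borel_measurable M"
    and S: "\<And>x. norm (\<psi> x) \<le> S" "S \<ge> 0" and p: "p \<ge> 1"
  shows "(\<integral>\<^sup>+x. ennreal (norm (\<psi> x * g x)) \<partial>M)
    \<le> (\<integral>\<^sup>+x. ennreal (norm (\<psi> x)) \<partial>M) + ennreal S * (\<integral>\<^sup>+x. ennreal (norm (g x) powr p) \<partial>M)"
proof -
  have le: "t \<le> 1 + t powr p" if "t \<ge> 0" for t :: real
  proof (cases "t \<le> 1")
    case False
    then have "t powr 1 \<le> t powr p" using p by (intro powr_mono) auto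
    then show ?thesis using False by simp
  qed (simp add: add_increasing2)
  have "(\<integral>\<^sup>+x. ennreal (norm (\<psi> x * g x)) \<partial>M) \<le> (\<integral>\<^sup>+x. ennreal (norm (\<psi> x)) + ennreal S * ennreal (norm (g x) powr p) \<partial>M)"
  proof (rule nn_integral_mono)
    fix x
    have "norm (\<psi> x * g x) \<le> norm (\<psi> x) * (1 + norm (g x) powr p)"
      unfolding norm_mult by (intro mult_left_mono le) auto
    also have "\<dots> = norm (\<psi> x) + norm (\<psi> x) * (norm (g x) powr p)" by (simp add: algebra_simps)
    also have "\<dots> \<le> norm (\<psi> x) + S * (norm (g x) powr p)" using S by (intro add_mono mult_right_mono) auto
    finally show "ennreal (norm (\<psi> x * g x)) \<le> ennreal (norm (\<psi> x)) + ennreal S * ennreal (norm (g x) powr p)"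
      using S by (simp add: ennreal_leI flip: ennreal_mult ennreal_plus)
  qed
  also have "\<dots> = (\<integral>\<^sup>+x. ennreal (norm (\<psi> x)) \<partial>M) + ennreal S * (\<integral>\<^sup>+x. ennreal (norm (g x) powr p) \<partial>M)"
    by (subst nn_integral_add) (auto simp: nn_integral_cmult)
  finally show ?thesis .
qed

text \<open>A qualitative Bernstein inequality. Some finite bound is wanted, whatever its size: it
  lets \<open>reproduced_sup_bound\<close> absorb a fraction of the supremum and makes
  \<open>piece_L2\<close> possible.\<close>

lemma reproduced_bounded:
  fixes v \<Phi> :: "'a::euclidean_space \<Rightarrow> complex"
  assumes \<Phi>: "\<Phi> \<in> schwartz" and v [measurable]: "v \<in> borel_measurable borel"
    and int: "\<And>x. integrable lborel (\<lambda>z. \<Phi> (x - z) * v z)"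
    and rep: "\<And>x. v x = (\<integral>z. \<Phi> (x - z) * v z \<partial>lborel)"
    and p: "p \<ge> 1" "(\<integral>\<^sup>+x. ennreal (norm (v x) powr p) \<partial>lborel) < \<infinity>"
  obtains B where "\<And>x. norm (v x) \<le> B"
proof -
  note [measurable] = schwartz_measurable[OF \<Phi>]
  obtain S where S: "S \<ge> 0" "\<And>x. norm (\<Phi> x) \<le> S" using rapid_bounded[OF schwartz_rapid[OF \<Phi>]] by blast
  let ?I = "\<integral>\<^sup>+x. ennreal (norm (v x) powr p) \<partial>lborel"
  let ?A = "\<integral>\<^sup>+z. ennreal (norm (\<Phi> z)) \<partial>lborel"
  have A: "?A < \<infinity>" using schwartz_integrable[OF \<Phi>] by (simp add: integrable_iff_bounded)
  have "ennreal (norm (v x)) \<le> ?A + ennreal S * ?I" for x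
  proof -
    have "ennreal (norm (v x)) \<le> (\<integral>\<^sup>+z. ennreal (norm (\<Phi> (x - z) * v z)) \<partial>lborel)"
      using integral_norm_bound_ennreal[OF int[of x]] unfolding rep[of x, symmetric] .
    also have "\<dots> \<le> (\<integral>\<^sup>+z. ennreal (norm (\<Phi> (x - z))) \<partial>lborel) + ennreal S * ?I"
      by (rule nn_integral_mult_le_Lp[OF _ _ S(2,1) p(1)]) measurable
    also have "(\<integral>\<^sup>+z. ennreal (norm (\<Phi> (x - z))) \<partial>lborel) = ?A"
      using nn_integral_affine[of "\<lambda>z. ennreal (norm (\<Phi> z))" "-1" x] by simp
    finally show ?thesis .
  qed
  moreover have "?A + ennreal S * ?I < \<infinity>" using A p by (simp add: ennreal_mult_less_top)
  ultimately have "norm (v x) \<le> enn2real (?A + ennreal S * ?I)" for x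
    by (metis enn2real_ennreal enn2real_mono infinity_ennreal_def norm_ge_zero)
  then show ?thesis using that by blast
qed

text \<open>A function reproduced by \<open>\<Phi>\<close> is controlled by any level that it exceeds only on a small set.\<close>

lemma reproduced_sup_bound:
  fixes v \<Phi> :: "'a::euclidean_space \<Rightarrow> complex"
  assumes \<Phi>: "\<Phi> \<in> schwartz" and v [measurable]: "v \<in> borel_measurable borel" and B: "\<And>x. norm (v x) \<le> B"
    and rep: "\<And>x. v x = (\<integral>z. \<Phi> (x - z) * v z \<partial>lborel)"
    and S: "\<And>x. norm (\<Phi> x) \<le> S" and t: "t \<ge> 0"
    and E: "emeasure lborel {x. norm (v x) > t} \<le> ennreal m" "S * m \<le> 1 / 2" "m \<ge> 0"
  shows "norm (v x) \<le> 2 * (\<integral>z. norm (\<Phi> z) \<partial>lborel) * t"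
proof -
  note [measurable] = schwartz_measurable[OF \<Phi>]
  define A where "A = (\<integral>z. norm (\<Phi> z) \<partial>lborel)"
  define E where "E = {x. norm (v x) > t}"
  define s where "s = (SUP x. norm (v x))"
  have bdd: "bdd_above (range (\<lambda>x. norm (v x)))" by (rule bdd_aboveI2) (rule B)
  have le_s: "norm (v x) \<le> s" for x unfolding s_def by (rule cSUP_upper[OF _ bdd]) simp
  have s0: "s \<ge> 0" using le_s[of 0] norm_ge_zero order_trans by blast
  have S0: "S \<ge> 0" using S[of 0] norm_ge_zero order_trans by blast
  have [measurable]: "E \<in> sets borel" unfolding E_def by measurable
  have Em: "measure lborel E \<le> m" and Efin: "emeasure lborel E < \<infinity>"
    using E by (auto simp: E_def measure_def enn2real_leI intro: order_le_less_trans)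
  have "norm (v x) \<le> A * t + s / 2" for x
  proof -
    have i1: "integrable lborel (\<lambda>z. norm (\<Phi> (x - z)))" by (intro integrable_norm schwartz_integrable schwartz_reflect \<Phi>)
    have i2: "integrable lborel (indicator E :: 'a \<Rightarrow> real)" using Efin by simp
    have "norm (v x) \<le> (\<integral>z. norm (\<Phi> (x - z) * v z) \<partial>lborel)" by (subst rep) (rule integral_norm_bound)
    \<comment> \<open>Outside \<open>E\<close> the function is at most \<open>t\<close> and the
      whole mass of \<open>\<Phi>\<close> may be spent; on \<open>E\<close> only the supremum
      \<open>s\<close> is known, but there the small measure of \<open>E\<close> multiplies the
      height \<open>S\<close> of the kernel.\<close>
    also have "\<dots> \<le> (\<integral>z. norm (\<Phi> (x - z)) * t + S * s * indicator E z \<partial>lborel)"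
    proof (rule integral_mono')
      show "integrable lborel (\<lambda>z. norm (\<Phi> (x - z)) * t + S * s * indicator E z)"
        by (intro Bochner_Integration.integrable_add integrable_mult_left integrable_mult_right i1 i2)
      fix z
      show "norm (\<Phi> (x - z) * v z) \<le> norm (\<Phi> (x - z)) * t + S * s * indicator E z"
      proof (cases "z \<in> E")
        case True
        have "norm (\<Phi> (x - z) * v z) \<le> S * s" unfolding norm_mult by (intro mult_mono S le_s S0) auto
        then show ?thesis using True t by (simp add: add_increasing)
      next
        case False
        then show ?thesis unfolding norm_mult by (auto simp: E_def not_less intro!: mult_left_mono)
      qed
    qed (use S0 s0 t in auto)
    also have "\<dots> = (\<integral>z. norm (\<Phi> (x - z)) \<partial>lborel) * t + S * s * measure lborel E"
      using i1 i2 by (subst Bochner_Integration.integral_add) auto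
    also have "(\<integral>z. norm (\<Phi> (x - z)) \<partial>lborel) = A"
      unfolding A_def using integral_reflect[of "\<lambda>z. norm (\<Phi> z)" x] by simp
    also have "S * s * measure lborel E \<le> s / 2"
    proof -
      have "S * s * measure lborel E \<le> S * s * m" using S0 s0 Em by (intro mult_left_mono) auto
      also have "\<dots> = s * (S * m)" by simp
      also have "\<dots> \<le> s * (1 / 2)" using E s0 by (intro mult_left_mono) auto
      finally show ?thesis by simp
    qed
    finally show ?thesis by simp
  qed
  \<comment> \<open>The supremum is finite, so its half can be absorbed into the left side; this
    doubles the constant.\<close>
  then have "s \<le> A * t + s / 2" unfolding s_def by (intro cSUP_least) auto
  then show ?thesis using le_s[of x] unfolding A_def by simp
qed

context lp_gen
begin

section \<open>Dilated cutoffs and the dyadic partition of frequency space\<close>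

definition cutoff :: "real \<Rightarrow> 'a \<Rightarrow> complex" where "cutoff t \<xi> = bump (\<xi> /\<^sub>R t)"

lemma cutoff_schwartz: "t > 0 \<Longrightarrow> cutoff t \<in> schwartz"
  unfolding cutoff_def[abs_def] by (intro schwartz_dilate bump_schwartz) auto

lemma cutoff_1: "t > 0 \<Longrightarrow> norm \<xi> \<le> t \<Longrightarrow> cutoff t \<xi> = 1"
  unfolding cutoff_def by (intro bump_1) (simp add: field_simps)

lemma cutoff_0: "t > 0 \<Longrightarrow> norm \<xi> \<ge> 2 * t \<Longrightarrow> cutoff t \<xi> = 0"
  unfolding cutoff_def by (intro bump_0) (simp add: field_simps)

lemma norm_cutoff_diff_le: "norm (cutoff a \<xi> - cutoff b \<xi>) \<le> 1"
proof -
  obtain x y where "cutoff a \<xi> = of_real x" "0 \<le> x" "x \<le> 1" "cutoff b \<xi> = of_real y" "0 \<le> y" "y \<le> 1"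
    unfolding cutoff_def using bump_range by metis
  then show ?thesis by (simp flip: of_real_diff)
qed

definition phi_dil :: "real \<Rightarrow> 'a \<Rightarrow> complex" where
  "phi_dil t x = of_real (t ^ DIM('a)) * \<phi> (t *\<^sub>R x)"

lemma phi_dil_schwartz: "t > 0 \<Longrightarrow> phi_dil t \<in> schwartz"
  unfolding phi_dil_def[abs_def] by (intro schwartz_cmult schwartz_dilate phi_schwartz) auto

lemma fourier_phi_dil: assumes "t > 0" shows "fourier (phi_dil t) = cutoff t"
proof
  fix \<xi>
  have "fourier (phi_dil t) \<xi> = of_real (t ^ DIM('a)) * fourier (\<lambda>x. \<phi> (t *\<^sub>R x)) \<xi>"
    unfolding fourier_def phi_dil_def mult.assoc by simp
  also have "\<dots> = cutoff t \<xi>"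
    using fourier_dilate[OF schwartz_measurable[OF phi_schwartz] assms, of \<xi>] by (simp add: cutoff_def bump_def scaleR_conv_of_real)
  finally show "fourier (phi_dil t) \<xi> = cutoff t \<xi>" .
qed

definition phi_L1 :: real where "phi_L1 = (\<integral>x. norm (\<phi> x) \<partial>lborel)"

lemma phi_dil_L1: assumes "t > 0" shows "(\<integral>x. norm (phi_dil t x) \<partial>lborel) = phi_L1"
proof -
  have [measurable]: "\<phi> \<in> borel_measurable borel" by (intro schwartz_measurable phi_schwartz)
  show ?thesis
    unfolding phi_L1_def phi_dil_def using assms
    by (subst integral_affine[where c = t and a = 0 and f = "\<lambda>x. norm (\<phi> x)"]) (auto simp: norm_mult norm_power)
qed

lemma phi_L1_ge_1: "phi_L1 \<ge> 1"
  using norm_fourier_le[of \<phi> 0] bump_1[of 0] by (simp add: phi_L1_def bump_def)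

lemma phi_dil_bound: obtains S where "S > 0" "\<And>t x. t > 0 \<Longrightarrow> norm (phi_dil t x) \<le> t ^ DIM('a) * S"
proof -
  obtain S where S: "S \<ge> 0" "\<And>x. norm (\<phi> x) \<le> S" using rapid_bounded[OF schwartz_rapid[OF phi_schwartz]] by blast
  have "norm (phi_dil t x) \<le> t ^ DIM('a) * (S + 1)" if "t > 0" for t x
    unfolding phi_dil_def norm_mult using that S(2)[of "t *\<^sub>R x"] by (auto simp: norm_power intro!: mult_left_mono)
  then show ?thesis using that[of "S + 1"] S by auto
qed

text \<open>\<open>fourier_mult_conv\<close> is used with \<open>b\<close> equal to
  \<open>fourier \<Phi>\<close> divided by the inversion constant. The transform of \<open>b\<close>
  is then the reflected \<open>\<Phi>\<close>, while \<open>eq\<close> makes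
  \<open>fourier f\<close> times \<open>b\<close> a multiple of \<open>fourier f\<close>, whose
  transform gives back \<open>f\<close>.\<close>

lemma schwartz_reproduced:
  fixes f \<Phi> :: "'a \<Rightarrow> complex"
  assumes f: "f \<in> schwartz" and \<Phi>: "\<Phi> \<in> schwartz" and eq: "\<And>\<xi>. fourier f \<xi> * fourier \<Phi> \<xi> = fourier f \<xi>"
  shows "(\<integral>z. f (z - y) * \<Phi> (x - z) \<partial>lborel) = f (x - y)"
proof -
  note [measurable] = schwartz_measurable[OF f] schwartz_measurable[OF \<Phi>]
  define b where "b \<xi> = of_real (1 / inv_const) * fourier \<Phi> \<xi>" for \<xi>
  have b: "b \<in> schwartz" unfolding b_def by (intro schwartz_cmult fourier_schwartz \<Phi>)
  have c0: "inv_const \<noteq> 0" using inv_const_pos by simp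
  have Fc: "fourier (\<lambda>\<xi>. of_real (1 / inv_const) * q \<xi>) x = of_real (1 / inv_const) * fourier q x" for q :: "'a \<Rightarrow> complex" and x
    unfolding fourier_def mult.assoc by simp
  have Fb: "fourier b x = \<Phi> (- x)" for x
    unfolding b_def Fc using fourier_fourier[OF \<Phi>, of x] c0 by simp
  have "(\<lambda>\<xi>. fourier f \<xi> * b \<xi>) = (\<lambda>\<xi>. of_real (1 / inv_const) * fourier f \<xi>)"
    unfolding b_def using eq by (simp add: fun_eq_iff mult.left_commute)
  then have conv: "(\<integral>w. f (w - y') * \<Phi> (- w) \<partial>lborel) = f (- y')" for y'
    using fourier_mult_conv[OF f b, of y'] fourier_fourier[OF f, of y'] c0 unfolding Fb by (simp only: Fc) simp
  have "(\<integral>z. f (z - y) * \<Phi> (x - z) \<partial>lborel) = (\<integral>w. (\<lambda>z. f (z - y) * \<Phi> (x - z)) (w + x) \<partial>lborel)"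
    by (rule integral_translate[symmetric]) measurable
  also have "\<dots> = (\<integral>w. f (w - (y - x)) * \<Phi> (- w) \<partial>lborel)" by (simp add: algebra_simps)
  also have "\<dots> = f (x - y)" unfolding conv by simp
  finally show ?thesis .
qed

definition dyadic :: "int \<Rightarrow> real" where "dyadic k = 2 powi k"

lemma dyadic_pos: "dyadic k > 0" by (simp add: dyadic_def)
lemma dyadic_Suc: "dyadic (k + 1) = 2 * dyadic k" by (simp add: dyadic_def power_int_add)
lemma dyadic_powr: "dyadic k = 2 powr of_int k" by (simp add: dyadic_def powr_real_of_int')

definition symb :: "int \<Rightarrow> 'a \<Rightarrow> complex" where
  "symb k \<xi> = cutoff (dyadic (k + 1)) \<xi> - cutoff (dyadic k) \<xi>"

text \<open>Since \<open>cutoff t\<close> is 1 up to radius \<open>t\<close> and 0 beyond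
  \<open>2 * t\<close>, these scales make the outer cutoff 1 and the inner one 0 on the annulus from
  \<open>dyadic k\<close> to \<open>4 * dyadic k\<close> that carries \<open>symb k\<close>.\<close>

definition wide :: "int \<Rightarrow> 'a \<Rightarrow> complex" where
  "wide k \<xi> = cutoff (4 * dyadic k) \<xi> - cutoff (dyadic k / 2) \<xi>"

lemma symb_schwartz: "symb k \<in> schwartz" and wide_schwartz: "wide k \<in> schwartz"
  unfolding symb_def[abs_def] wide_def[abs_def] using dyadic_pos
  by (auto intro!: schwartz_diff cutoff_schwartz)

lemma symb_eq: "lp_symbol \<phi> ((2 powi (- k)) *\<^sub>R \<xi>) = symb k \<xi>"
  by (simp add: lp_symbol_def symb_def cutoff_def bump_def dyadic_def power_int_add power_int_minus mult.commute)

lemma symb_support: assumes "symb k \<xi> \<noteq> 0" shows "dyadic k \<le> norm \<xi>" "norm \<xi> \<le> 4 * dyadic k"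
proof -
  show "dyadic k \<le> norm \<xi>"
    using assms cutoff_1[of "dyadic k" \<xi>] cutoff_1[of "dyadic (k + 1)" \<xi>] dyadic_pos[of k] dyadic_Suc[of k]
    unfolding symb_def by (cases "norm \<xi> \<le> dyadic k") auto
  show "norm \<xi> \<le> 4 * dyadic k"
    using assms cutoff_0[of "dyadic k" \<xi>] cutoff_0[of "dyadic (k + 1)" \<xi>] dyadic_pos[of k] dyadic_Suc[of k]
    unfolding symb_def by (cases "norm \<xi> \<ge> 4 * dyadic k") auto
qed

lemma wide_support: assumes "wide k \<xi> \<noteq> 0" shows "dyadic k / 2 \<le> norm \<xi>" "norm \<xi> \<le> 8 * dyadic k"
proof -
  show "dyadic k / 2 \<le> norm \<xi>"
    using assms cutoff_1[of "4 * dyadic k" \<xi>] cutoff_1[of "dyadic k / 2" \<xi>] dyadic_pos[of k]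
    unfolding wide_def by (cases "norm \<xi> \<le> dyadic k / 2") auto
  show "norm \<xi> \<le> 8 * dyadic k"
    using assms cutoff_0[of "4 * dyadic k" \<xi>] cutoff_0[of "dyadic k / 2" \<xi>] dyadic_pos[of k]
    unfolding wide_def by (cases "norm \<xi> \<ge> 8 * dyadic k") auto
qed

lemma symb_wide: "symb k \<xi> * wide k \<xi> = symb k \<xi>"
proof (cases "symb k \<xi> = 0")
  case False
  from symb_support[OF this] have "wide k \<xi> = 1"
    unfolding wide_def using cutoff_1[of "4 * dyadic k" \<xi>] cutoff_0[of "dyadic k / 2" \<xi>] dyadic_pos[of k] by simp
  then show ?thesis by simp
qed simp

lemma symb_low: "symb k \<xi> * cutoff (4 * dyadic k) \<xi> = symb k \<xi>"
proof (cases "symb k \<xi> = 0")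
  case False
  from symb_support[OF this] show ?thesis using cutoff_1[of "4 * dyadic k" \<xi>] dyadic_pos[of k] by simp
qed simp

lemma norm_wide_le: "norm (wide k \<xi>) \<le> 1" unfolding wide_def by (rule norm_cutoff_diff_le)

text \<open>The sum telescopes. On any annulus between two positive radii the right side is 1 for
  large \<open>n\<close>, which gives the partition of unity away from the origin.\<close>

lemma sum_symb: "(\<Sum>k\<in>{- int n..<int n}. symb k \<xi>) = cutoff (dyadic (int n)) \<xi> - cutoff (dyadic (- int n)) \<xi>"
proof (induction n)
  case (Suc n)
  have e: "int (Suc n) = int n + 1" "- (int n + 1) = - int n - 1" by simp_all
  have "{- int (Suc n)..<int (Suc n)} = insert (- int n - 1) (insert (int n) {- int n..<int n})" by auto
  then have "(\<Sum>k\<in>{- int (Suc n)..<int (Suc n)}. symb k \<xi>) = symb (- int n - 1) \<xi> + (symb (int n) \<xi> + (\<Sum>k\<in>{- int n..<int n}. symb k \<xi>))"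
    by simp
  then show ?case unfolding Suc unfolding e symb_def by simp
qed simp

text \<open>The description operator is resolved by \<open>fourier_surj\<close> for existence and
  \<open>fourier_inj\<close> for uniqueness.\<close>

lemma lp_piece:
  shows lp_piece_schwartz: "lp_piece \<phi> k \<in> schwartz" and fourier_lp_piece: "fourier (lp_piece \<phi> k) = symb k"
proof -
  let ?P = "\<lambda>\<psi>. \<psi> \<in> schwartz \<and> (\<forall>\<xi>. fourier \<psi> \<xi> = lp_symbol \<phi> ((2 powi (- k)) *\<^sub>R \<xi>))"
  obtain \<psi> where \<psi>: "\<psi> \<in> schwartz" "fourier \<psi> = symb k" using fourier_surj[OF symb_schwartz] .
  have "?P (THE \<psi>. ?P \<psi>)"
  proof (rule theI[where P = ?P])
    show "?P \<psi>" using \<psi> unfolding symb_eq by simp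
    fix \<psi>' assume P: "?P \<psi>'"
    have "fourier \<psi>' = fourier \<psi>"
      unfolding \<psi>(2) by (rule ext) (rule P[THEN conjunct2, rule_format, unfolded symb_eq])
    then show "\<psi>' = \<psi>" using P \<psi>(1) fourier_inj by blast
  qed
  then have P: "?P (lp_piece \<phi> k)" unfolding lp_piece_def .
  then show "lp_piece \<phi> k \<in> schwartz" by blast
  show "fourier (lp_piece \<phi> k) = symb k"
    by (rule ext) (rule P[THEN conjunct2, rule_format, unfolded symb_eq])
qed

section \<open>The pieces of a tempered distribution as functions\<close>

abbreviation piece :: "(('a \<Rightarrow> complex) \<Rightarrow> complex) \<Rightarrow> int \<Rightarrow> 'a \<Rightarrow> complex" where
  "piece u k \<equiv> conv_distr (lp_piece \<phi> k) u"

text \<open>The symbol of \<open>phi_dil (4 * dyadic k)\<close> is 1 on the support of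
  \<open>symb k\<close>, so convolution with it fixes \<open>lp_piece \<phi> k\<close>;
  \<open>tempered_integral\<close> passes this identity through \<open>u\<close>.\<close>

lemma piece_reproduced:
  assumes u: "u \<in> tempered"
  shows "piece u k x = (\<integral>z. phi_dil (4 * dyadic k) (x - z) * piece u k z \<partial>lborel)"
proof -
  let ?\<Phi> = "phi_dil (4 * dyadic k)" and ?\<psi> = "lp_piece \<phi> k"
  have t: "4 * dyadic k > 0" using dyadic_pos[of k] by simp
  have \<Phi>: "?\<Phi> \<in> schwartz" by (rule phi_dil_schwartz[OF t])
  have "u (\<lambda>y. \<integral>z. ?\<psi> (z - y) * ?\<Phi> (x - z) \<partial>lborel) = (\<integral>z. conv_distr ?\<psi> u z * ?\<Phi> (x - z) \<partial>lborel)"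
    by (intro tempered_integral u lp_piece_schwartz schwartz_moments schwartz_reflect \<Phi>)
  moreover have "(\<integral>z. ?\<psi> (z - y) * ?\<Phi> (x - z) \<partial>lborel) = ?\<psi> (x - y)" for y
    by (rule schwartz_reproduced[OF lp_piece_schwartz \<Phi>]) (simp add: fourier_lp_piece fourier_phi_dil[OF t] symb_low)
  ultimately show ?thesis by (simp add: conv_distr_def mult.commute)
qed

lemma piece_integrable:
  assumes u: "u \<in> tempered"
  shows "integrable lborel (\<lambda>z. phi_dil (4 * dyadic k) (x - z) * piece u k z)"
proof -
  let ?\<Phi> = "phi_dil (4 * dyadic k)" and ?v = "piece u k"
  have t: "4 * dyadic k > 0" using dyadic_pos[of k] by simp
  have S: "(\<lambda>z. ?\<Phi> (x - z)) \<in> schwartz" by (intro schwartz_reflect phi_dil_schwartz t)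
  note [measurable] = schwartz_measurable[OF S] conv_distr_measurable[OF u lp_piece_schwartz]
  obtain C N where C: "C \<ge> 0" "\<And>x. norm (?v x) \<le> C * (1 + norm x) ^ N"
    using conv_distr_growth[OF u lp_piece_schwartz] by metis
  show ?thesis
  proof (rule Bochner_Integration.integrable_bound)
    show "integrable lborel (\<lambda>z. C * ((1 + norm z) ^ N * norm (?\<Phi> (x - z))))"
      by (intro integrable_mult_right schwartz_weight_integrable S)
    have "norm (?\<Phi> (x - z) * ?v z) \<le> C * ((1 + norm z) ^ N * norm (?\<Phi> (x - z)))" for z
      using mult_left_mono[OF C(2)[of z], of "norm (?\<Phi> (x - z))"] by (simp add: norm_mult mult_ac)
    then show "AE z in lborel. norm (?\<Phi> (x - z) * ?v z) \<le> norm (C * ((1 + norm z) ^ N * norm (?\<Phi> (x - z))))"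
      unfolding real_norm_def by (intro always_eventually allI order_trans[OF _ abs_ge_self])
  qed measurable
qed

text \<open>By \<open>fourier_mult_conv\<close> the test function on the left is a superposition of
  translates of \<open>lp_piece \<phi> k\<close>, to which \<open>tempered_integral\<close> applies.
  In effect, the transform of \<open>u\<close> multiplied by \<open>symb k\<close> is the transform
  of the function \<open>piece u k\<close>.\<close>

lemma tempered_fourier_symb:
  assumes u: "u \<in> tempered" and g: "g \<in> schwartz"
  shows "u (fourier (\<lambda>\<xi>. symb k \<xi> * g \<xi>)) = (\<integral>x. piece u k x * fourier g x \<partial>lborel)"
proof -
  have eq: "fourier (\<lambda>\<xi>. symb k \<xi> * g \<xi>) = (\<lambda>y. \<integral>x. lp_piece \<phi> k (x - y) * fourier g x \<partial>lborel)"
    using fourier_mult_conv[OF lp_piece_schwartz g, of k] by (simp add: fourier_lp_piece fun_eq_iff)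
  show ?thesis
    unfolding eq by (intro tempered_integral u lp_piece_schwartz schwartz_moments fourier_schwartz g)
qed

end

subsection \<open>The embedding estimate\<close>

lemma epowr_ennreal: "t \<ge> 0 \<Longrightarrow> epowr (ennreal t) a = ennreal (t powr a)"
  by (simp add: epowr_def)

lemma epowr_ge: "t \<ge> 0 \<Longrightarrow> a \<ge> 0 \<Longrightarrow> ennreal t \<le> h \<Longrightarrow> ennreal (t powr a) \<le> epowr h a"
  by (cases h) (auto simp: epowr_def intro!: ennreal_leI powr_mono2)

lemma epowr_mono: "a \<ge> 0 \<Longrightarrow> g \<le> h \<Longrightarrow> epowr g a \<le> epowr h a"
  by (cases g; cases h) (auto simp: epowr_def top_unique intro!: ennreal_leI powr_mono2)

lemma epowr_mult: "c \<ge> 0 \<Longrightarrow> c \<noteq> 0 \<Longrightarrow> epowr (ennreal c * h) a = ennreal (c powr a) * epowr h a"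
  by (cases h) (auto simp: epowr_def powr_mult ennreal_mult_top ennreal_mult[symmetric] enn2real_mult)

lemma measurable_epowr [measurable]:
  assumes [measurable]: "h \<in> borel_measurable M"
  shows "(\<lambda>x. epowr (h x) a) \<in> borel_measurable M"
  unfolding epowr_def
proof (rule measurable_If)
  have "{x \<in> space M. h x = \<infinity>} = h -` {\<infinity>} \<inter> space M" by auto
  then show "{x \<in> space M. h x = \<infinity>} \<in> sets M" using measurable_sets[OF assms, of "{\<infinity>}"] by simp
  have "(\<lambda>x. enn2real (h x) powr a) \<in> borel_measurable M"
    by measurable
  then show "(\<lambda>x. ennreal (enn2real (h x) powr a)) \<in> borel_measurable M" by measurable
qed simp

text \<open>For \<open>T > 0\<close> the indices that count form a half line starting at
  \<open>k0\<close>, and even the largest term, the one at \<open>k0\<close>, lies below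
  \<open>T\<close>.\<close>

lemma nn_integral_int_geometric:
  fixes \<beta> T :: real
  assumes \<beta>: "\<beta> > 0"
  shows "(\<integral>\<^sup>+k. ennreal (2 powr (- of_int k * \<beta>)) * indicator {k. 2 powr (- of_int k * \<beta>) < T} k \<partial>count_space (UNIV :: int set))
    \<le> ennreal (T / (1 - 2 powr (- \<beta>)))"
proof (cases "T > 0")
  case False
  then have "indicator {k. 2 powr (- of_int k * \<beta>) < T} k = (0 :: ennreal)" for k :: int
    using less_trans[of 0 "2 powr (- of_int k * \<beta>)" T] by (auto simp: indicator_def)
  then show ?thesis by simp
next
  case True
  define q where "q = 2 powr (- \<beta>)"
  have q: "0 < q" "q < 1" using \<beta> powr_less_mono[of "- \<beta>" 0 2] by (auto simp: q_def)
  define k0 where "k0 = \<lfloor>- log 2 T / \<beta>\<rfloor> + 1"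
  have iff: "2 powr (- of_int k * \<beta>) < T \<longleftrightarrow> k \<ge> k0" for k :: int
  proof -
    have "2 powr (- of_int k * \<beta>) < T \<longleftrightarrow> - of_int k * \<beta> < log 2 T"
      using True by (subst less_log_iff) auto
    also have "\<dots> \<longleftrightarrow> - log 2 T / \<beta> < of_int k"
      using \<beta> by (simp add: field_simps) argo
    also have "\<dots> \<longleftrightarrow> k \<ge> k0" unfolding k0_def by linarith
    finally show ?thesis .
  qed
  have bij: "bij_betw (\<lambda>n. k0 + int n) UNIV {k0..}"
    by (rule bij_betw_byWitness[where f' = "\<lambda>k. nat (k - k0)"]) auto
  have terms: "2 powr (- of_int (k0 + int n) * \<beta>) = 2 powr (- of_int k0 * \<beta>) * q ^ n" for n
  proof -
    have "q ^ n = 2 powr (- \<beta> * real n)" unfolding q_def by (subst powr_realpow[symmetric]) (simp_all add: powr_powr)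
    moreover have "- of_int (k0 + int n) * \<beta> = - of_int k0 * \<beta> + - \<beta> * real n" by (simp add: algebra_simps)
    ultimately show ?thesis by (simp only: powr_add)
  qed
  have "(\<integral>\<^sup>+k. ennreal (2 powr (- of_int k * \<beta>)) * indicator {k. 2 powr (- of_int k * \<beta>) < T} k \<partial>count_space (UNIV :: int set))
    = (\<integral>\<^sup>+k. ennreal (2 powr (- of_int k * \<beta>)) \<partial>count_space {k0..})"
    unfolding iff by (subst (2) nn_integral_count_space_indicator) (auto simp: atLeast_def)
  also have "\<dots> = (\<integral>\<^sup>+n. ennreal (2 powr (- of_int (k0 + int n) * \<beta>)) \<partial>count_space UNIV)"
    by (rule nn_integral_bij_count_space[OF bij, symmetric])
  also have "\<dots> = (\<Sum>n. ennreal (2 powr (- of_int k0 * \<beta>) * q ^ n))"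
    unfolding terms by (rule nn_integral_count_space_nat)
  also have "\<dots> = ennreal (2 powr (- of_int k0 * \<beta>) * (1 / (1 - q)))"
    using q by (intro suminf_ennreal_eq sums_mult geometric_sums) auto
  also have "\<dots> \<le> ennreal (T / (1 - q))"
  proof (rule ennreal_leI)
    have "2 powr (- of_int k0 * \<beta>) < T" unfolding iff by simp
    then show "2 powr (- of_int k0 * \<beta>) * (1 / (1 - q)) \<le> T / (1 - q)" using q by (simp add: divide_right_mono)
  qed
  finally show ?thesis unfolding q_def .
qed

text \<open>Terms are truncated at \<open>N\<close>: the truncated sum is still at least
  \<open>N\<close>, and a truncated term \<open>b\<close> satisfies
  \<open>N powr (q - 1) * b \<le> b powr q\<close> because \<open>q - 1\<close> is not positive. The
  real lower bound \<open>N\<close> stands for the sum itself, which may be infinite.\<close>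

lemma powr_subadditive:
  fixes a :: "int \<Rightarrow> real"
  assumes q: "0 < q" "q \<le> 1" and a: "\<And>j. a j \<ge> 0" and N: "N \<ge> 0" "ennreal N \<le> (\<integral>\<^sup>+j. ennreal (a j) \<partial>count_space UNIV)"
  shows "ennreal (N powr q) \<le> (\<integral>\<^sup>+j. ennreal (a j powr q) \<partial>count_space UNIV)"
proof (cases "N = 0")
  case False
  then have N0: "N > 0" using N by simp
  define b where "b j = min (a j) N" for j
  have Nb: "ennreal N \<le> (\<integral>\<^sup>+j. ennreal (b j) \<partial>count_space UNIV)"
  proof (cases "\<exists>j. a j \<ge> N")
    case True
    then obtain j where "a j \<ge> N" by blast
    then have "b j = N" by (simp add: b_def)
    then show ?thesis using nn_integral_ge_point[of j UNIV "\<lambda>j. ennreal (b j)"] by simp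
  next
    case False
    then have "a j < N" for j by (simp add: not_le)
    then have "b j = a j" for j using less_imp_le[of "a j" N] by (simp add: b_def)
    then have "b = a" by blast
    then show ?thesis using N by simp
  qed
  have "N powr q = N powr (q - 1) * N" using N0 by (simp add: powr_diff)
  then have "ennreal (N powr q) = ennreal (N powr (q - 1)) * ennreal N" using N by (simp add: ennreal_mult)
  also have "\<dots> \<le> ennreal (N powr (q - 1)) * (\<integral>\<^sup>+j. ennreal (b j) \<partial>count_space UNIV)"
    by (intro mult_left_mono Nb) simp
  also have "\<dots> = (\<integral>\<^sup>+j. ennreal (N powr (q - 1)) * ennreal (b j) \<partial>count_space UNIV)"
    by (subst nn_integral_cmult) auto
  also have "\<dots> \<le> (\<integral>\<^sup>+j. ennreal (a j powr q) \<partial>count_space UNIV)"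
  proof (rule nn_integral_mono)
    fix j
    have "N powr (q - 1) * b j \<le> a j powr q"
    proof (cases "b j = 0")
      case False
      then have b: "b j > 0" "b j \<le> N" "b j \<le> a j" using a[of j] N0 by (auto simp: b_def min_def split: if_splits)
      have "N powr (q - 1) * b j \<le> b j powr (q - 1) * b j"
        using b q by (intro mult_right_mono powr_mono2') auto
      also have "\<dots> = b j powr q" using b by (simp add: powr_diff)
      also have "\<dots> \<le> a j powr q" using b q by (intro powr_mono2) auto
      finally show ?thesis .
    qed simp
    then show "ennreal (N powr (q - 1)) * ennreal (b j) \<le> ennreal (a j powr q)"
      using a[of j] N0 by (simp add: b_def ennreal_leI flip: ennreal_mult)
  qed
  finally show ?thesis .
qed simp

text \<open>\<open>16 * A\<^sup>2\<close> is the square of the constant \<open>2 * A\<close> of the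
  sup bound, doubled by rounding to a dyadic height. \<open>2 * D\<close> comes from the measure
  threshold of that bound, and the two denominators from the geometric series over frequencies and
  over heights.\<close>

definition jawerth_const :: "real \<Rightarrow> real \<Rightarrow> real \<Rightarrow> real \<Rightarrow> real" where
  "jawerth_const p \<delta> A D = (16 * A\<^sup>2) powr (p / 2) * (2 * D) powr (1 - p / 2) / (1 - 2 powr (- (\<delta> * (1 - p / 2)))) / (1 - 2 powr (- p))"

text \<open>The elementary core of the Franke--Jawerth embedding of Triebel--Lizorkin into Besov spaces.
  The level sets of the maximal function \<open>M\<close> at the heights \<open>2\<^sup>j\<close> play the role of its
  decreasing rearrangement; \<open>sup\<close> is all that remains of the frequency localization of \<open>G k\<close>.\<close>

lemma jawerth_sum:
  fixes G :: "int \<Rightarrow> 'a::euclidean_space \<Rightarrow> real" and M :: "'a \<Rightarrow> ennreal" and N :: "int \<Rightarrow> real"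
  assumes p: "0 < p" "p < 2" and \<delta>: "\<delta> > 0" and A: "A \<ge> 1" and D: "D > 0"
    and G: "\<And>k. G k \<in> borel_measurable borel" "\<And>k x. G k x \<ge> 0"
    and M [measurable]: "M \<in> borel_measurable borel" and GM: "\<And>k x. ennreal (G k x) \<le> M x"
    and sup: "\<And>k t x. t > 0 \<Longrightarrow> emeasure lborel {x. M x > ennreal t} \<le> ennreal (2 powr (- of_int k * \<delta>) / (2 * D)) \<Longrightarrow> G k x \<le> 2 * A * t"
    and N: "\<And>k. N k \<ge> 0" "\<And>k. ennreal (N k) \<le> (\<integral>\<^sup>+x. ennreal ((G k x)\<^sup>2) \<partial>lborel)"
  shows "(\<integral>\<^sup>+k. ennreal (2 powr (- of_int k * (\<delta> * (1 - p / 2))) * N k powr (p / 2)) \<partial>count_space UNIV)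
     \<le> ennreal (jawerth_const p \<delta> A D)
        * (\<integral>\<^sup>+x. epowr (M x) p \<partial>lborel)"
proof -
  define I where "I = (\<integral>\<^sup>+x. epowr (M x) p \<partial>lborel)"
  define q where "q = p / 2"
  have q: "0 < q" "q < 1" using p by (auto simp: q_def)
  define \<beta> where "\<beta> = \<delta> * (1 - q)"
  have \<beta>: "\<beta> > 0" unfolding \<beta>_def using \<delta> q by simp
  have g1: "2 powr (- \<beta>) < 1" "2 powr (- p) < 1"
    using powr_less_mono[of "- \<beta>" 0 2] powr_less_mono[of "- p" 0 2] \<beta> p by auto
  define K1 where "K1 = (16 * A\<^sup>2) powr q * (2 * D) powr (1 - q) / (1 - 2 powr (- \<beta>))"
  have K1: "K1 > 0" unfolding K1_def using A D g1 by simp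
  define K where "K = K1 / (1 - 2 powr (- p))"
  have K: "K > 0" unfolding K_def using K1 g1 by simp
  have main: "(\<integral>\<^sup>+k. ennreal (2 powr (- of_int k * \<beta>) * N k powr q) \<partial>count_space UNIV) \<le> ennreal K * I"
  proof (cases "I = \<infinity>")
    case True
    then show ?thesis using K by (simp add: ennreal_mult_top)
  next
    case False
    define E where "E j = {x. M x > ennreal (2 powr of_int j)}" for j :: int
    have [measurable]: "E j \<in> sets borel" for j unfolding E_def by measurable
    \<comment> \<open>Chebyshev's inequality; with \<open>I\<close> finite it gives every level set
      finite measure.\<close>
    have EI: "ennreal ((2 powr of_int j) powr p) * emeasure lborel (E j) \<le> I" for j
    proof -
      have "ennreal ((2 powr of_int j) powr p) * emeasure lborel (E j) = (\<integral>\<^sup>+x. ennreal ((2 powr of_int j) powr p) * indicator (E j) x \<partial>lborel)"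
        by (subst nn_integral_cmult_indicator) auto
      also have "\<dots> \<le> I"
        unfolding I_def using p by (intro nn_integral_mono) (auto simp: E_def indicator_def intro!: epowr_ge[OF _ _ less_imp_le])
      finally show ?thesis .
    qed
    define \<mu> where "\<mu> j = measure lborel (E j)" for j
    have E\<mu>: "emeasure lborel (E j) = ennreal (\<mu> j)" for j
    proof -
      have "emeasure lborel (E j) \<noteq> \<infinity>"
        using EI[of j] False by (auto simp: ennreal_mult_top top_unique)
      then show ?thesis unfolding \<mu>_def by (intro emeasure_eq_ennreal_measure) simp
    qed
    have \<mu>0: "\<mu> j \<ge> 0" for j by (simp add: \<mu>_def)
    \<comment> \<open>A level set of measure at most \<open>c k\<close> makes \<open>sup\<close>
      applicable at frequency \<open>k\<close>; \<open>J k\<close> collects the heights where the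
      level set is too large for that.\<close>
    define c where "c k = 2 powr (- of_int k * \<delta>) / (2 * D)" for k :: int
    define J where "J k = {j. c k < \<mu> j}" for k
    have G2: "ennreal ((G k x)\<^sup>2) \<le> (\<integral>\<^sup>+j. ennreal (16 * A\<^sup>2 * 2 powr (2 * of_int j)) * indicator (J k) j * indicator (E j) x \<partial>count_space UNIV)"
      (is "_ \<le> (\<integral>\<^sup>+j. ?f j \<partial>_)") for k x
    proof (cases "G k x = 0")
      case False
      then have v: "G k x > 0" using G(2)[of k x] by simp
      define y where "y = G k x / (2 * A)"
      have y: "y > 0" "G k x = 2 * A * y" using v A by (auto simp: y_def)
      \<comment> \<open>The rounding gives \<open>2 powr j < y \<le> 2 * 2 powr j\<close>. The
        inequality on the left must be strict: if \<open>j\<close> were outside \<open>J k\<close>,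
        then \<open>sup\<close> would give \<open>y \<le> 2 powr j\<close>.\<close>
      define j where "j = \<lceil>log 2 y\<rceil> - 1"
      have "of_int j < log 2 y" "log 2 y \<le> of_int j + 1" unfolding j_def by linarith+
      then have j: "2 powr of_int j < y" "y \<le> 2 * 2 powr of_int j"
        using y(1) by (auto simp: less_log_iff log_le_iff powr_add mult.commute)
      have "j \<in> J k"
      proof (rule ccontr)
        assume "j \<notin> J k"
        then have "emeasure lborel {x. M x > ennreal (2 powr of_int j)} \<le> ennreal (2 powr (- of_int k * \<delta>) / (2 * D))"
          using E\<mu>[of j] by (simp add: J_def c_def E_def not_less ennreal_leI)
        from sup[OF _ this, of x] have "G k x \<le> 2 * A * 2 powr of_int j" by simp
        then show False using j(1) y A by (simp add: not_le[symmetric])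
      qed
      moreover have "x \<in> E j"
      proof -
        have "2 powr of_int j < G k x"
        proof -
          have "1 * y \<le> (2 * A) * y" using A y by (intro mult_right_mono) auto
          then show ?thesis using j(1) y(2) by simp
        qed
        then have "ennreal (2 powr of_int j) < ennreal (G k x)" using v by (simp add: ennreal_less_iff)
        then show ?thesis unfolding E_def using GM[of k x] by (auto intro: less_le_trans)
      qed
      moreover have "(G k x)\<^sup>2 \<le> 16 * A\<^sup>2 * 2 powr (2 * of_int j)"
      proof -
        have "(G k x)\<^sup>2 = 4 * A\<^sup>2 * y\<^sup>2" unfolding y(2) by (simp add: power_mult_distrib)
        also have "\<dots> \<le> 4 * A\<^sup>2 * (2 * 2 powr of_int j)\<^sup>2" using y j by (intro mult_left_mono power_mono) auto
        also have "\<dots> = 16 * A\<^sup>2 * 2 powr (2 * of_int j)"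
          by (simp add: power_mult_distrib power2_eq_square powr_add[symmetric])
        finally show ?thesis .
      qed
      ultimately have "ennreal ((G k x)\<^sup>2) \<le> ?f j" by (simp add: ennreal_leI)
      also have "\<dots> \<le> (\<integral>\<^sup>+j. ?f j \<partial>count_space UNIV)" by (rule nn_integral_ge_point) simp
      finally show ?thesis .
    qed simp
    \<comment> \<open>The term of height \<open>j\<close> in the bound \<open>G2\<close>, integrated
      in \<open>x\<close>.\<close>
    define a where "a k j = 16 * A\<^sup>2 * 2 powr (2 * of_int j) * indicator (J k) j * \<mu> j" for k j
    have a0: "a k j \<ge> 0" for k j unfolding a_def using \<mu>0 by (auto simp: indicator_def)
    have Na: "ennreal (N k) \<le> (\<integral>\<^sup>+j. ennreal (a k j) \<partial>count_space UNIV)" for k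
    proof -
      have "ennreal (N k) \<le> (\<integral>\<^sup>+x. (\<integral>\<^sup>+j. ennreal (16 * A\<^sup>2 * 2 powr (2 * of_int j)) * indicator (J k) j * indicator (E j) x \<partial>count_space UNIV) \<partial>lborel)"
        by (rule order_trans[OF N(2)]) (intro nn_integral_mono G2)
      also have "\<dots> = (\<integral>\<^sup>+j. (\<integral>\<^sup>+x. ennreal (16 * A\<^sup>2 * 2 powr (2 * of_int j)) * indicator (J k) j * indicator (E j) x \<partial>lborel) \<partial>count_space UNIV)"
        by (rule nn_integral_count_space_nn_integral) auto
      also have "\<dots> = (\<integral>\<^sup>+j. ennreal (a k j) \<partial>count_space UNIV)"
      proof (rule nn_integral_cong)
        fix j
        have "(\<integral>\<^sup>+x. ennreal (16 * A\<^sup>2 * 2 powr (2 * of_int j)) * indicator (J k) j * indicator (E j) x \<partial>lborel)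
            = ennreal (16 * A\<^sup>2 * 2 powr (2 * of_int j)) * indicator (J k) j * ennreal (\<mu> j)"
          by (subst nn_integral_cmult_indicator) (auto simp: E\<mu>)
        also have "\<dots> = ennreal (a k j)"
          unfolding a_def using \<mu>0[of j] by (cases "j \<in> J k") (simp_all add: ennreal_mult)
        finally show "(\<integral>\<^sup>+x. ennreal (16 * A\<^sup>2 * 2 powr (2 * of_int j)) * indicator (J k) j * indicator (E j) x \<partial>lborel) = ennreal (a k j)" .
      qed
      finally show ?thesis .
    qed
    define b where "b j = (16 * A\<^sup>2) powr q * 2 powr (of_int j * p) * \<mu> j powr q" for j :: int
    have b0: "b j \<ge> 0" for j unfolding b_def by simp
    have apow: "a k j powr q = b j * indicator (J k) j" for k j
    proof (cases "j \<in> J k")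
      case True
      then have "a k j powr q = (16 * A\<^sup>2) powr q * (2 powr (2 * of_int j)) powr q * \<mu> j powr q"
        unfolding a_def using \<mu>0[of j] by (simp add: powr_mult)
      also have "(2 powr (2 * of_int j)) powr q = 2 powr (of_int j * p)" by (simp add: powr_powr q_def)
      finally show ?thesis using True by (simp add: b_def)
    qed (simp add: a_def)
    have "(\<integral>\<^sup>+k. ennreal (2 powr (- of_int k * \<beta>) * N k powr q) \<partial>count_space UNIV)
       \<le> (\<integral>\<^sup>+k. (\<integral>\<^sup>+j. ennreal (2 powr (- of_int k * \<beta>)) * (ennreal (b j) * indicator (J k) j) \<partial>count_space UNIV) \<partial>count_space UNIV)"
    proof (rule nn_integral_mono)
      fix k
      have "ennreal (2 powr (- of_int k * \<beta>) * N k powr q) = ennreal (2 powr (- of_int k * \<beta>)) * ennreal (N k powr q)"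
        by (simp add: ennreal_mult)
      also have "\<dots> \<le> ennreal (2 powr (- of_int k * \<beta>)) * (\<integral>\<^sup>+j. ennreal (a k j powr q) \<partial>count_space UNIV)"
        using q by (intro mult_left_mono powr_subadditive[OF _ _ a0 N(1) Na]) auto
      also have "\<dots> = (\<integral>\<^sup>+j. ennreal (2 powr (- of_int k * \<beta>)) * ennreal (a k j powr q) \<partial>count_space UNIV)"
        by (subst nn_integral_cmult) auto
      also have "\<dots> = (\<integral>\<^sup>+j. ennreal (2 powr (- of_int k * \<beta>)) * (ennreal (b j) * indicator (J k) j) \<partial>count_space UNIV)"
        unfolding apow by (intro nn_integral_cong) (auto simp: indicator_def)
      finally show "ennreal (2 powr (- of_int k * \<beta>) * N k powr q) \<le> (\<integral>\<^sup>+j. ennreal (2 powr (- of_int k * \<beta>)) * (ennreal (b j) * indicator (J k) j) \<partial>count_space UNIV)" .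
    qed
    also have "\<dots> = (\<integral>\<^sup>+j. (\<integral>\<^sup>+k. ennreal (2 powr (- of_int k * \<beta>)) * (ennreal (b j) * indicator (J k) j) \<partial>count_space UNIV) \<partial>count_space UNIV)"
      by (rule nn_integral_count_space_nn_integral) auto
    also have "\<dots> \<le> (\<integral>\<^sup>+j. ennreal K1 * ennreal (2 powr (of_int j * p) * \<mu> j) \<partial>count_space UNIV)"
    proof (rule nn_integral_mono)
      fix j
      \<comment> \<open>Membership of \<open>j\<close> in \<open>J k\<close> is a lower bound for
        \<open>\<mu> j\<close>; raised to the power \<open>1 - q\<close> it reads
        \<open>2 powr (- k * \<beta>) < T\<close>. So the sum over \<open>k\<close> at a fixed
        height costs a multiple of \<open>T\<close>.\<close>
      define T where "T = (2 * D * \<mu> j) powr (1 - q)"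
      have JT: "j \<in> J k \<Longrightarrow> 2 powr (- of_int k * \<beta>) < T" for k
      proof -
        assume "j \<in> J k"
        then have "2 powr (- of_int k * \<delta>) < 2 * D * \<mu> j" using D by (simp add: J_def c_def field_simps)
        then have "(2 powr (- of_int k * \<delta>)) powr (1 - q) < T" unfolding T_def using q by (intro powr_less_mono2) auto
        then show ?thesis by (simp add: powr_powr \<beta>_def mult.assoc)
      qed
      have "(\<integral>\<^sup>+k. ennreal (2 powr (- of_int k * \<beta>)) * (ennreal (b j) * indicator (J k) j) \<partial>count_space UNIV)
         \<le> (\<integral>\<^sup>+k. ennreal (b j) * (ennreal (2 powr (- of_int k * \<beta>)) * indicator {k. 2 powr (- of_int k * \<beta>) < T} k) \<partial>count_space UNIV)"
        using JT by (intro nn_integral_mono) (auto simp: indicator_def mult.commute)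
      also have "\<dots> = ennreal (b j) * (\<integral>\<^sup>+k. ennreal (2 powr (- of_int k * \<beta>)) * indicator {k. 2 powr (- of_int k * \<beta>) < T} k \<partial>count_space UNIV)"
        by (subst nn_integral_cmult) auto
      also have "\<dots> \<le> ennreal (b j) * ennreal (T / (1 - 2 powr (- \<beta>)))"
        by (intro mult_left_mono nn_integral_int_geometric \<beta>) simp
      also have "\<dots> = ennreal (K1 * (2 powr (of_int j * p) * \<mu> j))"
      proof -
        \<comment> \<open>The power \<open>q\<close> stems from subadditivity and
          \<open>1 - q\<close> from the sum over frequencies. Together they restore the measure to
          the first power, which is what the sum over heights needs.\<close>
        have "\<mu> j powr q * T = (2 * D) powr (1 - q) * \<mu> j"
        proof (cases "\<mu> j = 0")
          case False
          then have "\<mu> j > 0" using \<mu>0[of j] by simp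
          then have "\<mu> j powr q * T = (2 * D) powr (1 - q) * (\<mu> j powr q * \<mu> j powr (1 - q))"
            unfolding T_def using D by (simp add: powr_mult)
          also have "\<mu> j powr q * \<mu> j powr (1 - q) = \<mu> j" using \<open>\<mu> j > 0\<close> by (simp flip: powr_add)
          finally show ?thesis .
        qed simp
        then have "b j * (T / (1 - 2 powr (- \<beta>))) = K1 * (2 powr (of_int j * p) * \<mu> j)"
          unfolding b_def K1_def by (simp add: field_simps)
        then show ?thesis using b0[of j] g1 by (simp add: T_def flip: ennreal_mult)
      qed
      also have "\<dots> = ennreal K1 * ennreal (2 powr (of_int j * p) * \<mu> j)" using K1 \<mu>0[of j] by (intro ennreal_mult) auto
      finally show "(\<integral>\<^sup>+k. ennreal (2 powr (- of_int k * \<beta>)) * (ennreal (b j) * indicator (J k) j) \<partial>count_space UNIV) \<le> ennreal K1 * ennreal (2 powr (of_int j * p) * \<mu> j)" .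
    qed
    also have "\<dots> = ennreal K1 * (\<integral>\<^sup>+j. ennreal (2 powr (of_int j * p) * \<mu> j) \<partial>count_space UNIV)"
      by (subst nn_integral_cmult) auto
    also have "(\<integral>\<^sup>+j. ennreal (2 powr (of_int j * p) * \<mu> j) \<partial>count_space UNIV)
        = (\<integral>\<^sup>+j. (\<integral>\<^sup>+x. ennreal (2 powr (of_int j * p)) * indicator (E j) x \<partial>lborel) \<partial>count_space UNIV)"
    proof (rule nn_integral_cong)
      fix j
      show "ennreal (2 powr (of_int j * p) * \<mu> j) = (\<integral>\<^sup>+x. ennreal (2 powr (of_int j * p)) * indicator (E j) x \<partial>lborel)"
        using \<mu>0[of j] by (subst nn_integral_cmult_indicator) (auto simp: E\<mu> ennreal_mult)
    qed
    also have "\<dots> = (\<integral>\<^sup>+x. (\<integral>\<^sup>+j. ennreal (2 powr (of_int j * p)) * indicator (E j) x \<partial>count_space UNIV) \<partial>lborel)"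
      by (rule nn_integral_count_space_nn_integral[symmetric]) auto
    \<comment> \<open>A discrete layer-cake estimate: at a given point, the powers of the dyadic
      heights below \<open>M x\<close> form a geometric series dominated by its largest
      term.\<close>
    also have "\<dots> \<le> (\<integral>\<^sup>+x. ennreal (1 / (1 - 2 powr (- p))) * epowr (M x) p \<partial>lborel)"
    proof (rule nn_integral_mono)
      fix x
      show "(\<integral>\<^sup>+j. ennreal (2 powr (of_int j * p)) * indicator (E j) x \<partial>count_space UNIV) \<le> ennreal (1 / (1 - 2 powr (- p))) * epowr (M x) p"
      proof (cases "M x = \<infinity>")
        case True
        then show ?thesis using g1 p by (simp add: epowr_def ennreal_mult_top)
      next
        case False
        then obtain t where t: "t \<ge> 0" "M x = ennreal t" by (cases "M x") auto
        \<comment> \<open>Reflecting the index gives the decreasing powers in which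
          \<open>nn_integral_int_geometric\<close> is stated.\<close>
        have bij: "bij_betw (\<lambda>k::int. - k) UNIV UNIV" by (rule bij_betw_byWitness[where f' = uminus]) auto
        have "(\<integral>\<^sup>+j. ennreal (2 powr (of_int j * p)) * indicator (E j) x \<partial>count_space UNIV)
            = (\<integral>\<^sup>+k. ennreal (2 powr (of_int (- k) * p)) * indicator (E (- k)) x \<partial>count_space UNIV)"
          by (rule nn_integral_bij_count_space[OF bij, symmetric])
        also have "\<dots> \<le> (\<integral>\<^sup>+k. ennreal (2 powr (- of_int k * p)) * indicator {k. 2 powr (- of_int k * p) < t powr p} k \<partial>count_space UNIV)"
        proof (rule nn_integral_mono)
          fix k :: int
          have "2 powr (- of_int k * p) < t powr p" if "x \<in> E (- k)"
          proof -
            have "2 powr (- of_int k) < t" using that t by (simp add: E_def ennreal_less_iff)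
            then have "(2 powr (- of_int k)) powr p < t powr p" using p by (intro powr_less_mono2) auto
            then show ?thesis by (simp add: powr_powr)
          qed
          then show "ennreal (2 powr (of_int (- k) * p)) * indicator (E (- k)) x
             \<le> ennreal (2 powr (- of_int k * p)) * indicator {k. 2 powr (- of_int k * p) < t powr p} k"
            by (auto simp: indicator_def)
        qed
        also have "\<dots> \<le> ennreal (t powr p / (1 - 2 powr (- p)))" by (rule nn_integral_int_geometric) (use p in simp)
        also have "\<dots> = ennreal (1 / (1 - 2 powr (- p))) * epowr (M x) p"
          using g1 unfolding t(2) epowr_ennreal[OF t(1)] by (subst ennreal_mult[symmetric]) auto
        finally show ?thesis .
      qed
    qed
    also have "\<dots> = ennreal (1 / (1 - 2 powr (- p))) * I"
      unfolding I_def by (intro nn_integral_cmult) measurable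
    finally have "(\<integral>\<^sup>+k. ennreal (2 powr (- of_int k * \<beta>) * N k powr q) \<partial>count_space UNIV)
        \<le> ennreal K1 * (ennreal (1 / (1 - 2 powr (- p))) * I)" by (simp add: mult_left_mono)
    also have "\<dots> = ennreal K * I"
      unfolding K_def using K1 g1 by (simp add: mult.assoc[symmetric] ennreal_mult[symmetric])
    finally show ?thesis .
  qed
  then show ?thesis unfolding jawerth_const_def K_def K1_def I_def \<beta>_def q_def .
qed

text \<open>Hoelder on a set of finite measure, by splitting at the height \<open>T\<close>: below
  it the measure of \<open>E\<close> is used, above it the square integral. With
  \<open>T\<^sup>2 = H / m\<close> the two contributions coincide, whence the factor 2; for
  \<open>H = 0\<close> the splitting height would vanish, so that case is treated apart.\<close>

lemma nn_integral_powr_le_L2: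
  fixes h :: "'a::euclidean_space \<Rightarrow> real"
  assumes p: "0 < p" "p < 2" and [measurable]: "h \<in> borel_measurable lborel" "E \<in> sets lborel" and h0: "\<And>x. h x \<ge> 0"
    and m: "emeasure lborel E \<le> ennreal m" "m > 0" and H: "(\<integral>\<^sup>+x. ennreal ((h x)\<^sup>2) \<partial>lborel) \<le> ennreal H" "H \<ge> 0"
  shows "(\<integral>\<^sup>+x. ennreal (h x powr p) * indicator E x \<partial>lborel) \<le> ennreal (2 * m powr (1 - p / 2) * H powr (p / 2))"
proof (cases "H = 0")
  case True
  then have "(\<integral>\<^sup>+x. ennreal ((h x)\<^sup>2) \<partial>lborel) = 0" using H by simp
  then have "AE x in lborel. ennreal ((h x)\<^sup>2) = 0" by (subst (asm) nn_integral_0_iff_AE) auto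
  then have "AE x in lborel. h x = 0" by simp
  then have "(\<integral>\<^sup>+x. ennreal (h x powr p) * indicator E x \<partial>lborel) = integral\<^sup>N (lborel :: 'a measure) (\<lambda>x. 0)"
    by (intro nn_integral_cong_AE) auto
  then show ?thesis by simp
next
  case False
  then have H0: "H > 0" using H by simp
  define T where "T = sqrt (H / m)"
  have T: "T > 0" "T\<^sup>2 = H / m" unfolding T_def using H0 m by auto
  have pt: "h x powr p \<le> T powr p + T powr (p - 2) * (h x)\<^sup>2" for x
  proof (cases "h x \<le> T")
    case True
    then have "h x powr p \<le> T powr p" using h0 p by (intro powr_mono2) auto
    then show ?thesis by (simp add: add_increasing2)
  next
    case False
    then have hx: "h x > T" "h x > 0" using T by auto
    have "h x powr p = h x powr (p - 2) * (h x)\<^sup>2" using hx by (simp add: powr_diff)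
    also have "\<dots> \<le> T powr (p - 2) * (h x)\<^sup>2" using hx T p by (intro mult_right_mono powr_mono2') auto
    finally show ?thesis by (simp add: add_increasing)
  qed
  have "(\<integral>\<^sup>+x. ennreal (h x powr p) * indicator E x \<partial>lborel)
     \<le> (\<integral>\<^sup>+x. ennreal (T powr p) * indicator E x + ennreal (T powr (p - 2)) * ennreal ((h x)\<^sup>2) \<partial>lborel)"
    using pt by (intro nn_integral_mono) (auto simp: indicator_def ennreal_leI simp flip: ennreal_mult ennreal_plus)
  also have "\<dots> = ennreal (T powr p) * emeasure lborel E + ennreal (T powr (p - 2)) * (\<integral>\<^sup>+x. ennreal ((h x)\<^sup>2) \<partial>lborel)"
    using assms(4) by (subst nn_integral_add) (auto simp: nn_integral_cmult nn_integral_cmult_indicator)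
  also have "\<dots> \<le> ennreal (T powr p) * ennreal m + ennreal (T powr (p - 2)) * ennreal H"
    by (intro add_mono mult_left_mono m H) auto
  also have "\<dots> = ennreal (T powr p * m + T powr (p - 2) * H)" using m H by (simp flip: ennreal_mult ennreal_plus)
  also have "T powr p * m + T powr (p - 2) * H = 2 * m powr (1 - p / 2) * H powr (p / 2)"
  proof -
    have Tq: "T powr a = (H / m) powr (a / 2)" for a
      unfolding T_def using H0 m by (simp add: powr_half_sqrt[symmetric] powr_powr)
    have "T powr p * m = m powr (1 - p / 2) * H powr (p / 2)"
      unfolding Tq using H0 m by (simp add: powr_divide powr_diff)
    moreover have "T powr (p - 2) * H = m powr (1 - p / 2) * H powr (p / 2)"
    proof -
      have e: "(p - 2) / 2 = p / 2 - 1" by simp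
      show ?thesis unfolding Tq e using H0 m by (simp add: powr_divide powr_diff)
    qed
    ultimately show ?thesis by simp
  qed
  finally show ?thesis .
qed

subsection \<open>Functions determined by their pairing with Schwartz functions\<close>

text \<open>Closed sets are exhausted by compact ones, and Borel sets follow by Dynkin's argument
  because the closed sets form an intersection-stable generator. A density whose integral over every
  Borel set is 0 vanishes almost everywhere.\<close>

lemma integral_compact_eq_0_imp_AE:
  fixes H :: "'a::euclidean_space \<Rightarrow> complex"
  assumes H: "integrable lborel H" and K: "\<And>K. compact K \<Longrightarrow> (\<integral>x. indicator K x *\<^sub>R H x \<partial>lborel) = 0"
  shows "AE x in lborel. H x = 0"
proof -
  have ii: "integrable lborel (\<lambda>x. indicator A x *\<^sub>R H x)" if "A \<in> sets borel" for A
    using integrable_mult_indicator[OF _ H, of A] that by simp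
  have closed0: "(\<integral>x. indicator C x *\<^sub>R H x \<partial>lborel) = 0" if C: "closed C" for C
  proof -
    have [measurable]: "C \<in> sets borel" using C by simp
    have [measurable]: "H \<in> borel_measurable borel" using H by auto
    have "(\<lambda>n. \<integral>x. indicator (C \<inter> cball 0 (real n)) x *\<^sub>R H x \<partial>lborel) \<longlonglongrightarrow> (\<integral>x. indicator C x *\<^sub>R H x \<partial>lborel)"
    proof (rule integral_dominated_convergence[where w = "\<lambda>x. norm (H x)"])
      show "AE x in lborel. (\<lambda>n. indicator (C \<inter> cball 0 (real n)) x *\<^sub>R H x) \<longlonglongrightarrow> indicator C x *\<^sub>R H x"
      proof (intro always_eventually allI)
        fix x :: 'a
        obtain N :: nat where "norm x \<le> N" using real_arch_simple by blast
        then have "\<forall>\<^sub>F n in sequentially. indicator (C \<inter> cball 0 (real n)) x *\<^sub>R H x = indicator C x *\<^sub>R H x"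
          by (intro eventually_sequentiallyI[of N]) (auto simp: indicator_def)
        then show "(\<lambda>n. indicator (C \<inter> cball 0 (real n)) x *\<^sub>R H x) \<longlonglongrightarrow> indicator C x *\<^sub>R H x" by (rule tendsto_eventually)
      qed
    qed (use H in \<open>auto simp: indicator_def\<close>)
    moreover have "(\<integral>x. indicator (C \<inter> cball 0 (real n)) x *\<^sub>R H x \<partial>lborel) = 0" for n
      by (intro K closed_Int_compact C compact_cball)
    ultimately show ?thesis by (simp add: LIMSEQ_const_iff)
  qed
  have all: "(\<integral>x. indicator A x *\<^sub>R H x \<partial>lborel) = 0" if "A \<in> sets borel" for A
  proof -
    have sig: "sigma_sets UNIV (Collect closed) = sets (borel :: 'a measure)"
      by (simp add: borel_eq_closed)
    have "Int_stable (Collect closed :: 'a set set)" by (auto simp: Int_stable_def)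
    moreover have "Collect closed \<subseteq> Pow (UNIV :: 'a set)" by simp
    moreover have "A \<in> sigma_sets UNIV (Collect closed)" using that sig by simp
    ultimately show ?thesis
    proof (induction A rule: sigma_sets_induct_disjoint)
      case (compl A)
      have A: "A \<in> sets borel" using compl sig by simp
      have "(\<integral>x. indicator (UNIV - A) x *\<^sub>R H x \<partial>lborel) = (\<integral>x. indicator UNIV x *\<^sub>R H x - indicator A x *\<^sub>R H x \<partial>lborel)"
        by (intro Bochner_Integration.integral_cong) (auto simp: indicator_def)
      also have "\<dots> = (\<integral>x. indicator UNIV x *\<^sub>R H x \<partial>lborel) - (\<integral>x. indicator A x *\<^sub>R H x \<partial>lborel)"
        by (intro Bochner_Integration.integral_diff ii A) simp
      also have "\<dots> = 0" using compl closed0[of UNIV] by simp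
      finally show ?case .
    next
      case (union A)
      have A: "A i \<in> sets lborel" for i using union sig by auto
      have "set_lebesgue_integral lborel (\<Union>i. A i) H = (\<Sum>i. set_lebesgue_integral lborel (A i) H)"
      proof (rule lebesgue_integral_countable_add)
        show "set_integrable lborel (\<Union>i. A i) H" unfolding set_integrable_def by (rule ii) (use A in auto)
        show "A i \<inter> A j = {}" if "i \<noteq> j" for i j using union that by (auto simp: disjoint_family_on_def)
      qed (use A in auto)
      then show ?case using union by (simp add: set_lebesgue_integral_def)
    qed (use closed0 in auto)
  qed
  show ?thesis
    by (rule sigma_finite_measure.density_zero[OF sigma_finite_lborel H]) (use all in \<open>simp add: set_lebesgue_integral_def\<close>)
qed

context lp_gen
begin

lemma integral_bump_nonzero: "(\<integral>x. bump x \<partial>lborel) \<noteq> 0"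
proof -
  have bi: "integrable lborel bump" by (intro schwartz_integrable bump_schwartz)
  have "0 < measure lborel (cball (0::'a) 1)" by (simp add: content_cball_pos)
  also have "\<dots> = (\<integral>x. indicator (cball (0::'a) 1) x \<partial>lborel)" by simp
  also have "\<dots> \<le> (\<integral>x. Re (bump x) \<partial>lborel)"
  proof (rule integral_mono)
    show "indicator (cball 0 1) x \<le> Re (bump x)" for x
      using bump_1[of x] bump_range[of x] by (auto simp: indicator_def)
  qed (use bi emeasure_lborel_cball_finite[of "0::'a" 1] in auto)
  also have "\<dots> = Re (\<integral>x. bump x \<partial>lborel)" using bi by (rule integral_Re)
  finally show ?thesis by auto
qed

text \<open>The indicator of the \<open>2 * t\<close>-neighbourhood of \<open>K\<close> is averaged
  against the normalised \<open>cutoff t\<close>, which vanishes beyond radius \<open>2 * t\<close>: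
  hence the value 1 on \<open>K\<close> and 0 beyond distance \<open>4 * t\<close>. By scaling, the
  bound depends neither on \<open>t\<close> nor on \<open>K\<close>, as dominated convergence will
  require.\<close>

lemma compact_mollify:
  fixes K :: "'a set"
  assumes K: "compact K" "K \<noteq> {}" and t: "t > 0"
  obtains \<psi> where "\<psi> \<in> schwartz" "\<And>y. y \<in> K \<Longrightarrow> \<psi> y = 1" "\<And>y. infdist y K > 4 * t \<Longrightarrow> \<psi> y = 0"
    "\<And>y. norm (\<psi> y) \<le> (\<integral>x. norm (bump x) \<partial>lborel) / norm (\<integral>x. bump x \<partial>lborel)"
proof -
  define U where "U = {x. infdist x K \<le> 2 * t}"
  have Ucl: "compact U" unfolding U_def using K t by (intro compact_infdist_le) auto
  then obtain r where "\<forall>x\<in>U. norm x \<le> r" using compact_imp_bounded bounded_iff by blast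
  then have r: "U \<subseteq> cball 0 r" by auto
  have [measurable]: "U \<in> sets borel" using Ucl by (simp add: compact_imp_closed)
  have [measurable]: "bump \<in> borel_measurable borel" by (intro schwartz_measurable bump_schwartz)
  have cm [measurable]: "cutoff t \<in> borel_measurable borel" by (intro schwartz_measurable cutoff_schwartz t)
  define h :: "'a \<Rightarrow> complex" where "h = indicator U"
  \<comment> \<open>Displaying the indicator as its own truncation to a ball puts it in the form of
    \<open>moments_cutoff\<close>.\<close>
  have h_eq: "h = (\<lambda>x. indicator (cball 0 r) x * h x)" using r by (auto simp: h_def indicator_def fun_eq_iff)
  have hm: "h \<in> borel_measurable borel" unfolding h_def by measurable
  have mom: "moments h" by (subst h_eq, rule moments_cutoff[of _ 1, OF hm]) (simp add: h_def indicator_def)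
  define c where "c = (\<integral>x. bump x \<partial>lborel)"
  define w where "w = t ^ DIM('a)"
  have w: "w > 0" using t by (simp add: w_def)
  have c0: "c \<noteq> 0" unfolding c_def by (rule integral_bump_nonzero)
  have ci: "(\<integral>x. cutoff t (x - y) \<partial>lborel) = of_real w * c" for y
  proof -
    have "(\<integral>x. cutoff t (x - y) \<partial>lborel) = (\<integral>x. cutoff t x \<partial>lborel)"
      using integral_translate[OF cm, of "- y"] by simp
    also have "\<dots> = of_real w * c" unfolding cutoff_def c_def w_def
      using t by (subst integral_affine[where c = t and a = 0]) (auto simp: scaleR_conv_of_real)
    finally show ?thesis .
  qed
  have cn: "(\<integral>x. norm (cutoff t (x - y)) \<partial>lborel) = w * (\<integral>x. norm (bump x) \<partial>lborel)" for y
  proof -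
    have "(\<integral>x. norm (cutoff t (x - y)) \<partial>lborel) = (\<integral>x. norm (cutoff t x) \<partial>lborel)"
      using integral_translate[of "\<lambda>x. norm (cutoff t x)" "- y"] by simp
    also have "\<dots> = w * (\<integral>x. norm (bump x) \<partial>lborel)" unfolding cutoff_def w_def
      using t by (subst integral_affine[where c = t and a = 0]) auto
    finally show ?thesis .
  qed
  have far: "cutoff t (x - y) = 0" if "dist x y \<ge> 2 * t" for x y using that t by (intro cutoff_0) (auto simp: dist_norm)
  define \<psi> where "\<psi> y = 1 / (of_real w * c) * superpose (\<lambda>x. x) h (cutoff t) y" for y
  show ?thesis
  proof
    show "\<psi> \<in> schwartz"
      unfolding \<psi>_def by (intro schwartz_cmult superpose_schwartz cutoff_schwartz t mom) auto
    show "\<psi> y = 1" if y: "y \<in> K" for y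
    proof -
      have eq: "cutoff t (x - y) * h x = cutoff t (x - y)" for x
      proof (cases "dist x y \<ge> 2 * t")
        case False
        then have "x \<in> U" unfolding U_def using infdist_le[OF y, of x] by simp
        then show ?thesis by (simp add: h_def)
      qed (simp add: far)
      show ?thesis unfolding \<psi>_def superpose_def eq ci using c0 w by simp
    qed
    show "\<psi> y = 0" if y: "infdist y K > 4 * t" for y
    proof -
      have eq: "cutoff t (x - y) * h x = 0" for x
      proof (cases "dist x y \<ge> 2 * t")
        case False
        then have "x \<notin> U" using y infdist_triangle[of y K x] by (auto simp: U_def dist_commute)
        then show ?thesis by (simp add: h_def)
      qed (simp add: far)
      show ?thesis unfolding \<psi>_def superpose_def eq by simp
    qed
    show "norm (\<psi> y) \<le> (\<integral>x. norm (bump x) \<partial>lborel) / norm (\<integral>x. bump x \<partial>lborel)" for y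
    proof -
      have i: "integrable lborel (\<lambda>x. norm (cutoff t (x - y)))"
        using schwartz_affine[OF cutoff_schwartz[OF t], of 1 "- y"] by (intro integrable_norm schwartz_integrable) simp
      have "norm (superpose (\<lambda>x. x) h (cutoff t) y) \<le> (\<integral>x. norm (cutoff t (x - y) * h x) \<partial>lborel)"
        unfolding superpose_def by (rule integral_norm_bound)
      also have "\<dots> \<le> (\<integral>x. norm (cutoff t (x - y)) \<partial>lborel)"
        by (rule integral_mono'[OF i]) (auto simp: norm_mult h_def indicator_def)
      finally have "norm (superpose (\<lambda>x. x) h (cutoff t) y) \<le> w * (\<integral>x. norm (bump x) \<partial>lborel)" unfolding cn .
      then show ?thesis unfolding \<psi>_def c_def[symmetric] using w c0 by (simp add: norm_mult norm_divide field_simps)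
    qed
  qed
qed

text \<open>The mollified indicators of a compact set tend pointwise to the indicator under the
  uniform bound \<open>L\<close>, so the vanishing pairings pass to the integral of \<open>H\<close>
  over the set.\<close>

lemma AE_eq_0_if_schwartz_pairing_0:
  fixes H :: "'a \<Rightarrow> complex"
  assumes H: "integrable lborel H" and pair: "\<And>\<psi>. \<psi> \<in> schwartz \<Longrightarrow> (\<integral>x. H x * \<psi> x \<partial>lborel) = 0"
  shows "AE x in lborel. H x = 0"
proof (rule integral_compact_eq_0_imp_AE[OF H])
  fix K :: "'a set" assume K: "compact K"
  show "(\<integral>x. indicator K x *\<^sub>R H x \<partial>lborel) = 0"
  proof (cases "K = {}")
    case False
    define L where "L = (\<integral>x. norm (bump x) \<partial>lborel) / norm (\<integral>x. bump x \<partial>lborel)"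
    let ?t = "\<lambda>n. 1 / real (Suc n)"
    have "\<exists>\<psi>. \<psi> \<in> schwartz \<and> (\<forall>y\<in>K. \<psi> y = 1) \<and> (\<forall>y. infdist y K > 4 * ?t n \<longrightarrow> \<psi> y = 0) \<and> (\<forall>y. norm (\<psi> y) \<le> L)" for n
      using compact_mollify[OF K False, of "?t n"] unfolding L_def by (metis of_nat_0_less_iff zero_less_Suc zero_less_divide_1_iff)
    then have "\<exists>\<psi>. \<forall>n. \<psi> n \<in> schwartz \<and> (\<forall>y\<in>K. \<psi> n y = 1) \<and> (\<forall>y. infdist y K > 4 * ?t n \<longrightarrow> \<psi> n y = 0) \<and> (\<forall>y. norm (\<psi> n y) \<le> L)"
      by (intro choice allI)
    then obtain \<psi> where \<psi>: "\<And>n. \<psi> n \<in> schwartz" "\<And>n y. y \<in> K \<Longrightarrow> \<psi> n y = 1"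
        "\<And>n y. infdist y K > 4 * ?t n \<Longrightarrow> \<psi> n y = 0" "\<And>n y. norm (\<psi> n y) \<le> L" by blast
    have [measurable]: "H \<in> borel_measurable borel" "\<psi> n \<in> borel_measurable borel" "K \<in> sets borel" for n
      using H \<psi>(1) K by (auto intro: schwartz_measurable simp: compact_imp_closed)
    have "(\<lambda>n. \<integral>x. H x * \<psi> n x \<partial>lborel) \<longlonglongrightarrow> (\<integral>x. indicator K x *\<^sub>R H x \<partial>lborel)"
    proof (rule integral_dominated_convergence[where w = "\<lambda>x. norm (H x) * L"])
      show "integrable lborel (\<lambda>x. norm (H x) * L)" using H by simp
      show "AE x in lborel. norm (H x * \<psi> n x) \<le> norm (H x) * L" for n
        using \<psi>(4) by (auto simp: norm_mult intro!: mult_left_mono)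
      show "AE x in lborel. (\<lambda>n. H x * \<psi> n x) \<longlonglongrightarrow> indicator K x *\<^sub>R H x"
      proof (intro always_eventually allI)
        fix x :: 'a
        show "(\<lambda>n. H x * \<psi> n x) \<longlonglongrightarrow> indicator K x *\<^sub>R H x"
        proof (cases "x \<in> K")
          case True
          then show ?thesis by (simp add: \<psi>(2))
        next
          case False
          have pos: "infdist x K > 0" using infdist_pos_not_in_closed[OF compact_imp_closed[OF K] \<open>K \<noteq> {}\<close> False] .
          have "(\<lambda>n. 4 * ?t n) \<longlonglongrightarrow> 4 * 0" by (intro tendsto_mult tendsto_const LIMSEQ_Suc[OF lim_1_over_n])
          then have "\<forall>\<^sub>F n in sequentially. 4 * ?t n < infdist x K"
            using pos by (intro order_tendstoD(2)[of _ "4 * 0"]) auto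
          then have "\<forall>\<^sub>F n in sequentially. H x * \<psi> n x = indicator K x *\<^sub>R H x"
            by eventually_elim (use False \<psi>(3) in simp)
          then show ?thesis by (rule tendsto_eventually)
        qed
      qed
    qed measurable
    then show ?thesis by (simp add: pair \<psi>(1) LIMSEQ_const_iff)
  qed simp
qed

text \<open>Near a point other than 0, multiplication by a cutoff supported in \<open>U\<close>
  makes the difference of \<open>g1\<close> and \<open>g2\<close> integrable and orthogonal to all
  Schwartz functions. By Lindelof, countably many of the resulting balls cover the complement of 0,
  and the origin is a null set.\<close>

lemma AE_eq_if_local_pairing_eq:
  fixes g1 g2 :: "'a \<Rightarrow> complex"
  assumes int1: "\<And>\<psi>. \<psi> \<in> schwartz \<Longrightarrow> integrable lborel (\<lambda>x. g1 x * \<psi> x)"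
    and int2: "\<And>\<psi>. \<psi> \<in> schwartz \<Longrightarrow> integrable lborel (\<lambda>x. g2 x * \<psi> x)"
    and loc: "\<And>x. x \<noteq> 0 \<Longrightarrow> \<exists>U. open U \<and> x \<in> U \<and> (\<forall>\<psi>\<in>schwartz. compact (closure {x. \<psi> x \<noteq> 0}) \<and> closure {x. \<psi> x \<noteq> 0} \<subseteq> U \<longrightarrow>
        (\<integral>x. g1 x * \<psi> x \<partial>lborel) = (\<integral>x. g2 x * \<psi> x \<partial>lborel))"
  shows "AE x in lborel. g1 x = g2 x"
proof -
  have "\<exists>e>0. AE y in lborel. y \<in> ball x e \<longrightarrow> g1 y = g2 y" if x: "x \<noteq> 0" for x
  proof -
    obtain U where U: "open U" "x \<in> U" "\<And>\<psi>. \<psi> \<in> schwartz \<Longrightarrow> compact (closure {x. \<psi> x \<noteq> 0}) \<Longrightarrow> closure {x. \<psi> x \<noteq> 0} \<subseteq> U \<Longrightarrow>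
        (\<integral>x. g1 x * \<psi> x \<partial>lborel) = (\<integral>x. g2 x * \<psi> x \<partial>lborel)" using loc[OF x] by blast
    obtain r where r: "r > 0" "cball x r \<subseteq> U" using U open_contains_cball by blast
    \<comment> \<open>The cutoff at scale \<open>e\<close> vanishes from radius
      \<open>2 * e = r\<close> on, so the localisation stays inside
      \<open>cball x r\<close>.\<close>
    define e where "e = r / 2"
    have e: "e > 0" using r by (simp add: e_def)
    define \<eta> where "\<eta> y = cutoff e (y - x)" for y
    have \<eta>: "\<eta> \<in> schwartz" unfolding \<eta>_def[abs_def] using schwartz_affine[OF cutoff_schwartz[OF e], of 1 "- x"] by simp
    have \<eta>1: "\<eta> y = 1" if "y \<in> ball x e" for y
      unfolding \<eta>_def using that e by (intro cutoff_1) (auto simp: dist_norm norm_minus_commute)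
    have \<eta>0: "y \<in> cball x r" if "\<eta> y \<noteq> 0" for y
      using that cutoff_0[OF e, of "y - x"] unfolding \<eta>_def e_def by (cases "norm (y - x) \<le> r") (auto simp: dist_norm norm_minus_commute)
    have "AE y in lborel. (g1 y * \<eta> y - g2 y * \<eta> y) = 0"
    proof (rule AE_eq_0_if_schwartz_pairing_0)
      show "integrable lborel (\<lambda>y. g1 y * \<eta> y - g2 y * \<eta> y)" by (intro Bochner_Integration.integrable_diff int1 int2 \<eta>)
      fix \<psi> :: "'a \<Rightarrow> complex" assume \<psi>: "\<psi> \<in> schwartz"
      have S: "(\<lambda>y. \<eta> y * \<psi> y) \<in> schwartz" by (intro schwartz_mult \<eta> \<psi>)
      have cl: "closure {y. \<eta> y * \<psi> y \<noteq> 0} \<subseteq> cball x r" using \<eta>0 by (intro closure_minimal) auto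
      then have "compact (closure {y. \<eta> y * \<psi> y \<noteq> 0})" using bounded_subset[OF bounded_cball] by (simp add: compact_eq_bounded_closed) blast
      from U(3)[OF S this] cl r have "(\<integral>y. g1 y * (\<eta> y * \<psi> y) \<partial>lborel) = (\<integral>y. g2 y * (\<eta> y * \<psi> y) \<partial>lborel)" by blast
      moreover have "(\<integral>y. g1 y * (\<eta> y * \<psi> y) - g2 y * (\<eta> y * \<psi> y) \<partial>lborel) = (\<integral>y. g1 y * (\<eta> y * \<psi> y) \<partial>lborel) - (\<integral>y. g2 y * (\<eta> y * \<psi> y) \<partial>lborel)"
        by (intro Bochner_Integration.integral_diff int1 int2 S)
      ultimately show "(\<integral>y. (g1 y * \<eta> y - g2 y * \<eta> y) * \<psi> y \<partial>lborel) = 0" by (simp add: left_diff_distrib mult.assoc)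
    qed
    then have "AE y in lborel. y \<in> ball x e \<longrightarrow> g1 y = g2 y"
      by (rule AE_mp) (auto intro!: always_eventually simp: \<eta>1)
    then show ?thesis using e by blast
  qed
  then have "\<exists>e. \<forall>x\<in>-{0}. e x > 0 \<and> (AE y in lborel. y \<in> ball x (e x) \<longrightarrow> g1 y = g2 y)"
    by (intro bchoice ballI) auto
  then obtain e where "\<forall>x\<in>-{0}. e x > 0 \<and> (AE y in lborel. y \<in> ball x (e x) \<longrightarrow> g1 y = g2 y)" by (rule exE)
  then have e: "x \<noteq> 0 \<Longrightarrow> e x > 0" "x \<noteq> 0 \<Longrightarrow> AE y in lborel. y \<in> ball x (e x) \<longrightarrow> g1 y = g2 y" for x by blast+
  obtain F where F: "F \<subseteq> (\<lambda>x. ball x (e x)) ` (-{0})" "countable F" "\<Union>F = \<Union>((\<lambda>x. ball x (e x)) ` (-{0}))"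
    by (rule Lindelof[of "(\<lambda>x. ball x (e x)) ` (-{0})"]) auto
  have "AE y in lborel. \<forall>B\<in>F. y \<in> B \<longrightarrow> g1 y = g2 y"
    unfolding AE_ball_countable[OF F(2)]
  proof
    fix B assume "B \<in> F"
    then obtain x where "x \<noteq> 0" "B = ball x (e x)" using F(1) by auto
    then show "AE y in lborel. y \<in> B \<longrightarrow> g1 y = g2 y" using e(2) by simp
  qed
  then show ?thesis
    using AE_lborel_singleton[of 0]
  proof eventually_elim
    case (elim y)
    have "y \<in> \<Union>F" unfolding F(3) using e(1)[OF elim(2)] elim(2) by (intro UN_I[of y]) auto
    then show "g1 y = g2 y" using elim(1) by blast
  qed
qed

subsection \<open>Fourier transforms of polynomials\<close>

text \<open>Vanishing on a neighbourhood, in contrast to vanishing at the point 0, is inherited by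
  derivatives.\<close>

definition vanishes_near_0 :: "('a \<Rightarrow> complex) \<Rightarrow> bool" where
  "vanishes_near_0 f \<longleftrightarrow> (\<exists>r>0. \<forall>x. norm x < r \<longrightarrow> f x = 0)"

lemma vanishes_near_0_add: "vanishes_near_0 f \<Longrightarrow> vanishes_near_0 g \<Longrightarrow> vanishes_near_0 (\<lambda>x. f x + g x)"
  unfolding vanishes_near_0_def
proof (elim exE conjE)
  fix r s :: real assume "0 < r" "0 < s" "\<forall>x. norm x < r \<longrightarrow> f x = 0" "\<forall>x. norm x < s \<longrightarrow> g x = 0"
  then show "\<exists>r>0. \<forall>x. norm x < r \<longrightarrow> f x + g x = 0" by (intro exI[of _ "min r s"]) auto
qed

lemma vanishes_near_0_cmult: "vanishes_near_0 f \<Longrightarrow> vanishes_near_0 (\<lambda>x. c * f x)"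
  unfolding vanishes_near_0_def by auto

lemma vanishes_near_0_sum:
  "finite I \<Longrightarrow> (\<And>i. i \<in> I \<Longrightarrow> vanishes_near_0 (f i)) \<Longrightarrow> vanishes_near_0 (\<lambda>x. \<Sum>i\<in>I. f i x)"
proof (induction I rule: finite_induct)
  case empty
  then show ?case by (auto simp: vanishes_near_0_def intro: exI[of _ 1])
qed (auto intro: vanishes_near_0_add)

lemma vanishes_near_0_pd:
  assumes "vanishes_near_0 f" shows "vanishes_near_0 (pd b f)"
proof -
  obtain r where r: "r > 0" "\<And>x. norm x < r \<Longrightarrow> f x = 0" using assms by (auto simp: vanishes_near_0_def)
  have "pd b f x = 0" if "norm x < r" for x
  proof -
    have "((\<lambda>x. 0) has_derivative (\<lambda>h. 0)) (at x)" by simp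
    then have "(f has_derivative (\<lambda>h. 0)) (at x)"
      by (rule has_derivative_transform_within_open[OF _ open_ball[of 0 r]]) (use that r in auto)
    then show ?thesis by (rule pd_eqI)
  qed
  then show ?thesis using r by (auto simp: vanishes_near_0_def)
qed

lemma fourier_sum:
  "finite I \<Longrightarrow> (\<And>i. i \<in> I \<Longrightarrow> integrable lborel (f i)) \<Longrightarrow> fourier (\<lambda>x. \<Sum>i\<in>I. f i x) \<xi> = (\<Sum>i\<in>I. fourier (f i) \<xi>)"
  unfolding fourier_def sum_distrib_right by (intro Bochner_Integration.integral_sum fourier_integrable)

lemma fourier_cmult: "fourier (\<lambda>x. c * f x) \<xi> = c * fourier f \<xi>"
  unfolding fourier_def mult.assoc by simp

lemma fourier_add: "integrable lborel f \<Longrightarrow> integrable lborel g \<Longrightarrow> fourier (\<lambda>x. f x + g x) \<xi> = fourier f \<xi> + fourier g \<xi>"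
  unfolding fourier_def distrib_right by (intro Bochner_Integration.integral_add fourier_integrable)

text \<open>Multiplying a transform by a polynomial amounts to a differential operator on
  \<open>\<psi>\<close>, which cannot enlarge the support. The existential form lets the induction
  run: the product case applies the hypothesis twice in succession.\<close>

lemma real_polynomial_mult_fourier:
  fixes P :: "'a \<Rightarrow> real"
  assumes "real_polynomial_function P" "\<psi> \<in> schwartz" "vanishes_near_0 \<psi>"
  shows "\<exists>\<psi>'. \<psi>' \<in> schwartz \<and> vanishes_near_0 \<psi>' \<and> (\<forall>x. of_real (P x) * fourier \<psi> x = fourier \<psi>' x)"
  using assms
proof (induction P arbitrary: \<psi> rule: real_polynomial_function.induct)
  case (linear f)
  \<comment> \<open>The division undoes the factor \<open>2 * pi * \<i>\<close> of
    \<open>fourier_pd\<close>.\<close>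
  define c where "c b = of_real (f b) / (2 * pi * \<i>)" for b
  let ?\<psi> = "\<lambda>x. \<Sum>b\<in>Basis. c b * pd b \<psi> x"
  have S: "(\<lambda>x. c b * pd b \<psi> x) \<in> schwartz" if "b \<in> Basis" for b
    using that by (intro schwartz_cmult schwartz_pd linear)
  have "of_real (f x) * fourier \<psi> x = fourier ?\<psi> x" for x
  proof -
    have "f x = (\<Sum>b\<in>Basis. (b \<bullet> x) * f b)"
    proof -
      have "f x = f (\<Sum>b\<in>Basis. (x \<bullet> b) *\<^sub>R b)" by (simp add: euclidean_representation)
      also have "\<dots> = (\<Sum>b\<in>Basis. (b \<bullet> x) * f b)"
        using linear(1) by (simp add: linear_sum[OF bounded_linear.linear] linear_simps inner_commute)
      finally show ?thesis .
    qed
    moreover have "fourier ?\<psi> x = (\<Sum>b\<in>Basis. of_real ((b \<bullet> x) * f b) * fourier \<psi> x)"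
    proof -
      have "fourier ?\<psi> x = (\<Sum>b\<in>Basis. fourier (\<lambda>x. c b * pd b \<psi> x) x)"
        by (intro fourier_sum finite_Basis schwartz_integrable S)
      also have "\<dots> = (\<Sum>b\<in>Basis. of_real ((b \<bullet> x) * f b) * fourier \<psi> x)"
      proof (intro sum.cong refl)
        fix b :: 'a assume b: "b \<in> Basis"
        have "c b * (2 * of_real pi * \<i>) = of_real (f b)" by (simp add: c_def)
        then have "c b * (2 * of_real pi * \<i> * of_real (b \<bullet> x) * fourier \<psi> x) = of_real (f b) * of_real (b \<bullet> x) * fourier \<psi> x"
          by (metis mult.assoc)
        then show "fourier (\<lambda>x. c b * pd b \<psi> x) x = of_real ((b \<bullet> x) * f b) * fourier \<psi> x"
          unfolding fourier_cmult fourier_pd[OF linear(2) b] by (simp add: mult.commute)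
      qed
      finally show ?thesis .
    qed
    ultimately show ?thesis by (simp add: sum_distrib_right)
  qed
  moreover have "?\<psi> \<in> schwartz" by (intro schwartz_sum S) auto
  moreover have "vanishes_near_0 ?\<psi>" by (intro vanishes_near_0_sum vanishes_near_0_cmult vanishes_near_0_pd linear) auto
  ultimately show ?case by blast
next
  case (const c)
  show ?case
    by (intro exI[of _ "\<lambda>x. of_real c * \<psi> x"] conjI schwartz_cmult vanishes_near_0_cmult const allI) (simp add: fourier_cmult)
next
  case (add f g)
  obtain \<psi>1 \<psi>2 where *: "\<psi>1 \<in> schwartz" "vanishes_near_0 \<psi>1" "\<And>x. of_real (f x) * fourier \<psi> x = fourier \<psi>1 x"
     "\<psi>2 \<in> schwartz" "vanishes_near_0 \<psi>2" "\<And>x. of_real (g x) * fourier \<psi> x = fourier \<psi>2 x"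
    using add by metis
  have "of_real (f x + g x) * fourier \<psi> x = fourier (\<lambda>x. \<psi>1 x + \<psi>2 x) x" for x
    using * by (subst fourier_add) (auto simp: schwartz_integrable distrib_right)
  then show ?case using * by (intro exI[of _ "\<lambda>x. \<psi>1 x + \<psi>2 x"]) (auto intro: schwartz_add vanishes_near_0_add)
next
  case (mult f g)
  obtain \<psi>1 where 1: "\<psi>1 \<in> schwartz" "vanishes_near_0 \<psi>1" "\<And>x. of_real (g x) * fourier \<psi> x = fourier \<psi>1 x"
    using mult by metis
  obtain \<psi>2 where 2: "\<psi>2 \<in> schwartz" "vanishes_near_0 \<psi>2" "\<And>x. of_real (f x) * fourier \<psi>1 x = fourier \<psi>2 x"
    using mult.IH(1)[OF 1(1,2)] by metis
  have "of_real (f x * g x) * fourier \<psi> x = fourier \<psi>2 x" for x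
    using 1(3)[of x] 2(3)[of x] by (simp add: mult.assoc)
  then show ?case using 2 by blast
qed

text \<open>The integrand is a combination of transforms of functions vanishing near 0, and by
  inversion the integral of a transform is a multiple of the value of the function at 0.\<close>

lemma integral_polynomial_fourier:
  fixes P :: "'a \<Rightarrow> complex"
  assumes P: "polynomial_function P" and \<psi>: "\<psi> \<in> schwartz" "vanishes_near_0 \<psi>"
  shows "(\<integral>x. P x * fourier \<psi> x \<partial>lborel) = 0"
proof -
  have RI: "real_polynomial_function (Re \<circ> P)" "real_polynomial_function (Im \<circ> P)"
    using P bounded_linear_Re bounded_linear_Im unfolding polynomial_function_def by blast+
  obtain \<psi>1 where 1: "\<psi>1 \<in> schwartz" "vanishes_near_0 \<psi>1" "\<forall>x. of_real ((Re \<circ> P) x) * fourier \<psi> x = fourier \<psi>1 x"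
    using real_polynomial_mult_fourier[OF RI(1) \<psi>] by (elim exE conjE)
  obtain \<psi>2 where 2: "\<psi>2 \<in> schwartz" "vanishes_near_0 \<psi>2" "\<forall>x. of_real ((Im \<circ> P) x) * fourier \<psi> x = fourier \<psi>2 x"
    using real_polynomial_mult_fourier[OF RI(2) \<psi>] by (elim exE conjE)
  have *: "of_real (Re (P x)) * fourier \<psi> x = fourier \<psi>1 x" "of_real (Im (P x)) * fourier \<psi> x = fourier \<psi>2 x" for x
    using 1(3) 2(3) by simp_all
  have z: "(\<integral>x. fourier f x \<partial>lborel) = 0" if "f \<in> schwartz" "vanishes_near_0 f" for f :: "'a \<Rightarrow> complex"
  proof -
    have "f 0 = 0" using that(2) by (auto simp: vanishes_near_0_def)
    then show ?thesis using fourier_integral_complex[OF that(1)] by simp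
  qed
  have "P x * fourier \<psi> x = fourier \<psi>1 x + \<i> * fourier \<psi>2 x" for x
  proof -
    have "P x = of_real (Re (P x)) + \<i> * of_real (Im (P x))" by (rule complex_eq)
    then have "P x * fourier \<psi> x = (of_real (Re (P x)) + \<i> * of_real (Im (P x))) * fourier \<psi> x" by simp
    also have "\<dots> = fourier \<psi>1 x + \<i> * fourier \<psi>2 x" by (simp add: distrib_right mult.assoc *)
    finally show ?thesis .
  qed
  then show ?thesis
    by (simp add: Bochner_Integration.integral_add fourier_schwartz_integrable z 1(1,2) 2(1,2))
qed

end

text \<open>The sum has at most five terms, so its norm is at most five times the largest one; the
  right side dominates that single term.\<close>

lemma sum_fewest_terms:
  fixes a :: "int \<Rightarrow> complex"
  assumes K: "K \<subseteq> {k1..k1 + 4}" and p: "p > 0"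
  shows "ennreal (norm (sum a K) powr p) \<le> (\<integral>\<^sup>+k. ennreal ((5 * norm (a k)) powr p) \<partial>count_space UNIV)"
proof (cases "K = {}")
  case False
  have fin: "finite K" using K finite_subset by blast
  have "card K \<le> card {k1..k1 + 4}" using K by (intro card_mono) auto
  then have card: "card K \<le> 5" by simp
  have "Max ((\<lambda>k. norm (a k)) ` K) \<in> (\<lambda>k. norm (a k)) ` K" using fin False by (intro Max_in) auto
  then obtain k where k: "k \<in> K" "norm (a k) = Max ((\<lambda>k. norm (a k)) ` K)" by auto
  have "norm (sum a K) \<le> (\<Sum>j\<in>K. norm (a k))"
    using fin k by (intro order_trans[OF norm_sum sum_mono]) auto
  also have "\<dots> = real (card K) * norm (a k)" by simp
  also have "\<dots> \<le> 5 * norm (a k)" using card by (intro mult_right_mono) auto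
  finally have "ennreal (norm (sum a K) powr p) \<le> ennreal ((5 * norm (a k)) powr p)"
    using p by (intro ennreal_leI powr_mono2) auto
  also have "\<dots> \<le> (\<integral>\<^sup>+k. ennreal ((5 * norm (a k)) powr p) \<partial>count_space UNIV)" by (rule nn_integral_ge_point) simp
  finally show ?thesis .
qed simp

lemma Lp_norm_eq: "Lp_norm p g = epowr (\<integral>\<^sup>+x. ennreal (norm (g x) powr p) \<partial>lborel) (1 / p)"
  unfolding Lp_norm_def eLp_norm_def by (simp add: epowr_ennreal)

lemma Lp_nn_integral_finite: "g \<in> Lp p \<Longrightarrow> (\<integral>\<^sup>+x. ennreal (norm (g x) powr p) \<partial>lborel) < \<infinity>"
  unfolding Lp_def Lp_norm_eq by (auto simp: epowr_def less_top split: if_splits)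

lemma Lp_schwartz_integrable:
  fixes g \<psi> :: "'a::euclidean_space \<Rightarrow> complex"
  assumes g: "g \<in> Lp p" and \<psi>: "\<psi> \<in> schwartz" and p: "p \<ge> 1"
  shows "integrable lborel (\<lambda>x. g x * \<psi> x)"
proof (rule integrableI_bounded)
  have gm [measurable]: "g \<in> borel_measurable borel" using g by (simp add: Lp_def)
  note [measurable] = schwartz_measurable[OF \<psi>]
  show "(\<lambda>x. g x * \<psi> x) \<in> borel_measurable lborel" by measurable
  obtain S where S: "S \<ge> 0" "\<And>x. norm (\<psi> x) \<le> S" using rapid_bounded[OF schwartz_rapid[OF \<psi>]] by blast
  have "(\<integral>\<^sup>+x. ennreal (norm (g x * \<psi> x)) \<partial>lborel)
     \<le> (\<integral>\<^sup>+x. ennreal (norm (\<psi> x)) \<partial>lborel) + ennreal S * (\<integral>\<^sup>+x. ennreal (norm (g x) powr p) \<partial>lborel)"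
    using nn_integral_mult_le_Lp[of \<psi> lborel g S p] S p gm schwartz_measurable[OF \<psi>] by (simp add: mult.commute)
  also have "\<dots> < \<infinity>"
    using schwartz_integrable[OF \<psi>] Lp_nn_integral_finite[OF g] by (simp add: integrable_iff_bounded ennreal_mult_less_top)
  finally show "(\<integral>\<^sup>+x. ennreal (norm (g x * \<psi> x)) \<partial>lborel) < \<infinity>" .
qed

text \<open>Applied to the square sum, it places each weighted piece, and hence their supremum,
  below the square function.\<close>

lemma ennreal_le_infsum: "f k \<le> (\<Sum>\<^sub>\<infinity>k. f k)" for f :: "'b \<Rightarrow> ennreal"
proof -
  have "infsum f {k} \<le> infsum f UNIV"
    by (rule infsum_mono_neutral) (auto intro: nonneg_summable_on_complete)
  then show ?thesis by simp
qed

section \<open>Gluing the transforms of the pieces away from the origin\<close>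

context lp_gen
begin

lemma dyadic_less_iff: "dyadic k < dyadic l \<longleftrightarrow> k < l"
  by (simp add: dyadic_powr)

lemma dyadic_le_iff: "dyadic k \<le> dyadic l \<longleftrightarrow> k \<le> l"
  by (simp add: dyadic_powr)

lemma dyadic_range:
  assumes "\<rho> > 0"
  obtains N :: nat where "R < dyadic (int N)" "dyadic (- int N) < \<rho>"
proof -
  obtain n1 where n1: "R < 2 ^ n1" using real_arch_pow[of 2 R] by auto
  obtain n2 where n2: "1 / \<rho> < 2 ^ n2" using real_arch_pow[of 2 "1 / \<rho>"] by auto
  define N where "N = max n1 n2"
  have "(2::real) ^ n1 \<le> 2 ^ N" "(2::real) ^ n2 \<le> 2 ^ N" by (auto simp: N_def intro: power_increasing)
  then have "R < 2 ^ N" "1 / \<rho> < 2 ^ N" using n1 n2 by linarith+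
  moreover have "dyadic (int N) = 2 ^ N" "dyadic (- int N) = 1 / 2 ^ N"
    by (simp_all add: dyadic_def power_int_minus divide_inverse)
  moreover have "1 / 2 ^ N < \<rho>" using \<open>1 / \<rho> < 2 ^ N\<close> assms by (simp add: field_simps)
  ultimately show ?thesis using that[of N] by simp
qed

text \<open>The support of \<open>wide k\<close> forces
  \<open>\<rho> / 8 \<le> dyadic k \<le> 2 * R\<close>. The bounds on \<open>N\<close> leave some
  room, so that the same \<open>N\<close> also serves the partition of unity in
  \<open>glue_pairing\<close>.\<close>

lemma wide_range:
  assumes "4 * R < dyadic (int N)" "dyadic (- int N) < \<rho> / 8" "\<rho> \<le> norm \<xi>" "norm \<xi> \<le> R" "wide k \<xi> \<noteq> 0"
  shows "k \<in> {- int N..<int N}"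
proof -
  have "dyadic k \<le> 2 * R" "\<rho> / 8 \<le> dyadic k" using wide_support[OF assms(5)] assms by auto
  moreover have "2 * R \<le> 4 * R" using assms norm_ge_zero[of \<xi>] by linarith
  ultimately have "dyadic k < dyadic (int N)" "dyadic (- int N) < dyadic k" using assms by linarith+
  then show ?thesis unfolding dyadic_less_iff by auto
qed

lemma wide_at_0: "wide k 0 = 0"
  using wide_support(1)[of k 0] dyadic_pos[of k] by fastforce

lemma emeasure_cball_dyadic:
  "emeasure lborel (cball (0::'a) (8 * dyadic k)) \<le> ennreal (16 ^ DIM('a) * measure lborel (ball (0::'a) 1) * 2 powr (of_int k * real DIM('a)))"
proof -
  have "emeasure lborel (cball (0::'a) (8 * dyadic k)) \<le> emeasure lborel (ball (0::'a) (16 * dyadic k))"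
    using dyadic_pos[of k] by (intro emeasure_mono) auto
  also have "\<dots> = ennreal (measure lborel (ball (0::'a) (16 * dyadic k)))"
    using emeasure_lborel_ball_finite[of "0::'a" "16 * dyadic k"] by (intro emeasure_eq_ennreal_measure) auto
  also have "measure lborel (ball (0::'a) (16 * dyadic k)) = (16 * dyadic k) ^ DIM('a) * measure lborel (ball (0::'a) 1)"
    using content_ball_conv_unit_ball[of "16 * dyadic k" "0::'a"] dyadic_pos[of k] by simp
  also have "(16 * dyadic k) ^ DIM('a) = 16 ^ DIM('a) * 2 powr (of_int k * real DIM('a))"
  proof -
    have "dyadic k ^ DIM('a) = (2 powr of_int k) powr real DIM('a)"
      unfolding dyadic_powr by (subst powr_realpow) auto
    then show ?thesis by (simp add: power_mult_distrib powr_powr)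
  qed
  finally show ?thesis by (simp add: mult_ac)
qed

text \<open>Gluing the transforms \<open>gh k\<close> of the pieces: \<open>wide k\<close> equals 1 on the support of \<open>symb k\<close>, so
  multiplying by it changes nothing distributionally but makes the sum locally finite.\<close>

definition glue :: "(int \<Rightarrow> 'a \<Rightarrow> complex) \<Rightarrow> 'a \<Rightarrow> complex" where
  "glue gh \<xi> = lim (\<lambda>n. \<Sum>k\<in>{- int n..<int n}. wide k \<xi> * gh k \<xi>)"

lemma glue_measurable:
  assumes [measurable]: "\<And>k. gh k \<in> borel_measurable borel"
  shows "glue gh \<in> borel_measurable borel"
proof -
  have [measurable]: "wide k \<in> borel_measurable borel" for k by (intro schwartz_measurable wide_schwartz)
  show ?thesis unfolding glue_def by measurable
qed

lemma glue_0: "glue gh 0 = 0" unfolding glue_def by (simp add: wide_at_0)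

lemma glue_eq:
  assumes N: "\<And>k. wide k \<xi> \<noteq> 0 \<Longrightarrow> k \<in> {- int N..<int N}"
  shows "glue gh \<xi> = (\<Sum>k\<in>{- int N..<int N}. wide k \<xi> * gh k \<xi>)"
proof -
  have "(\<Sum>k\<in>{- int n..<int n}. wide k \<xi> * gh k \<xi>) = (\<Sum>k\<in>{- int N..<int N}. wide k \<xi> * gh k \<xi>)" if "n \<ge> N" for n
  proof -
    have "wide k \<xi> = 0" if "k \<notin> {- int N..<int N}" for k using N that by blast
    then show ?thesis using that by (intro sum.mono_neutral_right) auto
  qed
  then have "(\<lambda>n. \<Sum>k\<in>{- int n..<int n}. wide k \<xi> * gh k \<xi>) \<longlonglongrightarrow> (\<Sum>k\<in>{- int N..<int N}. wide k \<xi> * gh k \<xi>)"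
    by (intro tendsto_eventually eventually_sequentiallyI[of N])
  then show ?thesis unfolding glue_def by (rule limI)
qed

lemma glue_powr_le:
  assumes p: "p > 0"
  shows "ennreal (norm (glue gh \<xi>) powr p) \<le> (\<integral>\<^sup>+k. ennreal ((5 * norm (wide k \<xi> * gh k \<xi>)) powr p) \<partial>count_space UNIV)"
proof (cases "\<xi> = 0")
  case False
  obtain N where N: "4 * norm \<xi> < dyadic (int N)" "dyadic (- int N) < norm \<xi> / 8"
    using dyadic_range[of "norm \<xi> / 8" "4 * norm \<xi>"] False by auto
  define K where "K = {k\<in>{- int N..<int N}. wide k \<xi> \<noteq> 0}"
  have "glue gh \<xi> = (\<Sum>k\<in>{- int N..<int N}. wide k \<xi> * gh k \<xi>)"
    by (rule glue_eq) (rule wide_range[OF N order_refl order_refl])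
  also have "\<dots> = (\<Sum>k\<in>K. wide k \<xi> * gh k \<xi>)" unfolding K_def by (intro sum.mono_neutral_right) auto
  finally have eq: "glue gh \<xi> = (\<Sum>k\<in>K. wide k \<xi> * gh k \<xi>)" .
  have "\<exists>k1. K \<subseteq> {k1..k1 + 4}"
  proof (cases "K = {}")
    case False
    have fin: "finite K" unfolding K_def by (rule finite_subset[of _ "{- int N..<int N}"]) auto
    \<comment> \<open>For the least active index, \<open>norm \<xi> \<le> 8 * dyadic k1\<close>; any
      other active \<open>k\<close> has
      \<open>dyadic k \<le> 2 * norm \<xi> \<le> 16 * dyadic k1\<close>, that is
      \<open>k \<le> k1 + 4\<close>.\<close>
    define k1 where "k1 = Min K"
    have "wide k1 \<xi> \<noteq> 0" using Min_in[OF fin False] by (simp add: K_def k1_def)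
    then have le: "norm \<xi> \<le> 8 * dyadic k1" by (rule wide_support)
    have d4: "dyadic (k1 + 4) = 16 * dyadic k1" by (simp add: dyadic_def power_int_add)
    have "k \<in> {k1..k1 + 4}" if k: "k \<in> K" for k
    proof -
      have "dyadic k / 2 \<le> norm \<xi>" using k by (intro wide_support) (simp add: K_def)
      then have "dyadic k \<le> dyadic (k1 + 4)" using le d4 by linarith
      then show ?thesis using Min_le[OF fin k] by (simp add: k1_def dyadic_le_iff)
    qed
    then show ?thesis by blast
  qed blast
  then show ?thesis unfolding eq using sum_fewest_terms[OF _ p] by blast
qed (simp add: glue_0)

text \<open>The support of \<open>\<psi>\<close> lies between two positive radii, where finitely
  many \<open>symb k\<close> add up to 1. For each of them \<open>tempered_fourier_symb\<close>
  replaces \<open>u\<close> by a piece and \<open>pair\<close> replaces the piece by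
  \<open>gh k\<close>.\<close>

lemma glue_pairing:
  assumes u: "u \<in> tempered" and gh [measurable]: "\<And>k. gh k \<in> borel_measurable borel"
    and gh2: "\<And>k. (nn_sq lborel (gh k)) < \<infinity>"
    and pair: "\<And>k \<psi>. \<psi> \<in> schwartz \<Longrightarrow> (\<integral>x. piece u k x * fourier \<psi> x \<partial>lborel) = (\<integral>x. gh k x * \<psi> x \<partial>lborel)"
    and \<psi>: "\<psi> \<in> schwartz" "compact (closure {x. \<psi> x \<noteq> 0})" "closure {x. \<psi> x \<noteq> 0} \<subseteq> - {0}"
  shows "u (fourier \<psi>) = (\<integral>x. glue gh x * \<psi> x \<partial>lborel)"
proof -
  obtain R where R: "\<And>x. \<psi> x \<noteq> 0 \<Longrightarrow> norm x \<le> R"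
    using compact_imp_bounded[OF \<psi>(2)] closure_subset unfolding bounded_iff by (metis (mono_tags, lifting) mem_Collect_eq subsetD)
  have "open (- closure {x. \<psi> x \<noteq> 0})" "0 \<in> - closure {x. \<psi> x \<noteq> 0}" using \<psi>(3) by auto
  then obtain \<rho> where \<rho>: "\<rho> > 0" "ball 0 \<rho> \<subseteq> - closure {x. \<psi> x \<noteq> 0}" using open_contains_ball by blast
  have \<rho>': "\<rho> \<le> norm x" if "\<psi> x \<noteq> 0" for x
  proof (rule ccontr)
    assume "\<not> \<rho> \<le> norm x"
    then have "x \<in> ball 0 \<rho>" by simp
    then have "x \<in> - closure {x. \<psi> x \<noteq> 0}" using \<rho>(2) by blast
    then show False using that closure_subset[of "{x. \<psi> x \<noteq> 0}"] by auto
  qed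
  obtain N where N: "4 * R < dyadic (int N)" "dyadic (- int N) < \<rho> / 8"
    using dyadic_range[of "\<rho> / 8" "4 * R"] \<rho> by auto
  let ?I = "{- int N..<int N}"
  have wS: "(\<lambda>x. wide k x * \<psi> x) \<in> schwartz" for k by (intro schwartz_mult wide_schwartz \<psi>)
  have sS: "(\<lambda>x. symb k x * \<psi> x) \<in> schwartz" for k by (intro schwartz_mult symb_schwartz \<psi>)
  have dec: "\<psi> x = (\<Sum>k\<in>?I. symb k x * \<psi> x)" for x
  proof (cases "\<psi> x = 0")
    case False
    have "norm x \<le> dyadic (int N)" using R[OF False] N(1) norm_ge_zero[of x] by linarith
    then have "cutoff (dyadic (int N)) x = 1" by (intro cutoff_1 dyadic_pos)
    moreover have "cutoff (dyadic (- int N)) x = 0" using \<rho>'[OF False] N(2) \<rho>(1) by (intro cutoff_0 dyadic_pos) linarith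
    ultimately show ?thesis unfolding sum_distrib_right[symmetric] sum_symb by simp
  qed simp
  have F: "fourier \<psi> = (\<lambda>y. \<Sum>k\<in>?I. fourier (\<lambda>x. symb k x * \<psi> x) y)"
  proof
    fix y
    have "fourier \<psi> y = fourier (\<lambda>x. \<Sum>k\<in>?I. symb k x * \<psi> x) y" by (simp flip: dec)
    also have "\<dots> = (\<Sum>k\<in>?I. fourier (\<lambda>x. symb k x * \<psi> x) y)"
      by (intro fourier_sum schwartz_integrable sS) simp
    finally show "fourier \<psi> y = (\<Sum>k\<in>?I. fourier (\<lambda>x. symb k x * \<psi> x) y)" .
  qed
  have "u (fourier \<psi>) = (\<Sum>k\<in>?I. u (fourier (\<lambda>x. symb k x * \<psi> x)))"
    unfolding F by (intro tempered_sum u fourier_schwartz sS) simp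
  also have "\<dots> = (\<Sum>k\<in>?I. \<integral>x. gh k x * (wide k x * \<psi> x) \<partial>lborel)"
  proof (rule sum.cong)
    fix k
    \<comment> \<open>Inserting \<open>wide k\<close> is free while \<open>symb k\<close> is
      present. Once \<open>tempered_fourier_symb\<close> has removed \<open>symb k\<close>, the
      factor \<open>wide k\<close> is what still localises \<open>gh k\<close> and matches the
      definition of \<open>glue\<close>.\<close>
    have "(\<lambda>x. symb k x * \<psi> x) = (\<lambda>x. symb k x * (wide k x * \<psi> x))"
      unfolding mult.assoc[symmetric] symb_wide ..
    then show "u (fourier (\<lambda>x. symb k x * \<psi> x)) = (\<integral>x. gh k x * (wide k x * \<psi> x) \<partial>lborel)"
      using tempered_fourier_symb[OF u wS] pair[OF wS] by simp
  qed simp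
  also have "\<dots> = (\<integral>x. (\<Sum>k\<in>?I. gh k x * (wide k x * \<psi> x)) \<partial>lborel)"
  proof (rule Bochner_Integration.integral_sum[symmetric])
    fix k
    show "integrable lborel (\<lambda>x. gh k x * (wide k x * \<psi> x))"
    proof (rule integrable_mult_L2)
      show "(nn_sq lborel (\<lambda>x. wide k x * \<psi> x)) < \<infinity>"
        using schwartz_square_integrable[OF wS[of k]] by (simp add: integrable_iff_bounded)
    qed (use gh2 schwartz_measurable[OF wS] in auto)
  qed
  also have "\<dots> = (\<integral>x. glue gh x * \<psi> x \<partial>lborel)"
  proof (rule Bochner_Integration.integral_cong)
    fix x
    show "(\<Sum>k\<in>?I. gh k x * (wide k x * \<psi> x)) = glue gh x * \<psi> x"
    proof (cases "\<psi> x = 0")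
      case False
      have "glue gh x = (\<Sum>k\<in>?I. wide k x * gh k x)"
        by (rule glue_eq) (rule wide_range[OF N \<rho>'[OF False] R[OF False]])
      then have "glue gh x * \<psi> x = (\<Sum>k\<in>?I. wide k x * gh k x * \<psi> x)" by (simp only: sum_distrib_right)
      then show ?thesis by (simp only: mult_ac)
    qed simp
  qed simp
  finally show ?thesis .
qed

section \<open>Size of the individual pieces\<close>

lemma phi_dil_dyadic_bound:
  obtains D where "D > 0" "\<And>k x. norm (phi_dil (4 * dyadic k) x) \<le> D * 2 powr (of_int k * real DIM('a))"
proof -
  obtain S where S: "S > 0" "\<And>t x. t > 0 \<Longrightarrow> norm (phi_dil t x) \<le> t ^ DIM('a) * S" using phi_dil_bound by metis
  have "norm (phi_dil (4 * dyadic k) x) \<le> (4 ^ DIM('a) * S) * 2 powr (of_int k * real DIM('a))" for k x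
  proof -
    have "dyadic k ^ DIM('a) = (2 powr of_int k) powr real DIM('a)"
      unfolding dyadic_powr by (subst powr_realpow) auto
    then show ?thesis using S(2)[of "4 * dyadic k" x] dyadic_pos[of k]
      by (simp add: power_mult_distrib powr_powr mult_ac)
  qed
  then show ?thesis using that[of "4 ^ DIM('a) * S"] S(1) by simp
qed

lemma phi_dil_nn_L1: "t > 0 \<Longrightarrow> (\<integral>\<^sup>+x. ennreal (norm (phi_dil t x)) \<partial>lborel) = ennreal phi_L1"
  using nn_integral_eq_integral[OF integrable_norm[OF schwartz_integrable[OF phi_dil_schwartz[of t]]]]
  by (simp add: phi_L1_def[symmetric] phi_dil_L1)

lemma piece_bounded:
  assumes u: "u \<in> tempered" and p: "p \<ge> 1" "(\<integral>\<^sup>+x. ennreal (norm (piece u k x) powr p) \<partial>lborel) < \<infinity>"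
  obtains B where "\<And>x. norm (piece u k x) \<le> B"
proof -
  have t: "4 * dyadic k > 0" using dyadic_pos[of k] by simp
  show ?thesis
    by (rule reproduced_bounded[OF phi_dil_schwartz[OF t] conv_distr_measurable[OF u lp_piece_schwartz]
       piece_integrable[OF u] piece_reproduced[OF u] p]) (rule that)
qed

text \<open>A bounded function in Lp with \<open>p \<le> 2\<close> is square integrable: its square
  is at most \<open>B powr (2 - p)\<close> times its p-th power.\<close>

lemma piece_L2:
  assumes u: "u \<in> tempered" and p: "1 \<le> p" "p \<le> 2" "(\<integral>\<^sup>+x. ennreal (norm (piece u k x) powr p) \<partial>lborel) < \<infinity>"
  shows "(nn_sq lborel (piece u k)) < \<infinity>"
proof -
  let ?v = "piece u k"
  have [measurable]: "?v \<in> borel_measurable borel" by (intro conv_distr_measurable u lp_piece_schwartz)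
  obtain B where B: "\<And>x. norm (?v x) \<le> B" using piece_bounded[OF u p(1,3)] by blast
  have "(nn_sq lborel (\<lambda>x. ?v x)) \<le> (\<integral>\<^sup>+x. ennreal (B powr (2 - p)) * ennreal (norm (?v x) powr p) \<partial>lborel)"
  proof (rule nn_integral_mono)
    fix x
    have "(norm (?v x))\<^sup>2 \<le> B powr (2 - p) * norm (?v x) powr p"
    proof (cases "?v x = 0")
      case False
      then have "(norm (?v x))\<^sup>2 = norm (?v x) powr (2 - p) * norm (?v x) powr p"
        by (simp add: powr_add[symmetric])
      also have "\<dots> \<le> B powr (2 - p) * norm (?v x) powr p"
        using B p by (intro mult_right_mono powr_mono2) auto
      finally show ?thesis .
    qed simp
    then show "ennreal ((norm (?v x))\<^sup>2) \<le> ennreal (B powr (2 - p)) * ennreal (norm (?v x) powr p)"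
      by (simp add: ennreal_leI flip: ennreal_mult)
  qed
  also have "\<dots> = ennreal (B powr (2 - p)) * (\<integral>\<^sup>+x. ennreal (norm (?v x) powr p) \<partial>lborel)"
    by (rule nn_integral_cmult) measurable
  also have "\<dots> < \<infinity>" using p by (simp add: ennreal_mult_less_top)
  finally show ?thesis .
qed

lemma piece_sup_bound:
  assumes u: "u \<in> tempered" and p: "p \<ge> 1" "(\<integral>\<^sup>+x. ennreal (norm (piece u k x) powr p) \<partial>lborel) < \<infinity>"
    and D: "D > 0" "\<And>k x. norm (phi_dil (4 * dyadic k) x) \<le> D * 2 powr (of_int k * real DIM('a))"
    and t: "t \<ge> 0" "emeasure lborel {x. norm (piece u k x) > t} \<le> ennreal (2 powr (- of_int k * real DIM('a)) / (2 * D))"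
  shows "norm (piece u k x) \<le> 2 * phi_L1 * t"
proof -
  have r: "4 * dyadic k > 0" using dyadic_pos[of k] by simp
  obtain B where B: "\<And>x. norm (piece u k x) \<le> B" using piece_bounded[OF u p] by blast
  have "norm (piece u k x) \<le> 2 * (\<integral>z. norm (phi_dil (4 * dyadic k) z) \<partial>lborel) * t"
  proof (rule reproduced_sup_bound[OF phi_dil_schwartz[OF r] conv_distr_measurable[OF u lp_piece_schwartz] B
       piece_reproduced[OF u] D(2) t])
    \<comment> \<open>The kernel has height \<open>D * 2^(kd)\<close>, and the threshold for the
      level set is chosen so that its product with this height is 1/2.\<close>
    have "2 powr (of_int k * real DIM('a)) * 2 powr (- of_int k * real DIM('a)) = 1"
      unfolding powr_add[symmetric] by simp
    then show "D * 2 powr (of_int k * real DIM('a)) * (2 powr (- of_int k * real DIM('a)) / (2 * D)) \<le> 1 / 2"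
      using D(1) by (simp add: field_simps)
  qed (use D(1) in simp)
  then show ?thesis unfolding phi_dil_L1[OF r] .
qed

text \<open>The reproducing kernel has L1 norm \<open>phi_L1\<close> at every scale, so the constant
  does not depend on \<open>k\<close>.\<close>

lemma piece_plancherel:
  assumes u: "u \<in> tempered" and p: "1 \<le> p" "p \<le> 2" "(\<integral>\<^sup>+x. ennreal (norm (piece u k x) powr p) \<partial>lborel) < \<infinity>"
  shows "\<exists>gh. gh \<in> borel_measurable borel \<and>
    (nn_sq lborel gh)
      \<le> ennreal (2 * inv_const * phi_L1\<^sup>2) * (nn_sq lborel (piece u k)) \<and>
    (\<forall>\<psi>\<in>schwartz. (\<integral>x. piece u k x * fourier \<psi> x \<partial>lborel) = (\<integral>x. gh x * \<psi> x \<partial>lborel))"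
proof -
  have r: "4 * dyadic k > 0" using dyadic_pos[of k] by simp
  obtain B where B: "\<And>x. norm (piece u k x) \<le> B" using piece_bounded[OF u p(1,3)] by blast
  obtain gh where gh: "gh \<in> borel_measurable borel"
    "(nn_sq lborel gh)
       \<le> ennreal (2 * inv_const) * (\<integral>\<^sup>+x. ennreal (norm (phi_dil (4 * dyadic k) x)) \<partial>lborel)\<^sup>2 * (nn_sq lborel (piece u k))"
    "\<And>\<psi>. \<psi> \<in> schwartz \<Longrightarrow> (\<integral>x. piece u k x * fourier \<psi> x \<partial>lborel) = (\<integral>x. gh x * \<psi> x \<partial>lborel)"
    using plancherel_reproduced[OF phi_dil_schwartz[OF r] conv_distr_measurable[OF u lp_piece_schwartz] B piece_L2[OF u p]
       piece_reproduced[OF u]] by blast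
  have "ennreal (2 * inv_const) * (\<integral>\<^sup>+x. ennreal (norm (phi_dil (4 * dyadic k) x)) \<partial>lborel)\<^sup>2 = ennreal (2 * inv_const * phi_L1\<^sup>2)"
    unfolding phi_dil_nn_L1[OF r] using inv_const_pos phi_L1_ge_1 by (simp add: ennreal_power ennreal_mult)
  then show ?thesis using gh by auto
qed

abbreviation square_fun :: "real \<Rightarrow> (('a \<Rightarrow> complex) \<Rightarrow> complex) \<Rightarrow> 'a \<Rightarrow> ennreal" where
  "square_fun s u x \<equiv> epowr (\<Sum>\<^sub>\<infinity>k::int. ennreal ((norm (of_real (2 powr (of_int k * s)) * piece u k x))\<^sup>2)) (1 / 2)"

text \<open>The hypotheses of \<open>jawerth_sum\<close> are verified for the weighted pieces, with
  the dimension as \<open>\<delta>\<close>. \<open>N k\<close> is the squared L2 norm of the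
  weighted piece; the middle identity takes the weight off again, so that Plancherel can be applied
  to the piece itself.\<close>

lemma weighted_pieces_sum:
  fixes p s :: real
  assumes p: "1 < p" "p < 2" and u: "u \<in> tempered"
    and D: "D > 0" "\<And>k x. norm (phi_dil (4 * dyadic k) x) \<le> D * 2 powr (of_int k * real DIM('a))"
    and X: "X = (\<integral>\<^sup>+x. epowr (square_fun s u x) p \<partial>lborel)"
      "X < \<infinity>"
  shows "\<exists>N. (\<forall>k. N k \<ge> 0 \<and> (\<integral>\<^sup>+x. ennreal (norm (piece u k x) powr p) \<partial>lborel) < \<infinity> \<and>
        (nn_sq lborel (piece u k)) = ennreal (2 powr (- 2 * of_int k * s) * N k)) \<and>
     (\<integral>\<^sup>+k. ennreal (2 powr (- of_int k * (real DIM('a) * (1 - p / 2))) * N k powr (p / 2)) \<partial>count_space UNIV)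
     \<le> ennreal (jawerth_const p (real DIM('a)) phi_L1 D) * X"
proof -
  define v where "v k = piece u k" for k
  define a where "a k = 2 powr (of_int k * s)" for k :: int
  have a: "a k > 0" for k by (simp add: a_def)
  define G where "G k x = a k * norm (v k x)" for k x
  define M where "M x = (SUP k. ennreal (G k x))" for x
  have vm [measurable]: "v k \<in> borel_measurable borel" for k unfolding v_def by (intro conv_distr_measurable u lp_piece_schwartz)
  have Gm [measurable]: "G k \<in> borel_measurable borel" for k unfolding G_def by measurable
  have G0: "G k x \<ge> 0" for k x using a[of k] by (simp add: G_def)
  have Mm [measurable]: "M \<in> borel_measurable borel" unfolding M_def by measurable
  have GM: "ennreal (G k x) \<le> M x" for k x unfolding M_def by (rule SUP_upper) simp
  have MX: "(\<integral>\<^sup>+x. epowr (M x) p \<partial>lborel) \<le> X"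
    unfolding X(1)
  proof (intro nn_integral_mono epowr_mono)
    fix x
    show "M x \<le> square_fun s u x"
      unfolding M_def
    proof (rule SUP_least)
      fix k
      have "ennreal ((G k x)\<^sup>2) \<le> (\<Sum>\<^sub>\<infinity>k::int. ennreal ((norm (of_real (2 powr (of_int k * s)) * piece u k x))\<^sup>2))"
        using ennreal_le_infsum[of "\<lambda>k. ennreal ((norm (of_real (2 powr (of_int k * s)) * piece u k x))\<^sup>2)" k]
        by (simp add: G_def a_def v_def norm_mult)
      from epowr_ge[OF _ _ this, of "1 / 2"]
      show "ennreal (G k x) \<le> square_fun s u x"
        using G0[of k x] by (simp add: powr_half_sqrt)
    qed
  qed (use p in auto)
  have vp: "(\<integral>\<^sup>+x. ennreal (norm (v k x) powr p) \<partial>lborel) < \<infinity>" for k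
  proof -
    have "ennreal (norm (v k x) powr p) \<le> ennreal ((1 / a k) powr p) * epowr (M x) p" for x
    proof -
      have "norm (v k x) = (1 / a k) * G k x" unfolding G_def using a[of k] by simp
      then have "norm (v k x) powr p = (1 / a k) powr p * G k x powr p" using a[of k] G0[of k x] by (simp only: powr_mult)
      then have "ennreal (norm (v k x) powr p) = ennreal ((1 / a k) powr p) * ennreal (G k x powr p)" by (simp add: ennreal_mult)
      also have "\<dots> \<le> ennreal ((1 / a k) powr p) * epowr (M x) p"
        using p by (intro mult_left_mono epowr_ge G0 GM) auto
      finally show ?thesis .
    qed
    then have "(\<integral>\<^sup>+x. ennreal (norm (v k x) powr p) \<partial>lborel) \<le> (\<integral>\<^sup>+x. ennreal ((1 / a k) powr p) * epowr (M x) p \<partial>lborel)"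
      by (intro nn_integral_mono)
    also have "\<dots> = ennreal ((1 / a k) powr p) * (\<integral>\<^sup>+x. epowr (M x) p \<partial>lborel)" by (rule nn_integral_cmult) measurable
    also have "\<dots> < \<infinity>" using order_le_less_trans[OF MX X(2)] by (simp add: ennreal_mult_less_top)
    finally show ?thesis .
  qed
  have v2: "(nn_sq lborel (v k)) < \<infinity>" for k
    unfolding v_def by (rule piece_L2[OF u _ _ vp[unfolded v_def]]) (use p in auto)
  define N where "N k = (a k)\<^sup>2 * enn2real (nn_sq lborel (v k))" for k
  have N0: "N k \<ge> 0" for k by (simp add: N_def)
  have V: "(nn_sq lborel (v k)) = ennreal (enn2real (nn_sq lborel (v k)))" for k
    using v2[of k] by simp
  have NG: "ennreal (N k) = (\<integral>\<^sup>+x. ennreal ((G k x)\<^sup>2) \<partial>lborel)" for k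
  proof -
    have "(\<integral>\<^sup>+x. ennreal ((G k x)\<^sup>2) \<partial>lborel) = (\<integral>\<^sup>+x. ennreal ((a k)\<^sup>2) * ennreal ((norm (v k x))\<^sup>2) \<partial>lborel)"
      unfolding G_def by (simp add: power_mult_distrib ennreal_mult)
    also have "\<dots> = ennreal ((a k)\<^sup>2) * (nn_sq lborel (v k))" by (rule nn_integral_cmult) measurable
    also have "\<dots> = ennreal (N k)" unfolding N_def by (subst V) (simp add: ennreal_mult)
    finally show ?thesis ..
  qed
  have Nv: "(nn_sq lborel (v k)) = ennreal (2 powr (- 2 * of_int k * s) * N k)" for k
  proof -
    have "2 powr (- 2 * of_int k * s) * (a k)\<^sup>2 = 1"
      by (simp add: a_def power2_eq_square powr_add[symmetric])
    then have "2 powr (- 2 * of_int k * s) * N k = enn2real (nn_sq lborel (v k))"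
      unfolding N_def mult.assoc[symmetric] by simp
    then show ?thesis using V[of k] by simp
  qed
  have sup: "G k x \<le> 2 * phi_L1 * t"
    if t: "t > 0" "emeasure lborel {x. M x > ennreal t} \<le> ennreal (2 powr (- of_int k * real DIM('a)) / (2 * D))" for k x t
  proof -
    \<comment> \<open>The sup bound is homogeneous in the height: it is applied to the unweighted
      piece at height \<open>t / a k\<close> and then multiplied by \<open>a k\<close>.\<close>
    have "{x. norm (v k x) > t / a k} \<subseteq> {x. M x > ennreal t}"
    proof
      fix x assume "x \<in> {x. norm (v k x) > t / a k}"
      then have "t < G k x" unfolding G_def using a[of k] by (simp add: field_simps)
      then have "ennreal t < ennreal (G k x)" using t by (simp add: ennreal_less_iff)
      then show "x \<in> {x. M x > ennreal t}" using GM[of k x] by (auto intro: less_le_trans)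
    qed
    then have "emeasure lborel {x. norm (v k x) > t / a k} \<le> emeasure lborel {x. M x > ennreal t}"
      by (rule emeasure_mono) measurable
    also note t(2)
    finally have "norm (v k x) \<le> 2 * phi_L1 * (t / a k)"
      unfolding v_def using t(1) a[of k] p by (intro piece_sup_bound[OF u _ vp[unfolded v_def] D]) auto
    then show ?thesis unfolding G_def using a[of k] by (simp add: field_simps)
  qed
  have "(\<integral>\<^sup>+k. ennreal (2 powr (- of_int k * (real DIM('a) * (1 - p / 2))) * N k powr (p / 2)) \<partial>count_space UNIV)
     \<le> ennreal (jawerth_const p (real DIM('a)) phi_L1 D)
       * (\<integral>\<^sup>+x. epowr (M x) p \<partial>lborel)"
    by (rule jawerth_sum[OF _ _ _ phi_L1_ge_1 D(1) Gm G0 Mm GM sup N0 eq_refl[OF NG]]) (use p in auto)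
  also have "\<dots> \<le> ennreal (jawerth_const p (real DIM('a)) phi_L1 D) * X"
    by (intro mult_left_mono MX) simp
  finally show ?thesis using N0 vp Nv unfolding v_def by (intro exI[of _ N]) blast
qed

text \<open>The function is \<open>glue gh\<close>, with \<open>gh k\<close> the Plancherel
  transform of the \<open>k\<close>-th piece. Its p-th power is integrated frequency by frequency,
  using Hoelder on a ball containing the support of \<open>wide k\<close>; the powers of 2 that
  arise are those controlled by \<open>weighted_pieces_sum\<close>.\<close>

lemma fourier_bounded_on_sobolev:
  fixes p s :: real
  assumes p: "1 < p" "p < 2" and s: "s = real DIM('a) * (2 / p - 1)"
  shows "\<exists>C>0. \<forall>u\<in>tempered. sobolev_norm \<phi> p s u < \<infinity> \<longrightarrow> (\<exists>g\<in>Lp p.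
    (\<forall>\<psi>\<in>schwartz. compact (closure {x. \<psi> x \<noteq> 0}) \<and> closure {x. \<psi> x \<noteq> 0} \<subseteq> - {0} \<longrightarrow> u (fourier \<psi>) = fun_distr g \<psi>) \<and>
    Lp_norm p g \<le> ennreal C * sobolev_norm \<phi> p s u)"
proof -
  obtain D where D: "D > 0" "\<And>k x. norm (phi_dil (4 * dyadic k) x) \<le> D * 2 powr (of_int k * real DIM('a))"
    using phi_dil_dyadic_bound by metis
  define q where "q = p / 2"
  have q: "0 < q" "q < 1" using p by (auto simp: q_def)
  define \<beta> where "\<beta> = real DIM('a) * (1 - q)"
  have \<beta>: "\<beta> > 0" using q by (simp add: \<beta>_def)
  define J where "J = jawerth_const p (real DIM('a)) phi_L1 D"
  define V where "V = 16 ^ DIM('a) * measure lborel (ball (0::'a) 1)"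
  define W where "W = 2 * inv_const * phi_L1\<^sup>2"
  have V: "V > 0" by (simp add: V_def content_ball_pos)
  have W: "W > 0" unfolding W_def using inv_const_pos phi_L1_ge_1 by simp
  have "2 powr (- \<beta>) < 1" "2 powr (- p) < 1"
    using powr_less_mono[of "- \<beta>" 0 2] powr_less_mono[of "- p" 0 2] \<beta> p by auto
  then have J: "J > 0" unfolding J_def jawerth_const_def \<beta>_def q_def using D(1) phi_L1_ge_1 by simp
  \<comment> \<open>\<open>5 powr p\<close> accounts for the overlap of the \<open>wide k\<close>,
    the 2 for the splitting in \<open>nn_integral_powr_le_L2\<close>, \<open>V\<close> for the
    volume of the ball and \<open>W\<close> for Plancherel.\<close>
  define T where "T = 5 powr p * (2 * V powr (1 - q) * W powr q)"
  have T: "T > 0" unfolding T_def using V W by simp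
  define C where "C = (T * J) powr (1 / p)"
  have C: "C > 0" unfolding C_def using T J by simp
  have main: "\<exists>g\<in>Lp p. (\<forall>\<psi>\<in>schwartz. compact (closure {x. \<psi> x \<noteq> 0}) \<and> closure {x. \<psi> x \<noteq> 0} \<subseteq> - {0} \<longrightarrow> u (fourier \<psi>) = fun_distr g \<psi>) \<and>
    Lp_norm p g \<le> ennreal C * sobolev_norm \<phi> p s u"
    if u: "u \<in> tempered" and fin: "sobolev_norm \<phi> p s u < \<infinity>" for u
  proof -
    define X where "X = (\<integral>\<^sup>+x. epowr (square_fun s u x) p \<partial>lborel)"
    have SX: "sobolev_norm \<phi> p s u = epowr X (1 / p)" unfolding sobolev_norm_def eLp_norm_def X_def ..
    have Xfin: "X < \<infinity>" using fin unfolding SX epowr_def by (auto simp: less_top split: if_splits)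
    obtain N where N: "\<And>k. N k \<ge> 0" "\<And>k. (\<integral>\<^sup>+x. ennreal (norm (piece u k x) powr p) \<partial>lborel) < \<infinity>"
      "\<And>k. (nn_sq lborel (piece u k)) = ennreal (2 powr (- 2 * of_int k * s) * N k)"
      and sumN: "(\<integral>\<^sup>+k. ennreal (2 powr (- of_int k * \<beta>) * N k powr q) \<partial>count_space UNIV) \<le> ennreal J * X"
      using weighted_pieces_sum[OF p u D X_def Xfin] unfolding J_def \<beta>_def q_def by blast
    have "\<forall>k. \<exists>gh. gh \<in> borel_measurable borel \<and>
      (nn_sq lborel gh) \<le> ennreal W * ennreal (2 powr (- 2 * of_int k * s) * N k) \<and>
      (\<forall>\<psi>\<in>schwartz. (\<integral>x. piece u k x * fourier \<psi> x \<partial>lborel) = (\<integral>x. gh x * \<psi> x \<partial>lborel))"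
      unfolding N(3)[symmetric] W_def using p by (intro allI piece_plancherel[OF u _ _ N(2)]) auto
    then obtain gh where gh': "\<forall>k. gh k \<in> borel_measurable borel \<and>
      (nn_sq lborel (gh k)) \<le> ennreal W * ennreal (2 powr (- 2 * of_int k * s) * N k) \<and>
      (\<forall>\<psi>\<in>schwartz. (\<integral>x. piece u k x * fourier \<psi> x \<partial>lborel) = (\<integral>x. gh k x * \<psi> x \<partial>lborel))"
      by (rule choice[THEN exE])
    have ghm [measurable]: "gh k \<in> borel_measurable borel" for k using gh' by blast
    define H where "H k = W * (2 powr (- 2 * of_int k * s) * N k)" for k
    have H0: "H k \<ge> 0" for k unfolding H_def using W N(1) by simp
    have gh2: "(nn_sq lborel (gh k)) \<le> ennreal (H k)" for k
      using gh' W N(1)[of k] unfolding H_def by (subst ennreal_mult) auto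
    have pair: "(\<integral>x. piece u k x * fourier \<psi> x \<partial>lborel) = (\<integral>x. gh k x * \<psi> x \<partial>lborel)" if "\<psi> \<in> schwartz" for k \<psi>
      using gh' that by blast
    let ?g = "glue gh"
    have gm [measurable]: "?g \<in> borel_measurable borel" by (rule glue_measurable) (rule ghm)
    have wm [measurable]: "wide k \<in> borel_measurable borel" for k by (intro schwartz_measurable wide_schwartz)
    have piece: "(\<integral>\<^sup>+x. ennreal ((5 * norm (wide k x * gh k x)) powr p) \<partial>lborel) \<le> ennreal T * ennreal (2 powr (- of_int k * \<beta>) * N k powr q)" for k
    proof -
      define m where "m = V * 2 powr (of_int k * real DIM('a))"
      have m: "m > 0" unfolding m_def using V by simp
      have "(\<integral>\<^sup>+x. ennreal ((5 * norm (wide k x * gh k x)) powr p) \<partial>lborel)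
         \<le> (\<integral>\<^sup>+x. ennreal (5 powr p) * (ennreal (norm (gh k x) powr p) * indicator (cball 0 (8 * dyadic k)) x) \<partial>lborel)"
      proof (rule nn_integral_mono)
        fix x
        show "ennreal ((5 * norm (wide k x * gh k x)) powr p) \<le> ennreal (5 powr p) * (ennreal (norm (gh k x) powr p) * indicator (cball 0 (8 * dyadic k)) x)"
        proof (cases "wide k x = 0")
          case False
          then have x: "x \<in> cball 0 (8 * dyadic k)" using wide_support(2) by simp
          have "norm (wide k x * gh k x) \<le> norm (gh k x)"
            unfolding norm_mult by (intro mult_left_le_one_le norm_wide_le) auto
          then have "(5 * norm (wide k x * gh k x)) powr p \<le> (5 * norm (gh k x)) powr p" using p by (intro powr_mono2) auto
          also have "\<dots> = 5 powr p * norm (gh k x) powr p" by (simp add: powr_mult)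
          finally show ?thesis using x by (simp add: ennreal_leI flip: ennreal_mult)
        qed simp
      qed
      also have "\<dots> = ennreal (5 powr p) * (\<integral>\<^sup>+x. ennreal (norm (gh k x) powr p) * indicator (cball 0 (8 * dyadic k)) x \<partial>lborel)"
        by (rule nn_integral_cmult) measurable
      also have "\<dots> \<le> ennreal (5 powr p) * ennreal (2 * m powr (1 - p / 2) * H k powr (p / 2))"
      proof (intro mult_left_mono nn_integral_powr_le_L2)
        show "emeasure lborel (cball (0::'a) (8 * dyadic k)) \<le> ennreal m" unfolding m_def V_def by (rule emeasure_cball_dyadic)
      qed (use p m gh2 H0 in auto)
      also have "\<dots> = ennreal (T * (2 powr (- of_int k * \<beta>) * N k powr q))"
      proof -
        have "m powr (1 - q) = V powr (1 - q) * 2 powr (of_int k * \<beta>)"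
          unfolding m_def \<beta>_def using V by (simp add: powr_mult powr_powr mult.assoc)
        moreover have "H k powr q = W powr q * 2 powr (- 2 * of_int k * \<beta>) * N k powr q"
        proof -
          \<comment> \<open>The value of \<open>s\<close> enters here: the ball gives
            \<open>2 powr (k * \<beta>)\<close>, removing the weight gives
            \<open>2 powr (- 2 * k * \<beta>)\<close>, and the product is the power of 2 in
            \<open>sumN\<close>.\<close>
          have sq: "s * q = \<beta>" unfolding s \<beta>_def q_def using p by (simp add: field_simps)
          have "(2 powr (- 2 * of_int k * s)) powr q = 2 powr (- 2 * of_int k * (s * q))" by (simp add: powr_powr mult.assoc)
          then show ?thesis unfolding H_def sq using W N(1)[of k] by (simp add: powr_mult)
        qed
        ultimately have "5 powr p * (2 * m powr (1 - q) * H k powr q)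
           = T * ((2 powr (of_int k * \<beta>) * 2 powr (- 2 * of_int k * \<beta>)) * N k powr q)"
          unfolding T_def by simp
        also have "2 powr (of_int k * \<beta>) * 2 powr (- 2 * of_int k * \<beta>) = 2 powr (- of_int k * \<beta>)"
          unfolding powr_add[symmetric] by (simp add: mult.commute)
        finally have "5 powr p * (2 * m powr (1 - q) * H k powr q) = T * (2 powr (- of_int k * \<beta>) * N k powr q)" .
        then show ?thesis unfolding q_def[symmetric] by (subst ennreal_mult[symmetric]) auto
      qed
      finally show ?thesis using T by (simp add: ennreal_mult)
    qed
    have gp: "(\<integral>\<^sup>+x. ennreal (norm (?g x) powr p) \<partial>lborel) \<le> ennreal (T * J) * X"
    proof -
      have "(\<integral>\<^sup>+x. ennreal (norm (?g x) powr p) \<partial>lborel)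
         \<le> (\<integral>\<^sup>+x. (\<integral>\<^sup>+k. ennreal ((5 * norm (wide k x * gh k x)) powr p) \<partial>count_space UNIV) \<partial>lborel)"
        using p by (intro nn_integral_mono glue_powr_le) auto
      also have "\<dots> = (\<integral>\<^sup>+k. (\<integral>\<^sup>+x. ennreal ((5 * norm (wide k x * gh k x)) powr p) \<partial>lborel) \<partial>count_space UNIV)"
        by (rule nn_integral_count_space_nn_integral) measurable
      also have "\<dots> \<le> (\<integral>\<^sup>+k. ennreal T * ennreal (2 powr (- of_int k * \<beta>) * N k powr q) \<partial>count_space UNIV)"
        by (intro nn_integral_mono piece)
      also have "\<dots> = ennreal T * (\<integral>\<^sup>+k. ennreal (2 powr (- of_int k * \<beta>) * N k powr q) \<partial>count_space UNIV)"
        by (rule nn_integral_cmult) simp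
      also have "\<dots> \<le> ennreal T * (ennreal J * X)" by (intro mult_left_mono sumN) simp
      also have "\<dots> = ennreal (T * J) * X" using T J by (simp add: ennreal_mult mult.assoc)
      finally show ?thesis .
    qed
    have norm: "Lp_norm p ?g \<le> ennreal C * sobolev_norm \<phi> p s u"
    proof -
      have "Lp_norm p ?g \<le> epowr (ennreal (T * J) * X) (1 / p)"
        unfolding Lp_norm_eq using p by (intro epowr_mono gp) auto
      also have "\<dots> = ennreal C * sobolev_norm \<phi> p s u"
        unfolding SX C_def using T J by (intro epowr_mult) auto
      finally show ?thesis .
    qed
    have "?g \<in> Lp p"
      unfolding Lp_def using order_le_less_trans[OF norm] fin by (simp add: ennreal_mult_less_top)
    moreover have "u (fourier \<psi>) = fun_distr ?g \<psi>"
      if "\<psi> \<in> schwartz" "compact (closure {x. \<psi> x \<noteq> 0})" "closure {x. \<psi> x \<noteq> 0} \<subseteq> - {0}" for \<psi>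
      unfolding fun_distr_def
      by (rule glue_pairing[OF u ghm _ pair that]) (rule order_le_less_trans[OF gh2], simp)
    ultimately show ?thesis using norm by blast
  qed
  show ?thesis using C main by blast
qed

end

theorem theorem1p12:
  fixes \<phi> :: "'a::euclidean_space \<Rightarrow> complex" and p s :: real
  assumes "lp_generator \<phi>"
    and "1 < p" and "p < 2"
    and "s = real DIM('a) * (2 / p - 1)"
  shows "\<exists>C::real. C > 0 \<and> (\<forall>F \<in> homog_sobolev \<phi> p s. \<exists>g \<in> Lp p.
      (\<forall>f\<in>F. distr_support (\<lambda>\<psi>. fourier_distr f \<psi> - fun_distr g \<psi>) \<subseteq> {0} \<and>
             Lp_norm p g \<le> ennreal C * sobolev_norm \<phi> p s f) \<and>
      (\<forall>g' \<in> Lp p. (\<forall>f\<in>F. distr_support (\<lambda>\<psi>. fourier_distr f \<psi> - fun_distr g' \<psi>) \<subseteq> {0}) \<longrightarrow>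
             (AE x in lborel. g' x = g x)))"
proof -
  interpret lp_gen \<phi> by unfold_locales (rule assms(1))
  note p = assms(2,3)
  let ?supp = "\<lambda>\<psi>::'a \<Rightarrow> complex. closure {x. \<psi> x \<noteq> 0}"
  obtain C where C: "C > 0" and main: "\<And>u. u \<in> tempered \<Longrightarrow> sobolev_norm \<phi> p s u < \<infinity> \<Longrightarrow> \<exists>g\<in>Lp p.
    (\<forall>\<psi>\<in>schwartz. compact (?supp \<psi>) \<and> ?supp \<psi> \<subseteq> - {0} \<longrightarrow> u (fourier \<psi>) = fun_distr g \<psi>) \<and>
    Lp_norm p g \<le> ennreal C * sobolev_norm \<phi> p s u"
    using fourier_bounded_on_sobolev[OF p assms(4)] by blast
  have unique: "AE x in lborel. g1 x = g2 x"
    if g: "g1 \<in> Lp p" "g2 \<in> Lp p" and loc: "\<And>x. x \<noteq> 0 \<Longrightarrow> \<exists>U. open U \<and> x \<in> U \<and>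
      (\<forall>\<psi>\<in>schwartz. compact (?supp \<psi>) \<and> ?supp \<psi> \<subseteq> U \<longrightarrow> fun_distr g1 \<psi> = fun_distr g2 \<psi>)" for g1 g2
    using p loc unfolding fun_distr_def
    by (intro AE_eq_if_local_pairing_eq Lp_schwartz_integrable[OF g(1)] Lp_schwartz_integrable[OF g(2)]) auto
  show ?thesis
  proof (intro exI[of _ C] conjI ballI C)
    fix F assume "F \<in> homog_sobolev \<phi> p s"
    then obtain f0 where f0: "f0 \<in> tempered" "sobolev_norm \<phi> p s f0 < \<infinity>" and F: "F = mod_poly `` {f0}"
      unfolding homog_sobolev_def by blast
    obtain g where g: "g \<in> Lp p" and gf0: "\<And>\<psi>. \<psi> \<in> schwartz \<Longrightarrow> compact (?supp \<psi>) \<Longrightarrow> ?supp \<psi> \<subseteq> - {0} \<Longrightarrow> f0 (fourier \<psi>) = fun_distr g \<psi>"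
      using main[OF f0] by blast
    have f0F: "f0 \<in> F"
    proof -
      have "polynomial_function (\<lambda>x::'a. 0 :: complex)" by (rule polynomial_function_const)
      moreover have "\<forall>f\<in>schwartz. f0 f - f0 f = fun_distr (\<lambda>x. 0) f" by (simp add: fun_distr_def)
      ultimately show ?thesis unfolding F mod_poly_def using f0(1) by blast
    qed
    \<comment> \<open>A representative differs from \<open>f0\<close> by a polynomial, which pairs
      to 0 with transforms of functions vanishing near 0. All representatives thus share one
      transform away from the origin.\<close>
    have Ff: "f (fourier \<psi>) = fun_distr g \<psi>"
      if f: "f \<in> F" and \<psi>: "\<psi> \<in> schwartz" "compact (?supp \<psi>)" "?supp \<psi> \<subseteq> - {0}" for f \<psi>
    proof -
      obtain P where P: "polynomial_function P" "\<And>f'. f' \<in> schwartz \<Longrightarrow> f0 f' - f f' = fun_distr P f'"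
        using f unfolding F mod_poly_def by blast
      have "open (- ?supp \<psi>)" "0 \<in> - ?supp \<psi>" using \<psi>(3) by auto
      then obtain r where r: "r > 0" "ball 0 r \<subseteq> - ?supp \<psi>" using open_contains_ball by blast
      have "\<psi> x = 0" if "norm x < r" for x
      proof -
        have "x \<in> ball 0 r" using that by simp
        then have "x \<in> - ?supp \<psi>" using r(2) by blast
        then show ?thesis using closure_subset[of "{x. \<psi> x \<noteq> 0}"] by auto
      qed
      then have "vanishes_near_0 \<psi>" using r(1) unfolding vanishes_near_0_def by blast
      then have "fun_distr P (fourier \<psi>) = 0"
        unfolding fun_distr_def by (rule integral_polynomial_fourier[OF P(1) \<psi>(1)])
      then have "f (fourier \<psi>) = f0 (fourier \<psi>)" using P(2)[OF fourier_schwartz[OF \<psi>(1)]] by simp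
      then show ?thesis using gf0[OF \<psi>] by simp
    qed
    show "\<exists>g \<in> Lp p.
      (\<forall>f\<in>F. distr_support (\<lambda>\<psi>. fourier_distr f \<psi> - fun_distr g \<psi>) \<subseteq> {0} \<and>
             Lp_norm p g \<le> ennreal C * sobolev_norm \<phi> p s f) \<and>
      (\<forall>g' \<in> Lp p. (\<forall>f\<in>F. distr_support (\<lambda>\<psi>. fourier_distr f \<psi> - fun_distr g' \<psi>) \<subseteq> {0}) \<longrightarrow>
             (AE x in lborel. g' x = g x))"
    proof (intro bexI[OF _ g] conjI ballI impI)
      fix f assume f: "f \<in> F"
      have "open (- {0::'a}) \<and> (\<forall>\<psi>\<in>schwartz. compact (?supp \<psi>) \<and> ?supp \<psi> \<subseteq> - {0} \<longrightarrow> fourier_distr f \<psi> - fun_distr g \<psi> = 0)"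
        using Ff[OF f] by (auto simp: fourier_distr_def)
      then show "distr_support (\<lambda>\<psi>. fourier_distr f \<psi> - fun_distr g \<psi>) \<subseteq> {0}"
        unfolding distr_support_def by blast
      have ft: "f \<in> tempered" using f unfolding F mod_poly_def by blast
      \<comment> \<open>The bound is transferred to each representative through uniqueness, not
        through an invariance of the norm: the estimate applied to \<open>f\<close> gives a function
        \<open>g2\<close>, which agrees with \<open>g\<close> almost everywhere because both
        represent the transform of \<open>f\<close> away from 0. If the norm of \<open>f\<close> is
        infinite, \<open>C > 0\<close> makes the right side infinite.\<close>
      show "Lp_norm p g \<le> ennreal C * sobolev_norm \<phi> p s f"
      proof (cases "sobolev_norm \<phi> p s f < \<infinity>")
        case True
        obtain g2 where g2: "g2 \<in> Lp p" "\<And>\<psi>. \<psi> \<in> schwartz \<Longrightarrow> compact (?supp \<psi>) \<Longrightarrow> ?supp \<psi> \<subseteq> - {0} \<Longrightarrow> f (fourier \<psi>) = fun_distr g2 \<psi>"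
          "Lp_norm p g2 \<le> ennreal C * sobolev_norm \<phi> p s f" using main[OF ft True] by blast
        have "AE x in lborel. g x = g2 x"
          by (rule unique[OF g g2(1)]) (use Ff[OF f] g2(2) in \<open>auto intro!: exI[of _ "- {0}"]\<close>)
        then have "Lp_norm p g = Lp_norm p g2"
          unfolding Lp_norm_eq by (intro arg_cong2[where f = epowr] nn_integral_cong_AE refl) auto
        then show ?thesis using g2(3) by simp
      next
        case False
        then show ?thesis using C by (simp add: not_less top_unique ennreal_mult_top)
      qed
    next
      fix g' assume g': "g' \<in> Lp p" "\<forall>f\<in>F. distr_support (\<lambda>\<psi>. fourier_distr f \<psi> - fun_distr g' \<psi>) \<subseteq> {0}"
      show "AE x in lborel. g' x = g x"
      proof (rule unique[OF g'(1) g])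
        fix x :: 'a assume x: "x \<noteq> 0"
        then have "x \<notin> distr_support (\<lambda>\<psi>. fourier_distr f0 \<psi> - fun_distr g' \<psi>)" using g'(2) f0F by blast
        then obtain U where U: "open U" "x \<in> U" "\<And>\<psi>. \<psi> \<in> schwartz \<Longrightarrow> compact (?supp \<psi>) \<Longrightarrow> ?supp \<psi> \<subseteq> U \<Longrightarrow> fourier_distr f0 \<psi> - fun_distr g' \<psi> = 0"
          unfolding distr_support_def by blast
        show "\<exists>U. open U \<and> x \<in> U \<and> (\<forall>\<psi>\<in>schwartz. compact (?supp \<psi>) \<and> ?supp \<psi> \<subseteq> U \<longrightarrow> fun_distr g' \<psi> = fun_distr g \<psi>)"
        \<comment> \<open>Removing the origin from \<open>U\<close> leaves test functions for which
          both identities are available: that of \<open>g'\<close>, valid on \<open>U\<close>, and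
          that of \<open>g\<close>, valid away from 0.\<close>
        proof (intro exI[of _ "U \<inter> - {0}"] conjI ballI impI)
          fix \<psi> :: "'a \<Rightarrow> complex" assume \<psi>: "\<psi> \<in> schwartz" "compact (?supp \<psi>) \<and> ?supp \<psi> \<subseteq> U \<inter> - {0}"
          then have "fourier_distr f0 \<psi> = fun_distr g' \<psi>" using U(3) by simp
          moreover have "fourier_distr f0 \<psi> = fun_distr g \<psi>" unfolding fourier_distr_def using gf0 \<psi> by simp
          ultimately show "fun_distr g' \<psi> = fun_distr g \<psi>" by simp
        qed (use U x in \<open>auto intro: open_Int\<close>)
      qed
    qed
  qed
qed

end
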